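(* The family $\{V_p:p\in\mathcal I\}$ of value functions defined in the context is the unique family $U=\{u_p:p\in\mathcal I\}$ of bounded and uniformly continuous functions on $\mathbb R^d\times[0,T]$ that solves the following problem: $u_{\bar p}=0$ and, for every $p\in\mathcal I$ with $p\neq\bar p$, $u_p$ is the unique bounded and uniformly continuous viscosity solution $u$ of $$\begin{cases}\max\{u(x,t)-\psi_p^U(x,t),\ -u_t(x,t)+\lambda u(x,t)+H^p(x,t,D_xu(x,t))\}=0,&(x,t)\in\mathbb R^d\times[0,T[,\\ u(x,T)=\psi_p^U(x,T),&x\in\mathbb R^d,\end{cases}$$ where $$\psi_p^U(x,t)=\inf_{p'\in\mathcal I_p}\big(C(x,p,p')+u_{p'}(x,t)\big),\qquad H^p(x,t,\xi)=\sup_{a\in A}\{-f(x,a,p)\cdot\xi-\ell(x,a,p,t)\}.$$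
   Context: Data. $N\ge1$ is an integer, $\mathcal I=\{0,1\}^N$, $\bar p=(1,\dots,1)\in\mathcal I$, $T>0$, $\lambda\ge0$, $A\subset\mathbb R^m$ is compact (nonempty), and $\mathcal A=\{\alpha:[0,+\infty[\to A \text{ measurable}\}$. For $p=(p^1,\dots,p^N)\in\mathcal I$, $$\mathcal I_p=\{\tilde p\in\mathcal I:\ p^i=1\Rightarrow\tilde p^i=1,\ \text{and there is } l \text{ with } p^l=0,\ \tilde p^l=1\},$$ so $\mathcal I_{\bar p}=\emptyset$. Assumptions. $f:\mathbb R^d\times A\times\mathcal I\to\mathbb R^d$ is continuous, bounded, and there is $L>0$ with $\|f(x,a,p)-f(y,a,p)\|\le L\|x-y\|$ for all $x,y\in\mathbb R^d$, $a\in A$, $p\in\mathcal I$. $\ell:\mathbb R^d\times A\times\mathcal I\times[0,T]\to[0,+\infty[$ is bounded, continuous, and uniformly continuous with respect to $x$ uniformly with respect to $(a,p,t)$. $C:\mathbb R^d\times\mathcal I\times\mathcal I\to[0,+\infty[$ is uniformly continuous with respect to $x\in\mathbb R^d$, uniformly with respect to $p\in\mathcal I$, $p'\in\mathcal I_p$. Value functions. Set $V_{\bar p}\equiv0$. Proceeding backwardly (by induction on the number of zeros of $p$), for $p\ne\bar p$ and $(x,t)\in\mathbb R^d\times[0,T]$ define $$V_p(x,t)=\inf_{\alpha\in\mathcal A,\ \tau\in[t,T],\ p'\in\mathcal I_p}\left(\int_t^{\tau}e^{-\lambda(s-t)}\ell(y(s),\alpha(s),p,s)\,ds+e^{-\lambda(\tau-t)}\big(C(y(\tau),p,p')+V_{p'}(y(\tau),\tau)\big)\right),$$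 where $y'(s)=f(y(s),\alpha(s),p)$ for a.e. $s\in\,]t,T]$, $y(t)=x$. Viscosity solutions. A continuous $u$ on $\mathbb R^d\times[0,T]$ is a viscosity solution of $\max\{u-\psi,\,-u_t+\lambda u+H(x,t,D_xu)\}=0$ in $\mathbb R^d\times[0,T[$ with $u(\cdot,T)=\psi(\cdot,T)$ if the terminal condition holds pointwise and, for every $\varphi\in C^1(\mathbb R^d\times[0,T])$: at every local maximum point $(x,t)\in\mathbb R^d\times[0,T[$ of $u-\varphi$ (relative to $\mathbb R^d\times[0,T[$), $\max\{u(x,t)-\psi(x,t),-\varphi_t(x,t)+\lambda u(x,t)+H(x,t,D_x\varphi(x,t))\}\le0$; and at every local minimum point of $u-\varphi$ the same expression is $\ge0$.
   Formalization: The switching cost C(x,p,p') is additionally assumed bounded above over x, p and p' in I_p; without this the claim fails, e.g. N=1, C(x,0,1)=|x| gives the unbounded value V_0(x,T)=|x|. *)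

theory Defs
  imports "HOL-Analysis.Analysis"
begin

text \<open>
  An element of \<open>{0,1}\<^sup>N\<close> is a function \<open>p :: 'n \<Rightarrow> bool\<close> on a finite index type with \<open>N\<close> elements,
  \<open>p i\<close> meaning \<open>p\<^sup>i = 1\<close>; its function-space topology is the discrete one. Functions on
  \<open>\<real>\<^sup>d \<times> [0,T]\<close> are total functions of type \<open>(real^'d) \<times> real \<Rightarrow> real\<close> of which only the values
  on \<open>spacetime T\<close> matter.
\<close>

definition pbar :: "'n \<Rightarrow> bool" where
  "pbar = (\<lambda>_. True)"

definition succs :: "('n \<Rightarrow> bool) \<Rightarrow> ('n \<Rightarrow> bool) set" where
  "succs p = {q. (\<forall>i. p i \<longrightarrow> q i) \<and> (\<exists>l. \<not> p l \<and> q l)}"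

definition spacetime :: "real \<Rightarrow> ((real^'d) \<times> real) set" where
  "spacetime T = UNIV \<times> {0..T}"

definition controls :: "(real^'m) set \<Rightarrow> (real \<Rightarrow> real^'m) set" where
  "controls A = {\<alpha>. \<alpha> \<in> borel_measurable (lebesgue_on {0..}) \<and> (\<forall>s\<ge>0. \<alpha> s \<in> A)}"

text \<open>A finite family of non-overlapping subintervals \<open>[u,v]\<close> is a finite set of pairs \<open>(u,v)\<close>.\<close>

definition abs_continuous_on :: "real \<Rightarrow> real \<Rightarrow> (real \<Rightarrow> 'a::real_normed_vector) \<Rightarrow> bool" where
  "abs_continuous_on a b y \<longleftrightarrow>
     (\<forall>e>0. \<exists>\<delta>>0. \<forall>D. finite D \<and> (\<forall>(u,v)\<in>D. a \<le> u \<and> u \<le> v \<and> v \<le> b)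
        \<and> pairwise (\<lambda>(u,v) (u',v'). {u<..<v} \<inter> {u'<..<v'} = {}) D
        \<and> (\<Sum>(u,v)\<in>D. v - u) < \<delta>
        \<longrightarrow> (\<Sum>(u,v)\<in>D. norm (y v - y u)) < e)"

text \<open>
  A solution of an ordinary differential equation that holds almost everywhere is understood in the
  sense of Caratheodory, that is, as an absolutely continuous function.
\<close>

definition trajectory ::
    "(real^'d \<Rightarrow> real^'m \<Rightarrow> ('n \<Rightarrow> bool) \<Rightarrow> real^'d) \<Rightarrow> real \<Rightarrow> ('n \<Rightarrow> bool) \<Rightarrow> real^'d \<Rightarrow> real
      \<Rightarrow> (real \<Rightarrow> real^'m) \<Rightarrow> (real \<Rightarrow> real^'d) \<Rightarrow> bool" where
  "trajectory f T p x t \<alpha> y \<longleftrightarrow>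
     abs_continuous_on t T y \<and> y t = x \<and>
     (AE s in lebesgue. s \<in> {t<..T} \<longrightarrow>
        (y has_vector_derivative f (y s) (\<alpha> s) p) (at s within {t..T}))"

lemma card_zeros_succs:
  fixes p q :: "'n::finite \<Rightarrow> bool"
  assumes "q \<in> succs p"
  shows "card {i. \<not> q i} < card {i. \<not> p i}"
  using assms by (intro psubset_card_mono) (auto simp: succs_def)

text \<open>
  The trajectory \<open>y\<close> appears among the variables of the infimum; on \<open>[t,T]\<close> it is determined
  by \<open>x\<close>, \<open>t\<close>, \<open>\<alpha>\<close> and \<open>p\<close> when \<open>f\<close> is bounded, continuous and Lipschitz in its first argument.
\<close>

function value_fun ::
    "(real^'d \<Rightarrow> real^'m \<Rightarrow> ('n::finite \<Rightarrow> bool) \<Rightarrow> real^'d)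
      \<Rightarrow> (real^'d \<Rightarrow> real^'m \<Rightarrow> ('n \<Rightarrow> bool) \<Rightarrow> real \<Rightarrow> real)
      \<Rightarrow> (real^'d \<Rightarrow> ('n \<Rightarrow> bool) \<Rightarrow> ('n \<Rightarrow> bool) \<Rightarrow> real)
      \<Rightarrow> (real^'m) set \<Rightarrow> real \<Rightarrow> real \<Rightarrow> ('n \<Rightarrow> bool) \<Rightarrow> (real^'d) \<times> real \<Rightarrow> real" where
  "value_fun f l C A lam T p (x,t) =
     (if p = pbar then 0
      else Inf ((\<lambda>(\<alpha>,y,\<tau>,p').
                   (LINT s:{t..\<tau>}|lebesgue. exp (- lam * (s - t)) * l (y s) (\<alpha> s) p s)
                   + exp (- lam * (\<tau> - t)) * (C (y \<tau>) p p' + value_fun f l C A lam T p' (y \<tau>, \<tau>)))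
                ` {(\<alpha>,y,\<tau>,p'). \<alpha> \<in> controls A \<and> trajectory f T p x t \<alpha> y
                                  \<and> \<tau> \<in> {t..T} \<and> p' \<in> succs p}))"
  by pat_completeness auto
termination
  by (relation "Wellfounded.measure (\<lambda>(f,l,C,A,lam,T,p,z). card {i. \<not> p i})") (auto intro: card_zeros_succs)

declare value_fun.simps [simp del]

definition hamiltonian ::
    "(real^'d \<Rightarrow> real^'m \<Rightarrow> ('n \<Rightarrow> bool) \<Rightarrow> real^'d)
      \<Rightarrow> (real^'d \<Rightarrow> real^'m \<Rightarrow> ('n \<Rightarrow> bool) \<Rightarrow> real \<Rightarrow> real) \<Rightarrow> (real^'m) set
      \<Rightarrow> ('n \<Rightarrow> bool) \<Rightarrow> real^'d \<Rightarrow> real \<Rightarrow> real^'d \<Rightarrow> real" where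
  "hamiltonian f l A p x t \<xi> = (SUP a\<in>A. - (f x a p \<bullet> \<xi>) - l x a p t)"

definition obstacle ::
    "(real^'d \<Rightarrow> ('n \<Rightarrow> bool) \<Rightarrow> ('n \<Rightarrow> bool) \<Rightarrow> real) \<Rightarrow> (('n \<Rightarrow> bool) \<Rightarrow> (real^'d) \<times> real \<Rightarrow> real)
      \<Rightarrow> ('n \<Rightarrow> bool) \<Rightarrow> (real^'d) \<times> real \<Rightarrow> real" where
  "obstacle C U p = (\<lambda>(x,t). INF p'\<in>succs p. C x p p' + U p' (x,t))"

text \<open>
  \<open>\<phi> \<in> C\<^sup>1(\<real>\<^sup>d \<times> [0,T])\<close> with spatial gradient \<open>g\<close> and time derivative \<open>q\<close>; both are unique on
  \<open>spacetime T\<close> when \<open>T > 0\<close>. The derivatives at times \<open>0\<close> and \<open>T\<close> are one-sided in time.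
\<close>

definition C1_with ::
    "real \<Rightarrow> ((real^'d) \<times> real \<Rightarrow> real) \<Rightarrow> ((real^'d) \<times> real \<Rightarrow> real^'d)
      \<Rightarrow> ((real^'d) \<times> real \<Rightarrow> real) \<Rightarrow> bool" where
  "C1_with T \<phi> g q \<longleftrightarrow>
     continuous_on (spacetime T) g \<and> continuous_on (spacetime T) q \<and>
     (\<forall>z\<in>spacetime T. (\<phi> has_derivative (\<lambda>(h,k). g z \<bullet> h + q z * k)) (at z within spacetime T))"

definition local_max_on :: "'a::topological_space set \<Rightarrow> ('a \<Rightarrow> real) \<Rightarrow> 'a \<Rightarrow> bool" where
  "local_max_on S w z \<longleftrightarrow> z \<in> S \<and> (\<forall>\<^sub>F z' in at z within S. w z' \<le> w z)"

definition local_min_on :: "'a::topological_space set \<Rightarrow> ('a \<Rightarrow> real) \<Rightarrow> 'a \<Rightarrow> bool" where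
  "local_min_on S w z \<longleftrightarrow> z \<in> S \<and> (\<forall>\<^sub>F z' in at z within S. w z \<le> w z')"

text \<open>
  Viscosity solution of \<open>max {u - \<psi>, - u\<^sub>t + lam u + H(x,t,D\<^sub>xu)} = 0\<close> in \<open>\<real>\<^sup>d \<times> [0,T[\<close> with
  \<open>u(\<cdot>,T) = \<psi>(\<cdot>,T)\<close>. The extrema are relative to \<open>\<real>\<^sup>d \<times> [0,T[\<close>, so points with \<open>t = 0\<close> are included.
\<close>

definition viscosity_solution ::
    "real \<Rightarrow> real \<Rightarrow> ((real^'d) \<times> real \<Rightarrow> real) \<Rightarrow> (real^'d \<Rightarrow> real \<Rightarrow> real^'d \<Rightarrow> real)
      \<Rightarrow> ((real^'d) \<times> real \<Rightarrow> real) \<Rightarrow> bool" where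
  "viscosity_solution T lam \<psi> H u \<longleftrightarrow>
     continuous_on (spacetime T) u \<and> (\<forall>x. u (x,T) = \<psi> (x,T)) \<and>
     (\<forall>\<phi> g q. C1_with T \<phi> g q \<longrightarrow>
       (\<forall>x t. local_max_on (UNIV \<times> {0..<T}) (\<lambda>z. u z - \<phi> z) (x,t) \<longrightarrow>
          max (u (x,t) - \<psi> (x,t)) (- q (x,t) + lam * u (x,t) + H x t (g (x,t))) \<le> 0) \<and>
       (\<forall>x t. local_min_on (UNIV \<times> {0..<T}) (\<lambda>z. u z - \<phi> z) (x,t) \<longrightarrow>
          max (u (x,t) - \<psi> (x,t)) (- q (x,t) + lam * u (x,t) + H x t (g (x,t))) \<ge> 0))"

definition BUC :: "real \<Rightarrow> ((real^'d) \<times> real \<Rightarrow> real) \<Rightarrow> bool" where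
  "BUC T u \<longleftrightarrow> bounded (u ` spacetime T) \<and> uniformly_continuous_on (spacetime T) u"

definition unique_BUC_viscosity_solution ::
    "real \<Rightarrow> real \<Rightarrow> ((real^'d) \<times> real \<Rightarrow> real) \<Rightarrow> (real^'d \<Rightarrow> real \<Rightarrow> real^'d \<Rightarrow> real)
      \<Rightarrow> ((real^'d) \<times> real \<Rightarrow> real) \<Rightarrow> bool" where
  "unique_BUC_viscosity_solution T lam \<psi> H u \<longleftrightarrow>
     BUC T u \<and> viscosity_solution T lam \<psi> H u \<and>
     (\<forall>v. BUC T v \<and> viscosity_solution T lam \<psi> H v \<longrightarrow> (\<forall>z\<in>spacetime T. v z = u z))"

definition solves_system ::
    "(real^'d \<Rightarrow> real^'m \<Rightarrow> ('n \<Rightarrow> bool) \<Rightarrow> real^'d)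
      \<Rightarrow> (real^'d \<Rightarrow> real^'m \<Rightarrow> ('n \<Rightarrow> bool) \<Rightarrow> real \<Rightarrow> real)
      \<Rightarrow> (real^'d \<Rightarrow> ('n \<Rightarrow> bool) \<Rightarrow> ('n \<Rightarrow> bool) \<Rightarrow> real)
      \<Rightarrow> (real^'m) set \<Rightarrow> real \<Rightarrow> real \<Rightarrow> (('n \<Rightarrow> bool) \<Rightarrow> (real^'d) \<times> real \<Rightarrow> real) \<Rightarrow> bool" where
  "solves_system f l C A lam T U \<longleftrightarrow>
     (\<forall>p. BUC T (U p)) \<and>
     (\<forall>z\<in>spacetime T. U pbar z = 0) \<and>
     (\<forall>p. p \<noteq> pbar \<longrightarrow>
        unique_BUC_viscosity_solution T lam (obstacle C U p) (hamiltonian f l A p) (U p))"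

text \<open>
  Without an upper bound on the switching costs \<open>C x p p'\<close> the value functions need not be bounded:
  for \<open>N = 1\<close>, \<open>p = 0\<close> and \<open>C x p pbar = \<bar>x\<bar>\<close> the terminal value \<open>V\<^sub>p(x,T)\<close> is \<open>\<bar>x\<bar>\<close>, and no family
  of bounded functions satisfies the terminal conditions. Boundedness of \<open>C\<close> is therefore to be
  assumed along with its uniform continuity.
\<close>

end

theory Submission imports Defs
begin

text \<open>
  The system is triangular: the obstacle \<open>\<psi>\<^sub>p\<close> involves only the functions \<open>u\<^sub>q\<close> with \<open>q \<in> succs p\<close>,
  and such \<open>q\<close> have fewer zeros than \<open>p\<close>. An induction on the number of zeros therefore reduces
  everything to a single mode \<open>p\<close> with a fixed obstacle \<open>\<psi>\<close> that is bounded and uniformly continuous.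
  In that mode switching is optimal stopping: the best successor at the stopping time is
  chosen pointwise, which turns \<open>C + V\<^sub>q\<close> into \<open>\<psi>\<close> (\<open>value_fun_eq_val\<close>). It remains to show that the
  value of the stopping problem is a bounded uniformly continuous viscosity solution and
  that there is at most one such solution.

  Existence. The value satisfies a dynamic programming principle. Its upper half
  (\<open>dynamic_programming_upper\<close>) follows by running an arbitrary control first and then switching to a
  competitor; its lower half (\<open>dynamic_programming_lower\<close>) because the rest of a trajectory competes at
  a later time. Uniform continuity follows from Gronwall's inequality in space and from the
  principle itself in time (\<open>val_BUC\<close>). For the equation, the principle is combined
  with a first-order expansion of a test function along trajectories that is uniform in the control
  (\<open>first_order_expansion\<close>); constant controls give the subsolution inequality, near-optimal ones
  the supersolution inequality, since stopping soon cannot be near-optimal where the value lies below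
  the obstacle. All of this looks forward in time only, so \<open>t = 0\<close> needs no special care.

  Trajectories are absolutely continuous curves that satisfy the differential equation almost
  everywhere. The arguments above use the equivalent integral equation (\<open>trajectory_iff\<close>), which makes
  existence, concatenation and restriction easy. One direction of the equivalence is the fundamental
  theorem of calculus for absolutely continuous functions, the other one Lebesgue's differentiation
  theorem in one variable.

  Uniqueness. The comparison principle (\<open>comparison\<close>) is proved by doubling the variables. The extrema
  in the definition of a solution are relative to \<open>\<real>\<^sup>d \<times> [0,T[\<close>, hence only \<open>t = T\<close> is a boundary, and
  there two solutions agree. A maximum point at which the supersolution reaches the obstacle is harmless
  because the subsolution stays below the same uniformly continuous obstacle; at any other maximum point
  the two differential inequalities contradict each other.
\<close>

section \<open>Absolutely continuous functions and indefinite integrals\<close>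

text \<open>
  The exceptional set of the differentiation theorem below is covered finely, in Vitali's sense, by
  intervals on which the integral of \<open>g\<close> is far from the Riemann term with the tag at an endpoint. Finitely
  many disjoint ones among them form a partial tagged division, so Henstock's lemma makes their total length
  as small as desired.
\<close>

lemma negligible_henstock_discrepancy:
  fixes g :: "real \<Rightarrow> 'a::euclidean_space"
  assumes g: "g integrable_on {a..b}" and c: "0 < c"
  shows "negligible {x. \<forall>\<delta>>0. \<exists>u v. a < u \<and> u < v \<and> v < b \<and> v - u < \<delta> \<and> (x = u \<or> x = v) \<and>
            c * (v - u) < norm ((v - u) *\<^sub>R g x - integral {u..v} g)}" (is "negligible ?B")
  unfolding negligible_outer_le
proof (intro allI impI)
  fix e :: real assume "0 < e"
  have "g integrable_on cbox a b" "0 < e * c" using g c \<open>0 < e\<close> by auto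
  then obtain \<gamma> where \<gamma>: "gauge \<gamma>" and hen: "\<And>p. \<lbrakk>p tagged_partial_division_of (cbox a b); \<gamma> fine p\<rbrakk> \<Longrightarrow>
             sum (\<lambda>(x,k). norm(measure lborel k *\<^sub>R g x - integral k g)) p < e * c"
    by (rule Henstock_lemma) (rule that)
  \<comment> \<open>Only intervals inside the gauge at their tag are used, so that Henstock's lemma applies to them.\<close>
  define K where "K = {(u,v,x). a < u \<and> u < v \<and> v < b \<and> (x = u \<or> x = v) \<and> {u..v} \<subseteq> \<gamma> x \<and>
            c * (v - u) < norm ((v - u) *\<^sub>R g x - integral {u..v} g)}"
  define I where "I = (\<lambda>(u,v,x::real). {u..v::real})"
  define cen rad where "cen = (\<lambda>(u,v,x::real). (u + v) / 2 :: real)" and "rad = (\<lambda>(u,v,x::real). (v - u) / 2 :: real)"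
  have I_eq: "cball (cen i) (rad i) = I i" for i
    by (cases i) (auto simp: cen_def rad_def I_def cball_eq_atLeastAtMost field_simps)
  have K_pos: "0 < rad i" if "i \<in> K" for i
    using that by (auto simp: K_def rad_def)
  have cover: "\<exists>i. i \<in> K \<and> x \<in> cball (cen i) (rad i) \<and> rad i < d" if x: "x \<in> ?B" and "0 < d" for x d
  proof -
    have "open (\<gamma> x)" "x \<in> \<gamma> x" using \<gamma> by (auto simp: gauge_def)
    then obtain r where r: "0 < r" "cball x r \<subseteq> \<gamma> x" by (meson open_contains_cball)
    from x have "\<forall>\<delta>>0. \<exists>u v. a < u \<and> u < v \<and> v < b \<and> v - u < \<delta> \<and> (x = u \<or> x = v) \<and>
            c * (v - u) < norm ((v - u) *\<^sub>R g x - integral {u..v} g)" by simp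
    from this[rule_format, of "min r d"] r \<open>0 < d\<close>
    obtain u v where uv: "a < u" "u < v" "v < b" "v - u < min r d" "x = u \<or> x = v"
            "c * (v - u) < norm ((v - u) *\<^sub>R g x - integral {u..v} g)" by auto
    have "{u..v} \<subseteq> cball x r" using uv by (auto simp: dist_real_def)
    then have "(u,v,x) \<in> K" using uv r by (auto simp: K_def)
    moreover have "x \<in> cball (cen (u,v,x)) (rad (u,v,x))" unfolding I_eq using uv by (auto simp: I_def)
    moreover have "rad (u,v,x) < d" using uv by (auto simp: rad_def)
    ultimately show ?thesis by blast
  qed
  obtain Q where Q: "countable Q" "Q \<subseteq> K"
     and disj: "pairwise (\<lambda>i j. disjnt (cball (cen i) (rad i)) (cball (cen j) (rad j))) Q"
     and neg: "negligible (?B - (\<Union>i\<in>Q. cball (cen i) (rad i)))"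
    using Vitali_covering_theorem_cballs[of K rad ?B cen, OF K_pos cover] by blast
  have bound: "measure lebesgue (\<Union>i\<in>F. I i) \<le> e" if F: "F \<subseteq> Q" "finite F" for F
  proof -
    define tag where "tag = (\<lambda>i::real\<times>real\<times>real. (snd (snd i), I i))"
    have disjI: "I i \<inter> I j = {}" if "i \<in> F" "j \<in> F" "i \<noteq> j" for i j
      using disj that F unfolding pairwise_def I_eq disjnt_def by blast
    have FK: "i \<in> K" if "i \<in> F" for i using that F Q by auto
    have ne: "I i \<noteq> {}" if "i \<in> F" for i using FK[OF that] by (auto simp: I_def K_def)
    have inj: "inj_on tag F"
    proof (rule inj_onI, rule ccontr)
      fix i j assume ij: "i \<in> F" "j \<in> F" "tag i = tag j" "i \<noteq> j"
      then have "I i = I j" by (simp add: tag_def)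
      then show False using disjI[OF ij(1,2,4)] ne[OF ij(1)] by simp
    qed
    have "tag ` F tagged_partial_division_of (cbox a b)"
      unfolding tagged_partial_division_of_def
    proof (intro conjI allI impI)
      show "finite (tag ` F)" using F by simp
      fix x J assume "(x, J) \<in> tag ` F"
      then obtain i where i: "i \<in> F" "x = snd (snd i)" "J = I i" by (auto simp: tag_def)
      show "x \<in> J" "J \<subseteq> cbox a b" "\<exists>a b. J = cbox a b"
        using FK[OF i(1)] i(2,3) by (cases i; auto simp: K_def I_def intro!: exI)+
    next
      fix x1 J1 x2 J2 assume "(x1, J1) \<in> tag ` F \<and> (x2, J2) \<in> tag ` F \<and> (x1, J1) \<noteq> (x2, J2)"
      then have *: "(x1, J1) \<in> tag ` F" "(x2, J2) \<in> tag ` F" "(x1, J1) \<noteq> (x2, J2)" by auto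
      obtain i where i: "(x1, J1) = tag i" "i \<in> F" using *(1) by (rule imageE)
      obtain j where j: "(x2, J2) = tag j" "j \<in> F" using *(2) by (rule imageE)
      have "i \<noteq> j" using * i j by auto
      with i j have ij: "i \<in> F" "j \<in> F" "J1 = I i" "J2 = I j" "i \<noteq> j" by (auto simp: tag_def)
      have "J1 \<inter> J2 = {}" using disjI[OF ij(1,2,5)] ij(3,4) by simp
      then show "interior J1 \<inter> interior J2 = {}" using interior_subset by blast
    qed
    moreover have "\<gamma> fine (tag ` F)"
    proof (rule fineI)
      fix x J assume "(x, J) \<in> tag ` F"
      then obtain i where i: "i \<in> F" "x = snd (snd i)" "J = I i" by (auto simp: tag_def)
      then show "J \<subseteq> \<gamma> x" using FK[OF i(1)] by (cases i) (auto simp: K_def I_def)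
    qed
    ultimately have "sum (\<lambda>(x,k). norm(measure lborel k *\<^sub>R g x - integral k g)) (tag ` F) < e * c"
      by (rule hen)
    then have le: "(\<Sum>i\<in>F. norm (measure lborel (I i) *\<^sub>R g (snd (snd i)) - integral (I i) g)) < e * c"
      unfolding sum.reindex[OF inj] by (simp add: tag_def split_def o_def)
    have "c * measure lebesgue (\<Union>i\<in>F. I i) \<le> c * (\<Sum>i\<in>F. measure lebesgue (I i))"
      using c by (intro mult_left_mono measure_UNION_le F) (auto simp: I_def split: prod.splits)
    also have "\<dots> = (\<Sum>i\<in>F. c * measure lebesgue (I i))" by (simp add: sum_distrib_left)
    also have "\<dots> \<le> (\<Sum>i\<in>F. norm (measure lborel (I i) *\<^sub>R g (snd (snd i)) - integral (I i) g))"
    proof (rule sum_mono)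
      fix i assume "i \<in> F"
      from FK[OF this] show "c * measure lebesgue (I i) \<le> norm (measure lborel (I i) *\<^sub>R g (snd (snd i)) - integral (I i) g)"
        by (cases i) (auto simp: K_def I_def)
    qed
    also note le
    finally show ?thesis using c by (simp add: mult.commute)
  qed
  have meas: "I i \<in> lmeasurable" for i by (cases i) (simp add: I_def)
  have U: "(\<Union>i\<in>Q. I i) \<in> lmeasurable" "measure lebesgue (\<Union>i\<in>Q. I i) \<le> e"
    using fmeasurable_UN_bound[OF Q(1) meas bound] measure_UN_bound[OF Q(1) meas bound] by blast+
  have negI: "negligible (?B - (\<Union>i\<in>Q. I i))" using neg by (simp add: I_eq)
  show "\<exists>T. ?B \<subseteq> T \<and> T \<in> lmeasurable \<and> measure lebesgue T \<le> e"
  proof (intro exI conjI)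
    show "?B \<subseteq> (\<Union>i\<in>Q. I i) \<union> (?B - (\<Union>i\<in>Q. I i))" by auto
    show "(\<Union>i\<in>Q. I i) \<union> (?B - (\<Union>i\<in>Q. I i)) \<in> lmeasurable"
      by (intro fmeasurable.Un U negligible_imp_measurable negI)
    have "measure lebesgue ((\<Union>i\<in>Q. I i) \<union> (?B - (\<Union>i\<in>Q. I i))) \<le> measure lebesgue (\<Union>i\<in>Q. I i) + measure lebesgue (?B - (\<Union>i\<in>Q. I i))"
      by (intro measure_Un_le fmeasurableD U negligible_imp_measurable negI)
    then show "measure lebesgue ((\<Union>i\<in>Q. I i) \<union> (?B - (\<Union>i\<in>Q. I i))) \<le> e"
      using U negligible_imp_measure0[OF negI] by simp
  qed
qed

text \<open>
  Lebesgue's differentiation theorem on an interval: a point where the difference quotients do not converge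
  to \<open>g x\<close> is bad for some discrepancy \<open>1 / (k + 1)\<close>, and countably many negligible sets are negligible.
\<close>

lemma indefinite_integral_has_vector_derivative_AE:
  fixes g :: "real \<Rightarrow> 'a::euclidean_space"
  assumes g: "g integrable_on {a..b}"
  shows "AE x in lebesgue. x \<in> {a..b} \<longrightarrow>
           ((\<lambda>s. integral {a..s} g) has_vector_derivative g x) (at x within {a..b})"
proof -
  define B where "B c = {x. \<forall>\<delta>>0. \<exists>u v. a < u \<and> u < v \<and> v < b \<and> v - u < \<delta> \<and> (x = u \<or> x = v) \<and>
            c * (v - u) < norm ((v - u) *\<^sub>R g x - integral {u..v} g)}" for c
  define N where "N = {a, b} \<union> (\<Union>k. B (1 / real (Suc k)))"
  have "negligible (B (1 / real (Suc k)))" for k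
    unfolding B_def by (rule negligible_henstock_discrepancy[OF g]) simp
  then have "negligible N"
    unfolding N_def by (intro negligible_Un negligible_countable_Union countable_image) auto
  then have "N \<in> null_sets lebesgue" by (simp add: negligible_iff_null_sets)
  moreover have "((\<lambda>s. integral {a..s} g) has_vector_derivative g x) (at x within {a..b})"
    if x: "x \<in> {a..b}" "x \<notin> N" for x
    unfolding has_vector_derivative_def has_derivative_within_alt
  proof (intro conjI allI impI)
    show "bounded_linear (\<lambda>h. h *\<^sub>R g x)" by (rule bounded_linear_scaleR_left)
    fix e :: real assume "0 < e"
    then obtain k where k: "1 / real (Suc k) < e" using nat_approx_posE by blast
    have xab: "a < x" "x < b" using x by (auto simp: N_def less_le)
    have "x \<notin> B (1 / real (Suc k))" using x by (auto simp: N_def)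
    then obtain \<delta> where "\<delta> > 0" and \<delta>: "\<And>u v. a < u \<Longrightarrow> u < v \<Longrightarrow> v < b \<Longrightarrow> v - u < \<delta> \<Longrightarrow> (x = u \<or> x = v) \<Longrightarrow>
            norm ((v - u) *\<^sub>R g x - integral {u..v} g) \<le> 1 / real (Suc k) * (v - u)"
      unfolding B_def by (force simp: not_less)
    have int: "g integrable_on {a..s}" if "s \<le> b" for s
      by (rule integrable_on_subinterval[OF g]) (use that in auto)
    show "\<exists>d>0. \<forall>y\<in>{a..b}. norm (y - x) < d \<longrightarrow>
        norm (integral {a..y} g - integral {a..x} g - (y - x) *\<^sub>R g x) \<le> e * norm (y - x)"
    proof (intro exI[of _ "Min {\<delta>, x - a, b - x}"] conjI ballI impI)
      show "0 < Min {\<delta>, x - a, b - x}" using xab \<open>\<delta> > 0\<close> by auto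
      fix y assume "norm (y - x) < Min {\<delta>, x - a, b - x}"
      then have y: "\<bar>y - x\<bar> < \<delta>" "a < y" "y < b" by auto
      have ek: "1 / real (Suc k) * \<bar>y - x\<bar> \<le> e * \<bar>y - x\<bar>" using k by (intro mult_right_mono) auto
      consider "y = x" | "y < x" | "x < y" by linarith
      then show "norm (integral {a..y} g - integral {a..x} g - (y - x) *\<^sub>R g x) \<le> e * norm (y - x)"
      proof cases
        case 1 then show ?thesis by simp
      next
        case 2
        have "integral {a..y} g + integral {y..x} g = integral {a..x} g"
          using 2 y xab by (intro Henstock_Kurzweil_Integration.integral_combine int) auto
        then have "integral {a..y} g - integral {a..x} g - (y - x) *\<^sub>R g x = (x - y) *\<^sub>R g x - integral {y..x} g"
          by (simp add: algebra_simps)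
        then show ?thesis using \<delta>[of y x] 2 y xab ek by auto
      next
        case 3
        have "integral {a..x} g + integral {x..y} g = integral {a..y} g"
          using 3 y xab by (intro Henstock_Kurzweil_Integration.integral_combine int) auto
        then have "integral {a..y} g - integral {a..x} g - (y - x) *\<^sub>R g x = - ((y - x) *\<^sub>R g x - integral {x..y} g)"
          by (simp add: algebra_simps)
        then show ?thesis using \<delta>[of x y] 3 y xab ek by (auto simp: norm_minus_commute)
      qed
    qed
  qed
  ultimately show ?thesis by (intro AE_I'[of N]) auto
qed


text \<open>
  The fundamental theorem of calculus for absolutely continuous functions. The gauge is the derivative gauge
  off a null set \<open>N\<close> and a single open set of small measure around \<open>N\<close>. Tags off \<open>N\<close> contribute a small
  error as in the classical theorem; the intervals with tags in \<open>N\<close> have small total length, so absolute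
  continuity bounds the increments of \<open>y\<close> over them.
\<close>

lemma abs_continuous_on_has_integral:
  fixes y :: "real \<Rightarrow> 'a::euclidean_space"
  assumes ab: "a \<le> b" and ac: "abs_continuous_on a b y"
    and der: "AE s in lebesgue. s \<in> {a<..b} \<longrightarrow> (y has_vector_derivative g s) (at s within {a..b})"
  shows "(g has_integral (y b - y a)) {a..b}"
proof -
  obtain N0 where N0: "N0 \<in> null_sets lebesgue"
    and derN0: "\<And>s. s \<in> {a<..b} \<Longrightarrow> s \<notin> N0 \<Longrightarrow> (y has_vector_derivative g s) (at s within {a..b})"
    using der unfolding eventually_ae_filter by auto
  \<comment> \<open>The derivative is assumed on \<open>]a,b]\<close> only, so the left endpoint joins the null set.\<close>
  define N where "N = insert a N0"
  have negN: "negligible N" using N0 by (simp add: N_def negligible_iff_null_sets)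
  define g' where "g' = (\<lambda>s. if s \<in> N then 0 else g s)"
  have "(g' has_integral (y b - y a)) (cbox a b)"
    unfolding has_integral
  proof (intro allI impI)
    fix e :: real assume "0 < e"
    define e1 where "e1 = e / (2 * (b - a + 1))"
    have e1: "0 < e1" "e1 * (b - a) \<le> e / 2"
      using \<open>0 < e\<close> ab by (auto simp: e1_def field_simps)
    have "\<exists>d>0. s \<in> {a..b} - N \<longrightarrow> (\<forall>r\<in>{a..b}. norm (r - s) < d \<longrightarrow> norm (y r - y s - (r - s) *\<^sub>R g s) \<le> e1 * norm (r - s))" for s
    proof (cases "s \<in> {a..b} - N")
      case True
      then have "(y has_vector_derivative g s) (at s within {a..b})" by (intro derN0) (auto simp: N_def less_le)
      then show ?thesis unfolding has_vector_derivative_def has_derivative_within_alt using e1 by blast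
    qed (auto intro: exI[of _ 1])
    then obtain d where d0: "\<And>s. 0 < d s" and d: "\<And>s r. s \<in> {a..b} \<Longrightarrow> s \<notin> N \<Longrightarrow> r \<in> {a..b} \<Longrightarrow> norm (r - s) < d s \<Longrightarrow>
          norm (y r - y s - (r - s) *\<^sub>R g s) \<le> e1 * norm (r - s)"
      by (metis DiffI)
    obtain \<delta> where "\<delta> > 0" and \<delta>: "\<And>D. finite D \<Longrightarrow> (\<forall>(u,v)\<in>D. a \<le> u \<and> u \<le> v \<and> v \<le> b) \<Longrightarrow>
        pairwise (\<lambda>(u,v) (u',v'). {u<..<v} \<inter> {u'<..<v'} = {}) D \<Longrightarrow> (\<Sum>(u,v)\<in>D. v - u) < \<delta>
        \<Longrightarrow> (\<Sum>(u,v)\<in>D. norm (y v - y u)) < e / 2"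
      using ac[unfolded abs_continuous_on_def, rule_format, of "e / 2"] \<open>0 < e\<close> by auto
    obtain U where U: "open U" "N \<subseteq> U" "(U - N) \<in> lmeasurable" "emeasure lebesgue (U - N) < ennreal \<delta>"
      using sets_lebesgue_outer_open[of N \<delta>] negligible_imp_sets[OF negN] \<open>\<delta> > 0\<close> by blast
    have Um: "U \<in> lmeasurable"
      using fmeasurable.Un[OF U(3) negligible_imp_measurable[OF negN]] U(2) by (simp add: Un_absorb2)
    have "measure lebesgue U \<le> measure lebesgue (U - N) + measure lebesgue N"
      using measure_Un_le[of "U - N" lebesgue N] U negligible_imp_sets[OF negN] by (simp add: Un_absorb2 fmeasurableD)
    also have "\<dots> < \<delta>"
      using U(4) \<open>\<delta> > 0\<close> negligible_imp_measure0[OF negN] U(3) by (simp add: emeasure_eq_measure2 ennreal_less_iff)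
    finally have mU: "measure lebesgue U < \<delta>" .
    define \<gamma> where "\<gamma> = (\<lambda>s. if s \<in> N then U else ball s (d s))"
    have gauge: "gauge \<gamma>" using U d0 by (auto simp: gauge_def \<gamma>_def)
    have close: "norm ((\<Sum>(x,K)\<in>p. measure lborel K *\<^sub>R g' x) - (y b - y a)) < e"
      if p: "p tagged_division_of cbox a b" and fine: "\<gamma> fine p" for p
    proof -
      have fin: "finite p" using p by blast
      have pK: "\<exists>u v. K = {u..v} \<and> u \<le> v \<and> a \<le> u \<and> v \<le> b \<and> u \<le> x \<and> x \<le> v" if "(x,K) \<in> p" for x K
        using tagged_division_ofD(2,3,4)[OF p that] by (metis atLeastAtMost_iff atLeastatMost_subset_iff box_real(2) order_trans)
      define t where "t = (\<lambda>(x,K). measure lborel K *\<^sub>R g' x - (y (Sup K) - y (Inf K)))"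
      define p1 p2 where "p1 = {(x,K)\<in>p. x \<in> N}" and "p2 = {(x,K)\<in>p. x \<notin> N}"
      have split: "p = p1 \<union> p2" "p1 \<inter> p2 = {}" "finite p1" "finite p2"
        using fin by (auto simp: p1_def p2_def intro: finite_subset[of _ p])
      have "(\<Sum>(x,K)\<in>p. measure lborel K *\<^sub>R g' x) - (y b - y a) = sum t p"
        using additive_tagged_division_1[OF ab, of p y] p by (simp add: t_def split_def sum_subtractf)
      also have "\<dots> = sum t p1 + sum t p2" using split by (simp add: sum.union_disjoint)
      finally have eq: "(\<Sum>(x,K)\<in>p. measure lborel K *\<^sub>R g' x) - (y b - y a) = sum t p1 + sum t p2" .
      have "norm (sum t p2) \<le> (\<Sum>(x,K)\<in>p2. e1 * (Sup K - Inf K))"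
      proof (rule sum_norm_le, safe)
        fix x K assume xK: "(x,K) \<in> p2"
        then have xp: "(x,K) \<in> p" "x \<notin> N" by (auto simp: p2_def)
        obtain u v where uv: "K = {u..v}" "u \<le> v" "a \<le> u" "v \<le> b" "u \<le> x" "x \<le> v" using pK[OF xp(1)] by blast
        have "K \<subseteq> ball x (d x)" using fineD[OF fine xp(1)] xp(2) by (simp add: \<gamma>_def)
        then have "u \<in> ball x (d x)" "v \<in> ball x (d x)"
          unfolding uv(1) using uv(5,6) by (meson atLeastAtMost_iff order_refl order_trans subsetD)+
        then have du: "norm (y u - y x - (u - x) *\<^sub>R g x) \<le> e1 * norm (u - x)"
          and dv: "norm (y v - y x - (v - x) *\<^sub>R g x) \<le> e1 * norm (v - x)"
          using d[of x u] d[of x v] uv xp by (auto simp: dist_real_def)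
        have "norm (t (x,K)) = norm ((y u - y x - (u - x) *\<^sub>R g x) - (y v - y x - (v - x) *\<^sub>R g x))"
          using uv xp by (simp add: t_def g'_def algebra_simps)
        also have "\<dots> \<le> e1 * norm (u - x) + e1 * norm (v - x)"
          using norm_triangle_ineq4 du dv by (meson add_mono order_trans)
        also have "\<dots> = e1 * (Sup K - Inf K)" using uv by (simp add: algebra_simps)
        finally show "norm (t (x,K)) \<le> e1 * (Sup K - Inf K)" .
      qed
      also have "\<dots> \<le> (\<Sum>(x,K)\<in>p. e1 * (Sup K - Inf K))"
      proof (rule sum_mono2[OF fin])
        show "p2 \<subseteq> p" by (auto simp: p2_def)
        fix b assume "b \<in> p - p2"
        then show "0 \<le> (case b of (x, K) \<Rightarrow> e1 * (Sup K - Inf K))"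
          using pK e1 by (cases b) (fastforce)
      qed
      also have "\<dots> = e1 * (b - a)"
        using additive_tagged_division_1[OF ab, of p "\<lambda>x. x"] p by (simp add: split_def flip: sum_distrib_left)
      also have "\<dots> \<le> e / 2" by (rule e1)
      finally have n2: "norm (sum t p2) \<le> e / 2" .
      \<comment> \<open>Degenerate intervals carry no increment of \<open>y\<close>. Without them, distinct intervals have distinct endpoints,
        which allows passing from tagged intervals to pairs of endpoints.\<close>
      define p3 where "p3 = {(x,K)\<in>p1. Inf K < Sup K}"
      define io where "io = (\<lambda>(x::real,K::real set). (Inf K, Sup K))"
      have p3: "(x,K) \<in> p \<and> x \<in> N \<and> (\<exists>u v. K = {u..v} \<and> u < v \<and> a \<le> u \<and> v \<le> b \<and> io (x,K) = (u,v))" if "(x,K) \<in> p3" for x K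
        using that pK[of x K] by (auto simp: p3_def p1_def io_def)
      have disj: "{fst (io i)<..<snd (io i)} \<inter> {fst (io j)<..<snd (io j)} = {}" if "i \<in> p3" "j \<in> p3" "i \<noteq> j" for i j
      proof -
        obtain x K x' K' where ij: "i = (x,K)" "j = (x',K')" by fastforce
        have 1: "interior K = {fst (io i)<..<snd (io i)}" "interior K' = {fst (io j)<..<snd (io j)}"
          using p3[of x K] p3[of x' K'] that ij by (auto simp: interior_atLeastAtMost_real)
        have "interior K \<inter> interior K' = {}"
          using tagged_division_ofD(5)[OF p, of x K x' K'] p3[of x K] p3[of x' K'] that ij by auto
        then show ?thesis using 1 by simp
      qed
      have io_less: "fst (io i) < snd (io i)" if "i \<in> p3" for i
        using p3 that by (cases i) fastforce
      have inj: "inj_on io p3"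
        proof (rule inj_onI, rule ccontr)
        fix i j assume ij: "i \<in> p3" "j \<in> p3" "io i = io j" "i \<noteq> j"
        then have "{fst (io i)<..<snd (io i)} = {}" using disj[OF ij(1,2,4)] by simp
        then show False using io_less[OF ij(1)] by (simp add: greaterThanLessThan_empty_iff)
      qed
      have "(\<Sum>(u,v)\<in>io ` p3. norm (y v - y u)) < e / 2"
      proof (rule \<delta>)
        show "finite (io ` p3)" using split(3) by (auto simp: p3_def intro: finite_subset[of _ p1])
        then have finp3: "finite p3" using inj finite_imageD by blast
        show "\<forall>(u,v)\<in>io ` p3. a \<le> u \<and> u \<le> v \<and> v \<le> b" using p3 by fastforce
        show "pairwise (\<lambda>(u,v) (u',v'). {u<..<v} \<inter> {u'<..<v'} = {}) (io ` p3)"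
          unfolding pairwise_def split_def
        proof (intro ballI impI)
          fix i' j' assume ij': "i' \<in> io ` p3" "j' \<in> io ` p3" "i' \<noteq> j'"
          obtain i where i: "i' = io i" "i \<in> p3" using ij'(1) by (rule imageE)
          obtain j where j: "j' = io j" "j \<in> p3" using ij'(2) by (rule imageE)
          have "i \<noteq> j" using i j ij'(3) by auto
          with disj[OF i(2) j(2)] i j show "{fst i'<..<snd i'} \<inter> {fst j'<..<snd j'} = {}" by simp
        qed
        have "(\<Sum>(u,v)\<in>io ` p3. v - u) = (\<Sum>i\<in>p3. measure lebesgue {fst (io i)<..<snd (io i)})"
          unfolding sum.reindex[OF inj] by (rule sum.cong) (use io_less in \<open>auto simp: split_def less_imp_le\<close>)
        also have "\<dots> = measure lebesgue (\<Union>i\<in>p3. {fst (io i)<..<snd (io i)})"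
        proof (rule measure_UNION'[symmetric, OF finp3])
          show "pairwise (\<lambda>i j. disjnt {fst (io i)<..<snd (io i)} {fst (io j)<..<snd (io j)}) p3"
            unfolding pairwise_def disjnt_def using disj by blast
        qed simp
        also have "\<dots> \<le> measure lebesgue U"
        proof (rule measure_mono_fmeasurable[OF _ _ Um])
          show "(\<Union>i\<in>p3. {fst (io i)<..<snd (io i)}) \<subseteq> U"
          proof safe
            fix x K r assume xK: "(x,K) \<in> p3" and r: "r \<in> {fst (io (x,K))<..<snd (io (x,K))}"
            have "r \<in> K" using p3[OF xK] r by auto
            moreover have "K \<subseteq> U" using fineD[OF fine, of x K] p3[OF xK] by (simp add: \<gamma>_def)
            ultimately show "r \<in> U" by blast
          qed
        qed (use finp3 in auto)
        also note mU
        finally show "(\<Sum>(u,v)\<in>io ` p3. v - u) < \<delta>" .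
      qed
      also have "(\<Sum>(u,v)\<in>io ` p3. norm (y v - y u)) = (\<Sum>i\<in>p3. norm (t i))"
        unfolding sum.reindex[OF inj] by (rule sum.cong) (auto simp: io_def t_def g'_def p3_def p1_def norm_minus_commute)
      also have "\<dots> = (\<Sum>i\<in>p1. norm (t i))"
      proof (rule sum.mono_neutral_left[OF split(3)])
        show "p3 \<subseteq> p1" by (auto simp: p3_def)
        show "\<forall>i\<in>p1 - p3. norm (t i) = 0"
        proof
          fix i assume i: "i \<in> p1 - p3"
          obtain x K where xK: "i = (x,K)" by fastforce
          have "(x,K) \<in> p" "x \<in> N" using i xK by (auto simp: p1_def)
          moreover have "Inf K = Sup K" using i xK pK[OF \<open>(x,K) \<in> p\<close>] by (auto simp: p3_def)
          ultimately show "norm (t i) = 0" by (simp add: xK t_def g'_def)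
        qed
      qed
      finally have "norm (sum t p1) < e / 2" using norm_sum[of t p1] by linarith
      then show ?thesis unfolding eq using n2 norm_triangle_ineq[of "sum t p1" "sum t p2"] by linarith
    qed
    show "\<exists>\<gamma>. gauge \<gamma> \<and> (\<forall>\<D>. \<D> tagged_division_of cbox a b \<and> \<gamma> fine \<D> \<longrightarrow>
        norm ((\<Sum>(x,K)\<in>\<D>. measure lborel K *\<^sub>R g' x) - (y b - y a)) < e)"
      using gauge by (intro exI[of _ \<gamma>] conjI allI impI close) simp_all
  qed
  then have "(g' has_integral (y b - y a)) {a..b}" by simp
  from this show ?thesis
    by (rule has_integral_spike[OF negN, rotated]) (simp add: g'_def)
qed

section \<open>Tools for controlled trajectories\<close>

text \<open>
  The right-hand side \<open>W\<close> of the hypothesis satisfies \<open>W' = L d \<le> L W\<close>, so \<open>exp (- L (s - a)) W s\<close> decreases.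
\<close>

lemma gronwall:
  fixes d :: "real \<Rightarrow> real"
  assumes cont: "continuous_on {a..b} d" and L: "0 \<le> L"
    and le: "\<And>s. s \<in> {a..b} \<Longrightarrow> d s \<le> c + L * integral {a..s} d" and s: "s \<in> {a..b}"
  shows "d s \<le> c * exp (L * (s - a))"
proof -
  define W where "W = (\<lambda>r. c + L * integral {a..r} d)"
  define E where "E = (\<lambda>r. exp (- (L * (r - a))) * W r)"
  have contI: "continuous_on {a..s} (\<lambda>r. integral {a..r} d)"
    using s by (intro indefinite_integral_continuous_1 integrable_continuous_real continuous_on_subset[OF cont]) auto
  have "E s \<le> E a"
  proof (rule DERIV_nonpos_imp_decreasing_open[of a s E])
    show "a \<le> s" using s by simp
    show "continuous_on {a..s} E"
      unfolding E_def W_def by (intro continuous_intros contI)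
    fix r assume r: "a < r" "r < s"
    then have r': "r \<in> {a..b}" "r \<in> interior {a..b}" using s by (auto simp: interior_atLeastAtMost_real)
    have "((\<lambda>r. integral {a..r} d) has_real_derivative d r) (at r within {a..b})"
      by (rule integral_has_real_derivative[OF cont r'(1)])
    then have "((\<lambda>r. integral {a..r} d) has_real_derivative d r) (at r)"
      using at_within_interior[OF r'(2)] by simp
    then have "(E has_real_derivative (exp (- (L * (r - a))) * (L * d r) - L * exp (- (L * (r - a))) * W r)) (at r)"
      unfolding E_def W_def by (auto intro!: derivative_eq_intros)
    moreover have "exp (- (L * (r - a))) * (L * d r) - L * exp (- (L * (r - a))) * W r = exp (- (L * (r - a))) * (L * (d r - W r))"
      by (simp add: algebra_simps)
    moreover have "\<dots> \<le> 0"
      using le[OF r'(1)] L by (auto simp: W_def mult_le_0_iff)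
    ultimately show "\<exists>y. (E has_real_derivative y) (at r) \<and> y \<le> 0" by metis
  qed
  then have "exp (- (L * (s - a))) * W s \<le> c" by (simp add: E_def W_def)
  then have "exp (L * (s - a)) * (exp (- (L * (s - a))) * W s) \<le> exp (L * (s - a)) * c"
    by (intro mult_left_mono) auto
  also have "exp (L * (s - a)) * (exp (- (L * (s - a))) * W s) = W s"
    by (simp add: mult.assoc[symmetric] exp_add[symmetric])
  finally have "W s \<le> c * exp (L * (s - a))" by (simp add: mult.commute)
  then show ?thesis using le[OF s] by (simp add: W_def)
qed

lemma borel_measurable_along_curve:
  fixes G :: "'a::euclidean_space \<times> 'b::euclidean_space \<times> real \<Rightarrow> 'c::euclidean_space"
  assumes G: "continuous_on (UNIV \<times> A \<times> {0..T}) G" and A: "closed A"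
    and S: "S \<in> sets lebesgue" "S \<subseteq> {0..T}"
    and \<alpha>: "\<alpha> \<in> borel_measurable (lebesgue_on S)" "\<And>s. s \<in> S \<Longrightarrow> \<alpha> s \<in> A"
    and y: "continuous_on S y"
  shows "(\<lambda>s. G (y s, \<alpha> s, s)) \<in> borel_measurable (lebesgue_on S)"
proof -
  let ?D = "UNIV \<times> A \<times> {0..T}"
  have D: "?D \<in> sets borel" using A by (intro borel_closed closed_Times) auto
  have "(\<lambda>s. (y s, \<alpha> s, s)) \<in> borel_measurable (lebesgue_on S)"
    by (intro borel_measurable_Pair \<alpha>(1) continuous_imp_measurable_on_sets_lebesgue[OF _ S(1)] y continuous_on_id)
  then have "(\<lambda>s. (y s, \<alpha> s, s)) \<in> lebesgue_on S \<rightarrow>\<^sub>M restrict_space borel ?D"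
    by (rule measurable_restrict_space2[rotated]) (use \<alpha>(2) S(2) in auto)
  then show ?thesis
    using measurable_compose[OF _ borel_measurable_continuous_on_restrict[OF G]] by blast
qed

lemma controls_measurable_on:
  assumes "\<alpha> \<in> controls A" "S \<subseteq> {0..}"
  shows "\<alpha> \<in> borel_measurable (lebesgue_on S)"
  using assms measurable_restrict_mono unfolding controls_def by blast

lemma abs_continuous_on_imp_continuous_on:
  assumes "abs_continuous_on a b y"
  shows "continuous_on {a..b} y"
  unfolding continuous_on_iff
proof (intro ballI allI impI)
  fix x e :: real assume x: "x \<in> {a..b}" and e: "0 < e"
  then obtain \<delta> where "\<delta> > 0" and \<delta>: "\<And>D. finite D \<and> (\<forall>(u,v)\<in>D. a \<le> u \<and> u \<le> v \<and> v \<le> b)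
        \<and> pairwise (\<lambda>(u,v) (u',v'). {u<..<v} \<inter> {u'<..<v'} = {}) D
        \<and> (\<Sum>(u,v)\<in>D. v - u) < \<delta> \<Longrightarrow> (\<Sum>(u,v)\<in>D. norm (y v - y u)) < e"
    using assms unfolding abs_continuous_on_def by meson
  show "\<exists>d>0. \<forall>x'\<in>{a..b}. dist x' x < d \<longrightarrow> dist (y x') (y x) < e"
  proof (intro exI[of _ \<delta>] conjI ballI impI)
    fix x' assume x': "x' \<in> {a..b}" "dist x' x < \<delta>"
    show "dist (y x') (y x) < e"
    proof (cases "x \<le> x'")
      case True
      then show ?thesis using \<delta>[of "{(x, x')}"] x x' by (simp add: dist_real_def dist_norm)
    next
      case False
      then show ?thesis using \<delta>[of "{(x', x)}"] x x' by (simp add: dist_real_def dist_norm norm_minus_commute)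
    qed
  qed fact
qed

lemma abs_continuous_on_subinterval:
  assumes "abs_continuous_on a b y" "a \<le> a'" "b' \<le> b"
  shows "abs_continuous_on a' b' y"
  unfolding abs_continuous_on_def
proof (intro allI impI)
  fix e :: real assume "0 < e"
  then obtain \<delta> where "\<delta> > 0" and \<delta>: "\<And>D. finite D \<and> (\<forall>(u,v)\<in>D. a \<le> u \<and> u \<le> v \<and> v \<le> b)
        \<and> pairwise (\<lambda>(u,v) (u',v'). {u<..<v} \<inter> {u'<..<v'} = {}) D
        \<and> (\<Sum>(u,v)\<in>D. v - u) < \<delta> \<Longrightarrow> (\<Sum>(u,v)\<in>D. norm (y v - y u)) < e"
    using assms(1) unfolding abs_continuous_on_def by meson
  show "\<exists>\<delta>>0. \<forall>D. finite D \<and> (\<forall>(u,v)\<in>D. a' \<le> u \<and> u \<le> v \<and> v \<le> b')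
        \<and> pairwise (\<lambda>(u,v) (u',v'). {u<..<v} \<inter> {u'<..<v'} = {}) D
        \<and> (\<Sum>(u,v)\<in>D. v - u) < \<delta> \<longrightarrow> (\<Sum>(u,v)\<in>D. norm (y v - y u)) < e"
  proof (intro exI[of _ \<delta>] conjI allI impI)
    show "0 < \<delta>" by fact
    fix D :: "(real \<times> real) set"
    assume D: "finite D \<and> (\<forall>(u,v)\<in>D. a' \<le> u \<and> u \<le> v \<and> v \<le> b')
        \<and> pairwise (\<lambda>(u,v) (u',v'). {u<..<v} \<inter> {u'<..<v'} = {}) D \<and> (\<Sum>(u,v)\<in>D. v - u) < \<delta>"
    then have "\<forall>(u,v)\<in>D. a \<le> u \<and> u \<le> v \<and> v \<le> b" using assms(2,3) by fastforce
    with D show "(\<Sum>(u,v)\<in>D. norm (y v - y u)) < e" by (intro \<delta>) simp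
  qed
qed

lemma lipschitz_imp_abs_continuous_on:
  assumes K: "0 \<le> K" and lip: "\<And>u v. a \<le> u \<Longrightarrow> u \<le> v \<Longrightarrow> v \<le> b \<Longrightarrow> norm (y v - y u) \<le> K * (v - u)"
  shows "abs_continuous_on a b y"
  unfolding abs_continuous_on_def
proof (intro allI impI)
  fix e :: real assume "0 < e"
  show "\<exists>\<delta>>0. \<forall>D. finite D \<and> (\<forall>(u,v)\<in>D. a \<le> u \<and> u \<le> v \<and> v \<le> b)
        \<and> pairwise (\<lambda>(u,v) (u',v'). {u<..<v} \<inter> {u'<..<v'} = {}) D
        \<and> (\<Sum>(u,v)\<in>D. v - u) < \<delta> \<longrightarrow> (\<Sum>(u,v)\<in>D. norm (y v - y u)) < e"
  proof (intro exI[of _ "e / (K + 1)"] conjI allI impI)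
    show "0 < e / (K + 1)" using \<open>0 < e\<close> K by simp
    fix D :: "(real \<times> real) set"
    assume D: "finite D \<and> (\<forall>(u,v)\<in>D. a \<le> u \<and> u \<le> v \<and> v \<le> b)
        \<and> pairwise (\<lambda>(u,v) (u',v'). {u<..<v} \<inter> {u'<..<v'} = {}) D \<and> (\<Sum>(u,v)\<in>D. v - u) < e / (K + 1)"
    have "(\<Sum>(u,v)\<in>D. norm (y v - y u)) \<le> (\<Sum>(u,v)\<in>D. (K + 1) * (v - u))"
    proof (rule sum_mono)
      fix i assume i: "i \<in> D"
      obtain u v where uv: "i = (u,v)" by fastforce
      have *: "a \<le> u" "u \<le> v" "v \<le> b" using D i uv by auto
      show "(case i of (u, v) \<Rightarrow> norm (y v - y u)) \<le> (case i of (u, v) \<Rightarrow> (K + 1) * (v - u))"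
        using lip[OF *] * by (simp add: uv algebra_simps)
    qed
    also have "\<dots> = (K + 1) * (\<Sum>(u,v)\<in>D. v - u)" by (simp add: sum_distrib_left split_def)
    also have "\<dots> < e" using D K by (simp add: field_simps)
    finally show "(\<Sum>(u,v)\<in>D. norm (y v - y u)) < e" .
  qed
qed

lemma norm_integral_le_const:
  fixes g :: "real \<Rightarrow> 'a::euclidean_space"
  assumes "g integrable_on {u..v}" "u \<le> v" "\<And>s. s \<in> {u..v} \<Longrightarrow> norm (g s) \<le> B"
  shows "norm (integral {u..v} g) \<le> B * (v - u)"
  using Henstock_Kurzweil_Integration.integral_norm_bound_integral[of g "{u..v}" "\<lambda>_. B"] assms by (simp add: mult.commute integrable_const_ivl)

section \<open>Trajectories in a fixed mode\<close>

text \<open>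
  The data of the theorem for one mode \<open>p\<close>, with explicit constants: \<open>K\<close> bounds the dynamics, \<open>L\<close> is
  their Lipschitz constant and \<open>M\<close> bounds the running cost.
\<close>

locale switching_mode =
  fixes f :: "real^'d \<Rightarrow> real^'m \<Rightarrow> ('n \<Rightarrow> bool) \<Rightarrow> real^'d"
    and l :: "real^'d \<Rightarrow> real^'m \<Rightarrow> ('n \<Rightarrow> bool) \<Rightarrow> real \<Rightarrow> real"
    and A :: "(real^'m) set" and T lam :: real and p :: "'n \<Rightarrow> bool" and K L M :: real
  assumes T_pos: "0 < T" and lam_nonneg: "0 \<le> lam"
    and A_compact: "compact A" and A_nonempty: "A \<noteq> {}"
    and f_cont: "continuous_on (UNIV \<times> A) (\<lambda>(x,a). f x a p)"
    and f_bound: "\<And>x a. a \<in> A \<Longrightarrow> norm (f x a p) \<le> K"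
    and f_lip: "\<And>x y a. a \<in> A \<Longrightarrow> norm (f x a p - f y a p) \<le> L * norm (x - y)" and L_pos: "0 < L"
    and l_cont: "continuous_on (UNIV \<times> A \<times> {0..T}) (\<lambda>(x,a,t). l x a p t)"
    and l_nonneg: "\<And>x a t. a \<in> A \<Longrightarrow> t \<in> {0..T} \<Longrightarrow> 0 \<le> l x a p t"
    and l_bound: "\<And>x a t. a \<in> A \<Longrightarrow> t \<in> {0..T} \<Longrightarrow> l x a p t \<le> M"
    and l_uc: "\<forall>e>0. \<exists>\<delta>>0. \<forall>x y. \<forall>a\<in>A. \<forall>t\<in>{0..T}. norm (x - y) < \<delta> \<longrightarrow> \<bar>l x a p t - l y a p t\<bar> < e"
begin

lemma K_nonneg: "0 \<le> K"
  using f_bound A_nonempty norm_ge_zero order_trans by blast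

lemma M_nonneg: "0 \<le> M"
proof -
  obtain a where "a \<in> A" using A_nonempty by blast
  then show ?thesis using l_nonneg[of a 0 0] l_bound[of a 0 0] T_pos by simp
qed

abbreviation drift :: "(real \<Rightarrow> real^'m) \<Rightarrow> (real \<Rightarrow> real^'d) \<Rightarrow> real \<Rightarrow> real^'d" where
  "drift \<alpha> y s \<equiv> f (y s) (\<alpha> s) p"

abbreviation rate :: "real \<Rightarrow> (real \<Rightarrow> real^'m) \<Rightarrow> (real \<Rightarrow> real^'d) \<Rightarrow> real \<Rightarrow> real" where
  "rate t \<alpha> y s \<equiv> exp (- lam * (s - t)) * l (y s) (\<alpha> s) p s"

lemma controls_in: "\<alpha> \<in> controls A \<Longrightarrow> 0 \<le> s \<Longrightarrow> \<alpha> s \<in> A"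
  by (simp add: controls_def)

lemma const_control: "a \<in> A \<Longrightarrow> (\<lambda>_. a) \<in> controls A"
  by (simp add: controls_def)

lemma integrable_along_curve:
  fixes G :: "(real^'d) \<times> (real^'m) \<times> real \<Rightarrow> 'c::euclidean_space"
  assumes G: "continuous_on (UNIV \<times> A \<times> {0..T}) G" and \<alpha>: "\<alpha> \<in> controls A" and y: "continuous_on {t..u} y"
    and tu: "0 \<le> t" "u \<le> T" and bound: "\<And>s. s \<in> {t..u} \<Longrightarrow> norm (G (y s, \<alpha> s, s)) \<le> B"
  shows "(\<lambda>s. G (y s, \<alpha> s, s)) absolutely_integrable_on {t..u}"
proof (rule measurable_bounded_by_integrable_imp_absolutely_integrable[where g = "\<lambda>_. B"])
  show "(\<lambda>s. G (y s, \<alpha> s, s)) \<in> borel_measurable (lebesgue_on {t..u})"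
    using tu controls_in[OF \<alpha>] compact_imp_closed[OF A_compact]
    by (intro borel_measurable_along_curve[OF G] controls_measurable_on[OF \<alpha>] y) auto
qed (use bound in auto)

lemma drift_bound: "\<alpha> \<in> controls A \<Longrightarrow> 0 \<le> s \<Longrightarrow> norm (drift \<alpha> y s) \<le> K"
  by (intro f_bound controls_in)

lemma f_cont_spacetime: "continuous_on (UNIV \<times> A \<times> {0..T}) (\<lambda>z. f (fst z) (fst (snd z)) p)"
proof -
  have "continuous_on (UNIV \<times> A \<times> {0..T}) (\<lambda>z. case (fst z, fst (snd z)) of (x,a) \<Rightarrow> f x a p)"
    by (rule continuous_on_compose2[OF f_cont]) (auto intro!: continuous_intros)
  then show ?thesis by simp
qed

lemma drift_integrable:
  assumes "\<alpha> \<in> controls A" "continuous_on {t..u} y" "0 \<le> t" "u \<le> T"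
  shows "drift \<alpha> y integrable_on {t..u}"
proof -
  have "continuous_on (UNIV \<times> A \<times> {0..T}) (\<lambda>(x,a,s). f x a p)"
    using f_cont_spacetime by (simp add: split_def)
  from integrable_along_curve[OF this assms, of K] drift_bound[OF assms(1)] assms(3)
  show ?thesis by (auto intro: set_lebesgue_integral_eq_integral(1))
qed

lemma rate_bounds:
  assumes "\<alpha> \<in> controls A" "0 \<le> s" "s \<le> T" "t \<le> s"
  shows "0 \<le> rate t \<alpha> y s" "rate t \<alpha> y s \<le> M"
proof -
  have l: "0 \<le> l (y s) (\<alpha> s) p s" "l (y s) (\<alpha> s) p s \<le> M"
    using assms controls_in l_nonneg l_bound by auto
  then show "0 \<le> rate t \<alpha> y s" by simp
  have "exp (- lam * (s - t)) \<le> 1" using lam_nonneg assms(4) by simp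
  from mult_mono[OF this l(2)] l show "rate t \<alpha> y s \<le> M" by simp
qed

lemma rate_absolutely_integrable:
  assumes "\<alpha> \<in> controls A" "continuous_on {t..u} y" "0 \<le> t" "u \<le> T" "t0 \<le> t"
  shows "rate t0 \<alpha> y absolutely_integrable_on {t..u}"
proof -
  have "continuous_on (UNIV \<times> A \<times> {0..T}) (\<lambda>(x,a,s). exp (- lam * (s - t0)) * l x a p s)"
    using l_cont by (auto simp: split_def intro!: continuous_intros)
  moreover have "norm (rate t0 \<alpha> y s) \<le> M" if "s \<in> {t..u}" for s
    using rate_bounds[OF assms(1), of s t0 y] that assms(3-5) by (simp add: abs_of_nonneg)
  ultimately show ?thesis
    using integrable_along_curve[of "\<lambda>(x,a,s). exp (- lam * (s - t0)) * l x a p s", OF _ assms(1-4), of M] by simp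
qed

lemma rate_integrable:
  assumes "\<alpha> \<in> controls A" "continuous_on {t..u} y" "0 \<le> t" "u \<le> T" "t0 \<le> t"
  shows "rate t0 \<alpha> y integrable_on {t..u}"
  using rate_absolutely_integrable[OF assms] by (rule set_lebesgue_integral_eq_integral(1))

text \<open>
  The integral equation says that \<open>y\<close> is a primitive of its drift. A trajectory is one by the fundamental
  theorem for absolutely continuous functions; conversely, a primitive of a bounded measurable function is
  Lipschitz and differentiable almost everywhere.
\<close>

lemma trajectory_iff:
  assumes \<alpha>: "\<alpha> \<in> controls A" and t: "0 \<le> t" "t \<le> T"
  shows "trajectory f T p x t \<alpha> y \<longleftrightarrow>
     continuous_on {t..T} y \<and> (\<forall>s\<in>{t..T}. y s = x + integral {t..s} (drift \<alpha> y))"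
proof
  assume tr: "trajectory f T p x t \<alpha> y"
  then have ac: "abs_continuous_on t T y" and yt: "y t = x"
    and der: "AE s in lebesgue. s \<in> {t<..T} \<longrightarrow> (y has_vector_derivative drift \<alpha> y s) (at s within {t..T})"
    by (auto simp: trajectory_def)
  have "y s = x + integral {t..s} (drift \<alpha> y)" if s: "s \<in> {t..T}" for s
  proof -
    have "AE r in lebesgue. r \<in> {t<..s} \<longrightarrow> (y has_vector_derivative drift \<alpha> y r) (at r within {t..s})"
      using der by (rule AE_mp) (use s in \<open>auto intro!: AE_I2 has_vector_derivative_within_subset[of _ _ _ "{t..T}" "{t..s}"]\<close>)
    from abs_continuous_on_has_integral[OF _ abs_continuous_on_subinterval[OF ac] this] s
    have "(drift \<alpha> y has_integral y s - y t) {t..s}" by auto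
    then show ?thesis using yt by (simp add: integral_unique)
  qed
  then show "continuous_on {t..T} y \<and> (\<forall>s\<in>{t..T}. y s = x + integral {t..s} (drift \<alpha> y))"
    using abs_continuous_on_imp_continuous_on[OF ac] by blast
next
  assume *: "continuous_on {t..T} y \<and> (\<forall>s\<in>{t..T}. y s = x + integral {t..s} (drift \<alpha> y))"
  then have cont: "continuous_on {t..T} y" and eq: "\<And>s. s \<in> {t..T} \<Longrightarrow> y s = x + integral {t..s} (drift \<alpha> y)" by auto
  have int: "drift \<alpha> y integrable_on {u..v}" if "t \<le> u" "v \<le> T" for u v
    using that t by (intro drift_integrable[OF \<alpha>] continuous_on_subset[OF cont]) auto
  have "norm (y v - y u) \<le> K * (v - u)" if uv: "t \<le> u" "u \<le> v" "v \<le> T" for u v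
  proof -
    have "integral {t..v} (drift \<alpha> y) = integral {t..u} (drift \<alpha> y) + integral {u..v} (drift \<alpha> y)"
      using uv by (intro Henstock_Kurzweil_Integration.integral_combine[symmetric] int) auto
    then have "y v - y u = integral {u..v} (drift \<alpha> y)" using eq[of u] eq[of v] uv by auto
    also have "norm \<dots> \<le> K * (v - u)"
      using norm_integral_le_const[OF int] drift_bound[OF \<alpha>] uv t by auto
    finally show ?thesis .
  qed
  then have "abs_continuous_on t T y" by (rule lipschitz_imp_abs_continuous_on[OF K_nonneg])
  moreover have "y t = x" using eq[of t] t by simp
  moreover have "AE s in lebesgue. s \<in> {t<..T} \<longrightarrow> (y has_vector_derivative drift \<alpha> y s) (at s within {t..T})"
    using indefinite_integral_has_vector_derivative_AE[OF int[OF order_refl order_refl]]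
  proof (rule AE_mp, intro AE_I2 impI)
    fix s assume "s \<in> {t..T} \<longrightarrow> ((\<lambda>s. integral {t..s} (drift \<alpha> y)) has_vector_derivative drift \<alpha> y s) (at s within {t..T})"
      and s: "s \<in> {t<..T}"
    then have "((\<lambda>s. x + integral {t..s} (drift \<alpha> y)) has_vector_derivative drift \<alpha> y s) (at s within {t..T})"
      by (auto intro!: derivative_eq_intros)
    then show "(y has_vector_derivative drift \<alpha> y s) (at s within {t..T})"
      by (rule has_vector_derivative_transform[rotated 2]) (use s eq in auto)
  qed
  ultimately show "trajectory f T p x t \<alpha> y" by (simp add: trajectory_def)
qed


lemma trajectoryD:
  assumes "trajectory f T p x t \<alpha> y" "\<alpha> \<in> controls A" "0 \<le> t" "t \<le> T"
  shows "continuous_on {t..T} y" and "\<And>s. s \<in> {t..T} \<Longrightarrow> y s = x + integral {t..s} (drift \<alpha> y)"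
    and "y t = x"
  using assms trajectory_iff by (auto simp: trajectory_def)

text \<open>
  Picard iteration. In the norm weighted by \<open>exp (- 2 L s)\<close> the integral operator contracts by \<open>1/2\<close> on the
  whole interval, so Banach's theorem yields a fixed point at once. The weight is built into the unknown
  \<open>z s = exp (- 2 L s) y s\<close>, and time is clamped to \<open>[t,T]\<close> in order to work with bounded continuous
  functions on the whole line.
\<close>

lemma trajectory_exists:
  assumes \<alpha>: "\<alpha> \<in> controls A" and t: "0 \<le> t" "t \<le> T"
  obtains y where "trajectory f T p x t \<alpha> y"
proof -
  define c where "c = 2 * L"
  have c: "0 < c" using L_pos by (simp add: c_def)
  define cl where "cl = (\<lambda>s. max t (min s T))"
  have cl: "cl s \<in> {t..T}" for s using t by (auto simp: cl_def)
  have cl_id: "cl s = s" if "s \<in> {t..T}" for s using that by (auto simp: cl_def)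
  have cl_cont: "continuous_on UNIV cl" unfolding cl_def by (intro continuous_intros)
  \<comment> \<open>Undoes the weight: the candidate trajectory that belongs to \<open>z\<close>.\<close>
  define unw where "unw = (\<lambda>(z::real \<Rightarrow>\<^sub>C (real^'d)) r. exp (c * r) *\<^sub>R apply_bcontfun z r)"
  have unw_cont: "continuous_on S (unw z)" for S z
    unfolding unw_def by (intro continuous_intros continuous_on_apply_bcontfun)
  have int: "drift \<alpha> (unw z) integrable_on {t..s}" if "s \<le> T" for z s
    using that t by (intro drift_integrable[OF \<alpha> unw_cont]) auto
  define h where "h = (\<lambda>z s. exp (- (c * s)) *\<^sub>R (x + integral {t..s} (drift \<alpha> (unw z))))"
  have hcont: "continuous_on {t..T} (h z)" for z
    unfolding h_def by (intro continuous_intros indefinite_integral_continuous_1 int) simp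
  have mem: "(\<lambda>s. h z (cl s)) \<in> bcontfun" for z
  proof -
    have "bounded (h z ` {t..T})"
      by (intro compact_imp_bounded compact_continuous_image hcont) simp
    then have "bounded (range (\<lambda>s. h z (cl s)))"
      by (rule bounded_subset) (use cl in auto)
    moreover have "continuous_on UNIV (\<lambda>s. h z (cl s))"
      by (rule continuous_on_compose2[OF hcont cl_cont]) (use cl in auto)
    ultimately show ?thesis by (simp add: bcontfun_def)
  qed
  define \<Phi> where "\<Phi> = (\<lambda>z. Bcontfun (\<lambda>s. h z (cl s)))"
  have \<Phi>: "apply_bcontfun (\<Phi> z) s = h z (cl s)" for z s
    unfolding \<Phi>_def by (simp add: Bcontfun_inverse[OF mem])
  have contr: "dist (\<Phi> z) (\<Phi> z') \<le> 1/2 * dist z z'" for z z'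
  proof (rule dist_bound)
    fix s
    define u where "u = cl s"
    define D where "D = dist z z'"
    have u: "t \<le> u" "u \<le> T" using cl[of s] by (auto simp: u_def)
    have expint: "((\<lambda>r. L * D * exp (c * r)) has_integral L * D * (exp (c * u) / c) - L * D * (exp (c * t) / c)) {t..u}"
      using c by (intro fundamental_theorem_of_calculus u)
        (auto intro!: derivative_eq_intros simp: has_real_derivative_iff_has_vector_derivative[symmetric])
    have "h z u - h z' u = exp (- (c * u)) *\<^sub>R integral {t..u} (\<lambda>r. drift \<alpha> (unw z) r - drift \<alpha> (unw z') r)"
      using int[OF u(2)] by (simp add: h_def integral_diff algebra_simps)
    also have "norm \<dots> = exp (- (c * u)) * norm (integral {t..u} (\<lambda>r. drift \<alpha> (unw z) r - drift \<alpha> (unw z') r))" by simp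
    also have "\<dots> \<le> exp (- (c * u)) * integral {t..u} (\<lambda>r. L * D * exp (c * r))"
    proof (intro mult_left_mono Henstock_Kurzweil_Integration.integral_norm_bound_integral integrable_diff int u)
      show "(\<lambda>r. L * D * exp (c * r)) integrable_on {t..u}" using expint by blast
      fix r assume r: "r \<in> {t..u}"
      have "norm (drift \<alpha> (unw z) r - drift \<alpha> (unw z') r) \<le> L * norm (unw z r - unw z' r)"
        using r t by (intro f_lip controls_in[OF \<alpha>]) auto
      also have "norm (unw z r - unw z' r) = exp (c * r) * dist (apply_bcontfun z r) (apply_bcontfun z' r)"
        by (simp add: unw_def dist_norm flip: scaleR_diff_right)
      also have "L * \<dots> \<le> L * (exp (c * r) * D)"
        using L_pos by (intro mult_left_mono) (auto simp: D_def dist_bounded)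
      finally show "norm (drift \<alpha> (unw z) r - drift \<alpha> (unw z') r) \<le> L * D * exp (c * r)"
        by (simp add: mult_ac)
    qed simp
    also have "integral {t..u} (\<lambda>r. L * D * exp (c * r)) = L * D * (exp (c * u) / c) - L * D * (exp (c * t) / c)"
      using expint by (rule integral_unique)
    also have "exp (- (c * u)) * \<dots> \<le> exp (- (c * u)) * (L * D * (exp (c * u) / c))"
      using L_pos c by (intro mult_left_mono) (auto simp: D_def)
    also have "\<dots> = 1/2 * D" using L_pos by (simp add: c_def exp_minus field_simps)
    finally show "dist (apply_bcontfun (\<Phi> z) s) (apply_bcontfun (\<Phi> z') s) \<le> 1/2 * dist z z'"
      by (simp add: \<Phi> u_def D_def dist_norm)
  qed
  have "\<exists>!z. \<Phi> z = z"
    by (rule banach_fix_type[of "1/2"]) (use contr in auto)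
  then obtain z where z: "\<Phi> z = z" by blast
  have "unw z s = x + integral {t..s} (drift \<alpha> (unw z))" if s: "s \<in> {t..T}" for s
  proof -
    have "apply_bcontfun z s = h z s" using \<Phi>[of z s] z cl_id[OF s] by simp
    then show ?thesis by (simp add: unw_def h_def exp_minus)
  qed
  then have "trajectory f T p x t \<alpha> (unw z)"
    unfolding trajectory_iff[OF \<alpha> t] using unw_cont by blast
  then show ?thesis by (rule that)
qed

lemma trajectory_speed:
  assumes "trajectory f T p x t \<alpha> y" "\<alpha> \<in> controls A" "0 \<le> t" and uv: "t \<le> u" "u \<le> v" "v \<le> T"
  shows "y v - y u = integral {u..v} (drift \<alpha> y)" "norm (y v - y u) \<le> K * (v - u)"
proof -
  have tT: "t \<le> T" using uv by simp
  note y = trajectoryD[OF assms(1-3) tT]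
  have int: "drift \<alpha> y integrable_on {a..b}" if "t \<le> a" "b \<le> T" for a b
    using that assms by (intro drift_integrable continuous_on_subset[OF y(1)]) auto
  have "integral {t..v} (drift \<alpha> y) = integral {t..u} (drift \<alpha> y) + integral {u..v} (drift \<alpha> y)"
    using uv by (intro Henstock_Kurzweil_Integration.integral_combine[symmetric] int) auto
  then show *: "y v - y u = integral {u..v} (drift \<alpha> y)" using y(2)[of u] y(2)[of v] uv by auto
  show "norm (y v - y u) \<le> K * (v - u)" unfolding *
    using uv assms(3) by (intro norm_integral_le_const int drift_bound[OF assms(2)]) auto
qed

lemma trajectory_restrict:
  assumes "trajectory f T p x t \<alpha> y" "\<alpha> \<in> controls A" "0 \<le> t" and u: "u \<in> {t..T}"
  shows "trajectory f T p (y u) u \<alpha> y"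
proof -
  have tT: "t \<le> T" "0 \<le> u" "u \<le> T" using u assms(3) by auto
  show ?thesis
    unfolding trajectory_iff[OF assms(2) tT(2,3)]
  proof (intro conjI ballI)
    show "continuous_on {u..T} y"
      using trajectoryD(1)[OF assms(1-3) tT(1)] by (rule continuous_on_subset) (use u in auto)
    fix s assume "s \<in> {u..T}"
    then show "y s = y u + integral {u..s} (drift \<alpha> y)"
      using trajectory_speed(1)[OF assms(1-3), of u s] u by (simp add: algebra_simps)
  qed
qed

text \<open>
  Two trajectories driven by the same control separate at most exponentially, by Gronwall's inequality.
\<close>

lemma trajectory_dist_le:
  assumes y: "trajectory f T p x t \<alpha> y" and y': "trajectory f T p x' t \<alpha> y'"
    and \<alpha>: "\<alpha> \<in> controls A" and t: "0 \<le> t" and s: "s \<in> {t..T}"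
  shows "norm (y s - y' s) \<le> norm (x - x') * exp (L * T)"
proof -
  have tT: "t \<le> T" using s by simp
  note yD = trajectoryD[OF y \<alpha> t tT] and y'D = trajectoryD[OF y' \<alpha> t tT]
  let ?d = "\<lambda>r. norm (y r - y' r)"
  have cont: "continuous_on {t..T} ?d" by (intro continuous_intros yD(1) y'D(1))
  have "norm (y s - y' s) \<le> norm (x - x') * exp (L * (s - t))"
  proof (rule gronwall[OF cont _ _ s])
    show "0 \<le> L" using L_pos by simp
    fix r assume r: "r \<in> {t..T}"
    have int: "drift \<alpha> y integrable_on {t..r}" "drift \<alpha> y' integrable_on {t..r}"
      using r t by (auto intro!: drift_integrable[OF \<alpha>] continuous_on_subset[OF yD(1)] continuous_on_subset[OF y'D(1)])
    have intd: "?d integrable_on {t..r}"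
      by (rule integrable_continuous_real, rule continuous_on_subset[OF cont]) (use r in auto)
    have "y r - y' r = (x - x') + integral {t..r} (\<lambda>q. drift \<alpha> y q - drift \<alpha> y' q)"
      using yD(2)[OF r] y'D(2)[OF r] int by (simp add: integral_diff)
    also have "norm \<dots> \<le> norm (x - x') + norm (integral {t..r} (\<lambda>q. drift \<alpha> y q - drift \<alpha> y' q))"
      by (rule norm_triangle_ineq)
    also have "norm (integral {t..r} (\<lambda>q. drift \<alpha> y q - drift \<alpha> y' q)) \<le> integral {t..r} (\<lambda>q. L * ?d q)"
      using r t by (intro Henstock_Kurzweil_Integration.integral_norm_bound_integral integrable_diff int
            integrable_on_mult_right intd f_lip controls_in[OF \<alpha>]) auto
    finally show "?d r \<le> norm (x - x') + L * integral {t..r} ?d" by simp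
  qed
  also have "\<dots> \<le> norm (x - x') * exp (L * T)"
    using s t L_pos by (intro mult_left_mono) (auto intro!: mult_left_mono)
  finally show ?thesis .
qed

text \<open>
  At the junction \<open>u\<close> the new control takes the value of the second one although the first trajectory
  is still followed; a single time does not affect the integrals.
\<close>

lemma trajectory_concat:
  assumes y1: "trajectory f T p x t \<alpha>1 y1" and \<alpha>1: "\<alpha>1 \<in> controls A"
    and y2: "trajectory f T p (y1 u) u \<alpha>2 y2" and \<alpha>2: "\<alpha>2 \<in> controls A"
    and t: "0 \<le> t" and u: "u \<in> {t..T}"
  shows "(\<lambda>s. if s < u then \<alpha>1 s else \<alpha>2 s) \<in> controls A" (is "?\<alpha> \<in> _")
    and "trajectory f T p x t (\<lambda>s. if s < u then \<alpha>1 s else \<alpha>2 s) (\<lambda>s. if s \<le> u then y1 s else y2 s)" (is "trajectory _ _ _ _ _ _ ?y")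
proof -
  have tu: "t \<le> u" "u \<le> T" "0 \<le> u" "t \<le> T" using t u by auto
  have "{s \<in> space (lebesgue_on {0..}). s < u} = {0..<u}" by auto
  then have "{s \<in> space (lebesgue_on {0..}). s < u} \<in> sets (lebesgue_on {0..})"
    by (auto simp: sets_restrict_space_iff)
  then have "?\<alpha> \<in> borel_measurable (lebesgue_on {0..})"
    using \<alpha>1 \<alpha>2 unfolding controls_def by (intro measurable_If) auto
  then show \<alpha>: "?\<alpha> \<in> controls A"
    using \<alpha>1 \<alpha>2 by (simp add: controls_def)
  note D1 = trajectoryD[OF y1 \<alpha>1 t tu(4)] and D2 = trajectoryD[OF y2 \<alpha>2 tu(3) tu(2)]
  have "continuous_on ({t..u} \<union> {u..T}) ?y"
    using D2(3) by (intro continuous_on_cases D2(1) continuous_on_subset[OF D1(1)]) (use tu in auto)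
  moreover have "{t..u} \<union> {u..T} = {t..T}" using tu by auto
  ultimately have cont: "continuous_on {t..T} ?y" by simp
  have first: "integral {t..s} (drift ?\<alpha> ?y) = integral {t..s} (drift \<alpha>1 y1)" if "s \<le> u" for s
    by (rule integral_spike[of "{u}"]) (use that in auto)
  have second: "integral {u..s} (drift ?\<alpha> ?y) = integral {u..s} (drift \<alpha>2 y2)" for s
    using D2(3) by (intro Henstock_Kurzweil_Integration.integral_cong) auto
  show "trajectory f T p x t ?\<alpha> ?y"
    unfolding trajectory_iff[OF \<alpha> t tu(4)]
  proof (intro conjI ballI cont)
    fix s assume s: "s \<in> {t..T}"
    show "?y s = x + integral {t..s} (drift ?\<alpha> ?y)"
    proof (cases "s \<le> u")
      case True
      then show ?thesis using first[OF True] D1(2)[OF s] by simp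
    next
      case False
      have "integral {t..s} (drift ?\<alpha> ?y) = integral {t..u} (drift ?\<alpha> ?y) + integral {u..s} (drift ?\<alpha> ?y)"
        using False s t tu
        by (intro Henstock_Kurzweil_Integration.integral_combine[symmetric] drift_integrable[OF \<alpha>] continuous_on_subset[OF cont]) auto
      then show ?thesis
        unfolding first[OF order_refl] second using D1(2)[OF u] D2(2)[of s] s False by simp
    qed
  qed
qed

end

section \<open>The value of an optimal stopping problem\<close>

lemma norm_Pair_diff_le:
  "norm ((x, t) - (x', t')) \<le> norm (x - x') + \<bar>t - t'\<bar>" for x x' :: "'a::real_normed_vector" and t t' :: real
  using norm_Pair_le[of "x - x'" "t - t'"] by simp

lemma uniformly_continuous_on_spacetime_iff:
  fixes u :: "(real^'d) \<times> real \<Rightarrow> real"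
  shows "uniformly_continuous_on (spacetime T) u \<longleftrightarrow>
     (\<forall>e>0. \<exists>\<delta>>0. \<forall>x x' t t'. t \<in> {0..T} \<and> t' \<in> {0..T} \<and> norm (x - x') < \<delta> \<and> \<bar>t - t'\<bar> < \<delta> \<longrightarrow> \<bar>u (x,t) - u (x',t')\<bar> < e)"
  (is "_ \<longleftrightarrow> ?R")
proof
  assume uc: "uniformly_continuous_on (spacetime T) u"
  show ?R
  proof (intro allI impI)
    fix e :: real assume "0 < e"
    then obtain d where d: "d > 0" "\<And>z z'. z \<in> spacetime T \<Longrightarrow> z' \<in> spacetime T \<Longrightarrow> dist z' z < d \<Longrightarrow> dist (u z') (u z) < e"
      using uc unfolding uniformly_continuous_on_def by metis
    show "\<exists>\<delta>>0. \<forall>x x' t t'. t \<in> {0..T} \<and> t' \<in> {0..T} \<and> norm (x - x') < \<delta> \<and> \<bar>t - t'\<bar> < \<delta> \<longrightarrow> \<bar>u (x,t) - u (x',t')\<bar> < e"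
    proof (intro exI[of _ "d/2"] conjI allI impI)
      fix x x' :: "real^'d" and t t'
      assume *: "t \<in> {0..T} \<and> t' \<in> {0..T} \<and> norm (x - x') < d/2 \<and> \<bar>t - t'\<bar> < d/2"
      have "dist (x,t) (x',t') < d"
        using norm_Pair_diff_le[of x t x' t'] * by (simp add: dist_norm)
      then show "\<bar>u (x,t) - u (x',t')\<bar> < e"
        using d(2)[of "(x',t')" "(x,t)"] * by (auto simp: spacetime_def dist_real_def)
    qed (use d in simp)
  qed
next
  assume R: ?R
  show "uniformly_continuous_on (spacetime T) u"
    unfolding uniformly_continuous_on_def
  proof (intro allI impI)
    fix e :: real assume "0 < e"
    then obtain d where d: "d > 0" "\<And>x x' t t'. t \<in> {0..T} \<Longrightarrow> t' \<in> {0..T} \<Longrightarrow> norm (x - x') < d \<Longrightarrow> \<bar>t - t'\<bar> < d \<Longrightarrow> \<bar>u (x,t) - u (x',t')\<bar> < e"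
      using R by meson
    show "\<exists>d>0. \<forall>z\<in>spacetime T. \<forall>z'\<in>spacetime T. dist z' z < d \<longrightarrow> dist (u z') (u z) < e"
    proof (intro exI[of _ d] conjI ballI impI)
      fix z z' :: "(real^'d) \<times> real" assume z: "z \<in> spacetime T" "z' \<in> spacetime T" "dist z' z < d"
      obtain x t x' t' where [simp]: "z = (x,t)" "z' = (x',t')" by fastforce
      have "norm (x' - x) < d" "\<bar>t' - t\<bar> < d"
        using z(3) dist_fst_le[of z' z] dist_snd_le[of z' z] by (simp_all add: dist_norm)
      then show "dist (u z') (u z) < e"
        using d(2)[of t' t x' x] z by (auto simp: spacetime_def dist_real_def)
    qed (use d in simp)
  qed
qed

text \<open>
  Since the control set is compact, a continuous function is uniformly continuous on compact sets
  of states, with a modulus that does not depend on the control. The running cost need not be uniformly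
  continuous in time on the whole space, so time is moved only while the states stay in a compact set.
\<close>

lemma equicontinuous_in_control:
  fixes G :: "'a::euclidean_space \<times> 'b::euclidean_space \<times> real \<Rightarrow> real"
  assumes G: "continuous_on (UNIV \<times> A \<times> {0..T}) G" and A: "compact A" and B: "compact B" and e: "0 < e"
  obtains \<delta> where "\<delta> > 0" "\<And>z z' a s s'. z \<in> B \<Longrightarrow> z' \<in> B \<Longrightarrow> a \<in> A \<Longrightarrow> s \<in> {0..T} \<Longrightarrow> s' \<in> {0..T} \<Longrightarrow>
      norm (z - z') < \<delta> \<Longrightarrow> \<bar>s - s'\<bar> < \<delta> \<Longrightarrow> \<bar>G (z, a, s) - G (z', a, s')\<bar> < e"
proof -
  have "compact (B \<times> A \<times> {0..T})" using A B by (intro compact_Times) auto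
  then have "uniformly_continuous_on (B \<times> A \<times> {0..T}) G"
    by (rule compact_uniformly_continuous[rotated]) (rule continuous_on_subset[OF G], auto)
  then obtain d where d: "d > 0" "\<And>w w'. w \<in> B \<times> A \<times> {0..T} \<Longrightarrow> w' \<in> B \<times> A \<times> {0..T} \<Longrightarrow> dist w' w < d \<Longrightarrow> dist (G w') (G w) < e"
    using e unfolding uniformly_continuous_on_def by metis
  show thesis
  proof (rule that[of "d/2"])
    fix z z' a s s'
    assume *: "z \<in> B" "z' \<in> B" "a \<in> A" "s \<in> {0..T}" "s' \<in> {0..T}" "norm (z - z') < d/2" "\<bar>s - s'\<bar> < d/2"
    have "norm ((z, a, s) - (z', a, s')) \<le> norm (z - z') + norm (s - s')"
      using norm_Pair_le[of "z - z'" "(0::'b, s - s')"] norm_Pair_le[of "0::'b" "s - s'"] by simp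
    then have "dist (z,a,s) (z',a,s') < d" using * by (simp add: dist_norm)
    then show "\<bar>G (z, a, s) - G (z', a, s')\<bar> < e"
      using d(2)[of "(z',a,s')" "(z,a,s)"] * by (auto simp: dist_real_def)
  qed (use d in simp)
qed

text \<open>
  One mode with a given obstacle: the controller picks a control and a stopping time, and pays \<open>\<psi>\<close> on
  stopping. For the switching problem \<open>\<psi>\<close> is the cheapest switching cost plus the value afterwards.
\<close>

locale optimal_stopping = switching_mode f l A T lam p K L M
  for f :: "real^'d \<Rightarrow> real^'m \<Rightarrow> ('n \<Rightarrow> bool) \<Rightarrow> real^'d"
    and l :: "real^'d \<Rightarrow> real^'m \<Rightarrow> ('n \<Rightarrow> bool) \<Rightarrow> real \<Rightarrow> real"
    and A :: "(real^'m) set" and T lam :: real and p :: "'n \<Rightarrow> bool" and K L M :: real +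
  fixes \<psi> :: "(real^'d) \<times> real \<Rightarrow> real" and P :: real
  assumes \<psi>_uc: "uniformly_continuous_on (spacetime T) \<psi>"
    and \<psi>_bounds: "\<And>x t. t \<in> {0..T} \<Longrightarrow> 0 \<le> \<psi> (x,t) \<and> \<psi> (x,t) \<le> P"
begin

lemma P_nonneg: "0 \<le> P"
  using \<psi>_bounds[of 0 0] T_pos by simp

definition running_cost :: "real \<Rightarrow> (real \<Rightarrow> real^'m) \<Rightarrow> (real \<Rightarrow> real^'d) \<Rightarrow> real \<Rightarrow> real" where
  "running_cost t \<alpha> y u = integral {t..u} (rate t \<alpha> y)"

definition cost :: "real \<Rightarrow> (real \<Rightarrow> real^'m) \<Rightarrow> (real \<Rightarrow> real^'d) \<Rightarrow> real \<Rightarrow> real" where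
  "cost t \<alpha> y \<tau> = running_cost t \<alpha> y \<tau> + exp (- lam * (\<tau> - t)) * \<psi> (y \<tau>, \<tau>)"

definition val :: "(real^'d) \<times> real \<Rightarrow> real" where
  "val = (\<lambda>(x,t). Inf {cost t \<alpha> y \<tau> | \<alpha> y \<tau>. \<alpha> \<in> controls A \<and> trajectory f T p x t \<alpha> y \<and> \<tau> \<in> {t..T}})"

lemma discount_bounds:
  assumes "0 \<le> h" "0 \<le> v" "v \<le> B"
  shows "v - lam * h * B \<le> exp (- lam * h) * v" "exp (- lam * h) * v \<le> v"
proof -
  have "1 + (- lam * h) \<le> exp (- lam * h)" by (rule exp_ge_add_one_self)
  then have "(1 + (- lam * h)) * v \<le> exp (- lam * h) * v" using assms(2) by (rule mult_right_mono)
  moreover have "lam * h * v \<le> lam * h * B" using lam_nonneg assms by (intro mult_left_mono) auto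
  ultimately show "v - lam * h * B \<le> exp (- lam * h) * v" by (simp add: algebra_simps)
  have "exp (- lam * h) \<le> 1" using lam_nonneg assms(1) by simp
  then show "exp (- lam * h) * v \<le> v" using assms(2) by (simp add: mult_left_le_one_le)
qed

lemma running_cost_bounds:
  assumes "\<alpha> \<in> controls A" "continuous_on {t..u} y" "0 \<le> t" "t \<le> u" "u \<le> T"
  shows "0 \<le> running_cost t \<alpha> y u" "running_cost t \<alpha> y u \<le> M * (u - t)"
proof -
  have int: "rate t \<alpha> y integrable_on {t..u}" using assms by (intro rate_integrable) auto
  have b: "0 \<le> rate t \<alpha> y s" "rate t \<alpha> y s \<le> M" if "s \<in> {t..u}" for s
    using rate_bounds[OF assms(1), of s t y] that assms by auto
  show "0 \<le> running_cost t \<alpha> y u" unfolding running_cost_def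
    using b by (intro Henstock_Kurzweil_Integration.integral_nonneg int) auto
  have "norm (integral {t..u} (rate t \<alpha> y)) \<le> M * (u - t)"
    using b assms by (intro norm_integral_le_const int) auto
  then show "running_cost t \<alpha> y u \<le> M * (u - t)" by (simp add: running_cost_def)
qed

lemma running_cost_split:
  assumes "\<alpha> \<in> controls A" "continuous_on {t..\<tau>} y" "0 \<le> t" "t \<le> u" "u \<le> \<tau>" "\<tau> \<le> T"
  shows "running_cost t \<alpha> y \<tau> = running_cost t \<alpha> y u + exp (- lam * (u - t)) * running_cost u \<alpha> y \<tau>"
proof -
  have "rate t \<alpha> y s = exp (- lam * (u - t)) * rate u \<alpha> y s" for s
  proof -
    have "exp (- lam * (s - t)) = exp (- lam * (u - t)) * exp (- lam * (s - u))"
      unfolding exp_add[symmetric] by (simp add: algebra_simps)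
    then show ?thesis by simp
  qed
  then have "integral {u..\<tau>} (rate t \<alpha> y) = integral {u..\<tau>} (\<lambda>s. exp (- lam * (u - t)) * rate u \<alpha> y s)"
    by (simp only:)
  then have eq: "integral {u..\<tau>} (rate t \<alpha> y) = exp (- lam * (u - t)) * running_cost u \<alpha> y \<tau>"
    by (simp add: running_cost_def)
  have "integral {t..\<tau>} (rate t \<alpha> y) = integral {t..u} (rate t \<alpha> y) + integral {u..\<tau>} (rate t \<alpha> y)"
    using assms by (intro Henstock_Kurzweil_Integration.integral_combine[symmetric] rate_integrable) auto
  then show ?thesis unfolding eq by (simp add: running_cost_def)
qed

lemma cost_split:
  assumes "\<alpha> \<in> controls A" "continuous_on {t..\<tau>} y" "0 \<le> t" "t \<le> u" "u \<le> \<tau>" "\<tau> \<le> T"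
  shows "cost t \<alpha> y \<tau> = running_cost t \<alpha> y u + exp (- lam * (u - t)) * cost u \<alpha> y \<tau>"
proof -
  have "exp (- lam * (\<tau> - t)) = exp (- lam * (u - t)) * exp (- lam * (\<tau> - u))"
    unfolding exp_add[symmetric] by (simp add: algebra_simps)
  then show ?thesis
    unfolding cost_def running_cost_split[OF assms] by (simp add: algebra_simps)
qed

lemma cost_nonneg:
  assumes "\<alpha> \<in> controls A" "trajectory f T p x t \<alpha> y" "0 \<le> t" "\<tau> \<in> {t..T}"
  shows "0 \<le> cost t \<alpha> y \<tau>"
proof -
  have "continuous_on {t..\<tau>} y"
    using trajectoryD(1)[OF assms(2,1,3)] assms(4) by (auto intro: continuous_on_subset)
  then show ?thesis
    unfolding cost_def using running_cost_bounds(1)[OF assms(1)] \<psi>_bounds assms(3,4) by (intro add_nonneg_nonneg) auto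
qed

lemma val_le_cost:
  assumes "\<alpha> \<in> controls A" "trajectory f T p x t \<alpha> y" "0 \<le> t" "\<tau> \<in> {t..T}"
  shows "val (x,t) \<le> cost t \<alpha> y \<tau>"
  unfolding val_def prod.case
proof (rule cInf_lower)
  show "bdd_below {cost t \<alpha> y \<tau> | \<alpha> y \<tau>. \<alpha> \<in> controls A \<and> trajectory f T p x t \<alpha> y \<and> \<tau> \<in> {t..T}}"
    by (rule bdd_belowI[of _ 0]) (use cost_nonneg assms(3) in blast)
qed (use assms in blast)

lemma competitors_nonempty:
  assumes "t \<in> {0..T}"
  shows "{cost t \<alpha> y \<tau> | \<alpha> y \<tau>. \<alpha> \<in> controls A \<and> trajectory f T p x t \<alpha> y \<and> \<tau> \<in> {t..T}} \<noteq> {}"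
proof -
  obtain a where "a \<in> A" using A_nonempty by blast
  moreover obtain y where "trajectory f T p x t (\<lambda>_. a) y"
    using trajectory_exists[OF const_control[OF \<open>a \<in> A\<close>]] assms by auto
  ultimately show ?thesis using const_control assms by fastforce
qed

lemma le_valI:
  assumes "t \<in> {0..T}"
    and "\<And>\<alpha> y \<tau>. \<alpha> \<in> controls A \<Longrightarrow> trajectory f T p x t \<alpha> y \<Longrightarrow> \<tau> \<in> {t..T} \<Longrightarrow> c \<le> cost t \<alpha> y \<tau>"
  shows "c \<le> val (x,t)"
  unfolding val_def prod.case
  by (rule cInf_greatest[OF competitors_nonempty[OF assms(1)]]) (use assms(2) in blast)

lemma near_optimal:
  assumes "t \<in> {0..T}" "0 < e"
  obtains \<alpha> y \<tau> where "\<alpha> \<in> controls A" "trajectory f T p x t \<alpha> y" "\<tau> \<in> {t..T}" "cost t \<alpha> y \<tau> < val (x,t) + e"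
  using le_valI[OF assms(1), of x "val (x,t) + e"] assms(2) by force

lemma val_le_obstacle:
  assumes "t \<in> {0..T}"
  shows "val (x,t) \<le> \<psi> (x,t)"
proof -
  obtain a where a: "a \<in> A" using A_nonempty by blast
  obtain y where y: "trajectory f T p x t (\<lambda>_. a) y"
    using trajectory_exists[OF const_control[OF a]] assms by auto
  have "y t = x" using y by (simp add: trajectory_def)
  with val_le_cost[OF const_control[OF a] y, of t] assms show ?thesis
    by (simp add: cost_def running_cost_def)
qed

lemma val_bounds:
  assumes "t \<in> {0..T}"
  shows "0 \<le> val (x,t)" "val (x,t) \<le> P"
  using le_valI[OF assms, of x 0] cost_nonneg val_le_obstacle[OF assms, of x] \<psi>_bounds[OF assms, of x] assms
  by (auto intro: order_trans)

text \<open>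
  Any competitor from \<open>(y u, u)\<close> can be preceded by the given control on \<open>[t,u]\<close>.
\<close>

lemma dynamic_programming_upper:
  assumes \<alpha>: "\<alpha> \<in> controls A" and y: "trajectory f T p x t \<alpha> y" and t: "0 \<le> t" and u: "u \<in> {t..T}"
  shows "val (x,t) \<le> running_cost t \<alpha> y u + exp (- lam * (u - t)) * val (y u, u)"
proof -
  let ?E = "exp (- lam * (u - t))"
  have "(val (x,t) - running_cost t \<alpha> y u) / ?E \<le> val (y u, u)"
  proof (rule le_valI)
    show "u \<in> {0..T}" using t u by simp
    fix \<alpha>2 y2 \<tau> assume 2: "\<alpha>2 \<in> controls A" "trajectory f T p (y u) u \<alpha>2 y2" "\<tau> \<in> {u..T}"
    let ?\<alpha> = "\<lambda>s. if s < u then \<alpha> s else \<alpha>2 s" and ?y = "\<lambda>s. if s \<le> u then y s else y2 s"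
    note c = trajectory_concat[OF y \<alpha> 2(2,1) t u]
    have tT: "t \<le> T" using u by simp
    have cont: "continuous_on {t..\<tau>} ?y"
      using trajectoryD(1)[OF c(2,1) t tT] by (rule continuous_on_subset) (use 2 in auto)
    have y2u: "y2 u = y u" using 2(2) by (simp add: trajectory_def)
    have r1: "running_cost t ?\<alpha> ?y u = running_cost t \<alpha> y u"
      unfolding running_cost_def by (rule integral_spike[of "{u}"]) auto
    have r2: "running_cost u ?\<alpha> ?y \<tau> = running_cost u \<alpha>2 y2 \<tau>"
      unfolding running_cost_def using y2u by (intro Henstock_Kurzweil_Integration.integral_cong) auto
    have r3: "?y \<tau> = y2 \<tau>" using y2u 2(3) by auto
    have "cost u ?\<alpha> ?y \<tau> = cost u \<alpha>2 y2 \<tau>"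
      unfolding cost_def r2 r3 by (rule refl)
    then have "cost t ?\<alpha> ?y \<tau> = running_cost t \<alpha> y u + ?E * cost u \<alpha>2 y2 \<tau>"
      using cost_split[OF c(1) cont t, of u] u 2(3) r1 by simp
    moreover have "val (x,t) \<le> cost t ?\<alpha> ?y \<tau>"
      using u 2(3) by (intro val_le_cost[OF c t]) auto
    ultimately show "(val (x,t) - running_cost t \<alpha> y u) / ?E \<le> cost u \<alpha>2 y2 \<tau>"
      by (simp add: pos_divide_le_eq mult.commute)
  qed
  then show ?thesis by (simp add: pos_divide_le_eq mult.commute)
qed

text \<open>
  The remainder of a trajectory after time \<open>u\<close> is itself a competitor from \<open>(y u, u)\<close>.
\<close>

lemma dynamic_programming_lower:
  assumes \<alpha>: "\<alpha> \<in> controls A" and y: "trajectory f T p x t \<alpha> y" and t: "0 \<le> t" and u: "t \<le> u" "u \<le> \<tau>" "\<tau> \<le> T"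
  shows "running_cost t \<alpha> y u + exp (- lam * (u - t)) * val (y u, u) \<le> cost t \<alpha> y \<tau>"
proof -
  have tT: "t \<le> T" using u by simp
  have cont: "continuous_on {t..\<tau>} y"
    using trajectoryD(1)[OF y \<alpha> t tT] by (rule continuous_on_subset) (use u in auto)
  have "val (y u, u) \<le> cost u \<alpha> y \<tau>"
    using u t by (intro val_le_cost[OF \<alpha>] trajectory_restrict[OF y \<alpha> t]) auto
  then show ?thesis unfolding cost_split[OF \<alpha> cont t u] by simp
qed

text \<open>
  A near-optimal control and stopping time for one initial state are used for the other; the two
  trajectories stay close by Gronwall's inequality, hence so do the costs.
\<close>

lemma val_space_modulus:
  assumes e: "0 < e"
  obtains \<delta> where "\<delta> > 0" "\<And>x x' t. t \<in> {0..T} \<Longrightarrow> norm (x - x') < \<delta> \<Longrightarrow> \<bar>val (x,t) - val (x',t)\<bar> < e"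
proof -
  define el where "el = e / (4 * T)"
  have el: "0 < el" using e T_pos by (simp add: el_def)
  obtain dl where dl: "dl > 0" "\<And>x y a t. a \<in> A \<Longrightarrow> t \<in> {0..T} \<Longrightarrow> norm (x - y) < dl \<Longrightarrow> \<bar>l x a p t - l y a p t\<bar> < el"
    using l_uc el by meson
  have "0 < e / 4" using e by simp
  then obtain dp where dp: "dp > 0" "\<And>x x' t t'. t \<in> {0..T} \<Longrightarrow> t' \<in> {0..T} \<Longrightarrow> norm (x - x') < dp \<Longrightarrow> \<bar>t - t'\<bar> < dp \<Longrightarrow> \<bar>\<psi> (x,t) - \<psi> (x',t')\<bar> < e / 4"
    using \<psi>_uc unfolding uniformly_continuous_on_spacetime_iff by meson
  define \<delta> where "\<delta> = min dl dp / exp (L * T)"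
  have \<delta>: "\<delta> > 0" using dl dp by (simp add: \<delta>_def)
  have one: "val (x,t) \<le> val (x',t) + 3 * e / 4" if t: "t \<in> {0..T}" and xx: "norm (x - x') < \<delta>" for x x' t
  proof -
    have t': "0 \<le> t" "t \<le> T" using t by auto
    obtain \<alpha> y' \<tau> where opt: "\<alpha> \<in> controls A" "trajectory f T p x' t \<alpha> y'" "\<tau> \<in> {t..T}" "cost t \<alpha> y' \<tau> < val (x',t) + e / 4"
      using near_optimal[OF t \<open>0 < e / 4\<close>] by blast
    obtain y where y: "trajectory f T p x t \<alpha> y" using trajectory_exists[OF opt(1) t'] by blast
    have near: "norm (y s - y' s) < min dl dp" if "s \<in> {t..T}" for s
    proof -
      have "norm (y s - y' s) \<le> norm (x - x') * exp (L * T)"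
        by (rule trajectory_dist_le[OF y opt(2,1) t'(1) that])
      also have "\<dots> < min dl dp" using xx by (simp add: \<delta>_def pos_less_divide_eq)
      finally show ?thesis .
    qed
    have cont: "continuous_on {t..\<tau>} y" "continuous_on {t..\<tau>} y'"
      using trajectoryD(1)[OF y opt(1) t'] trajectoryD(1)[OF opt(2,1) t'] opt(3) by (auto intro: continuous_on_subset)
    have int: "rate t \<alpha> z integrable_on {t..\<tau>}" if "continuous_on {t..\<tau>} z" for z
      by (rule rate_integrable[OF opt(1) that]) (use opt(3) t' in auto)
    have "running_cost t \<alpha> y \<tau> \<le> integral {t..\<tau>} (\<lambda>s. rate t \<alpha> y' s + el)"
      unfolding running_cost_def
    proof (rule integral_le[OF int[OF cont(1)]])
      show "(\<lambda>s. rate t \<alpha> y' s + el) integrable_on {t..\<tau>}" by (intro integrable_add int cont integrable_const_ivl)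
      fix s assume s: "s \<in> {t..\<tau>}"
      then have s': "s \<in> {t..T}" "s \<in> {0..T}" "t \<le> s" using opt(3) t' by auto
      have "l (y s) (\<alpha> s) p s \<le> l (y' s) (\<alpha> s) p s + el"
        using dl(2)[OF controls_in[OF opt(1)] s'(2), of s "y s" "y' s"] near[OF s'(1)] s'(2) by auto
      then have "rate t \<alpha> y s \<le> exp (- lam * (s - t)) * (l (y' s) (\<alpha> s) p s + el)"
        by (intro mult_left_mono) auto
      also have "\<dots> \<le> rate t \<alpha> y' s + el"
        using discount_bounds(2)[of "s - t" el el] el s' by (simp add: algebra_simps)
      finally show "rate t \<alpha> y s \<le> rate t \<alpha> y' s + el" .
    qed
    also have "\<dots> = running_cost t \<alpha> y' \<tau> + (\<tau> - t) * el"
      using opt(3) by (subst integral_add[OF int[OF cont(2)] integrable_const_ivl]) (simp add: running_cost_def)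
    also have "\<dots> \<le> running_cost t \<alpha> y' \<tau> + e / 4"
    proof -
      have "(\<tau> - t) * el \<le> T * el" using opt(3) t' el by (intro mult_right_mono) auto
      also have "\<dots> = e / 4" using T_pos by (simp add: el_def)
      finally show ?thesis by simp
    qed
    finally have run: "running_cost t \<alpha> y \<tau> \<le> running_cost t \<alpha> y' \<tau> + e / 4" .
    have "\<psi> (y \<tau>, \<tau>) \<le> \<psi> (y' \<tau>, \<tau>) + e / 4"
    proof -
      have "\<bar>\<psi> (y \<tau>, \<tau>) - \<psi> (y' \<tau>, \<tau>)\<bar> < e / 4"
        by (rule dp(2)) (use near[OF opt(3)] opt(3) t' dp(1) in auto)
      then show ?thesis by linarith
    qed
    then have "exp (- lam * (\<tau> - t)) * \<psi> (y \<tau>, \<tau>) \<le> exp (- lam * (\<tau> - t)) * (\<psi> (y' \<tau>, \<tau>) + e / 4)"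
      by (intro mult_left_mono) auto
    also have "\<dots> \<le> exp (- lam * (\<tau> - t)) * \<psi> (y' \<tau>, \<tau>) + e / 4"
      using discount_bounds(2)[of "\<tau> - t" "e/4" "e/4"] e opt(3) by (simp add: algebra_simps)
    finally have "cost t \<alpha> y \<tau> \<le> cost t \<alpha> y' \<tau> + e / 4 + e / 4" using run by (simp add: cost_def)
    then show ?thesis using val_le_cost[OF opt(1) y t'(1) opt(3)] opt(4) by linarith
  qed
  show thesis
  proof (rule that[OF \<delta>])
    fix x x' :: "real^'d" and t assume "t \<in> {0..T}" "norm (x - x') < \<delta>"
    then show "\<bar>val (x,t) - val (x',t)\<bar> < e"
      using one[of t x x'] one[of t x' x] e by (auto simp: norm_minus_commute abs_if)
  qed
qed


text \<open>
  For \<open>t \<le> t'\<close>, running any control on \<open>[t,t']\<close> bounds the value at \<open>t\<close> from above. From below, a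
  near-optimal stopping time for \<open>t\<close> either lies after \<open>t'\<close>, and then dynamic programming applies, or before
  \<open>t'\<close>, and then its cost is at least \<open>\<psi> (x,t')\<close> up to a small error, and the value at \<open>t'\<close> does not
  exceed \<open>\<psi> (x,t')\<close>.
\<close>

lemma val_time_modulus:
  assumes e: "0 < e"
  obtains \<delta> where "\<delta> > 0" "\<And>x t t'. 0 \<le> t \<Longrightarrow> t \<le> t' \<Longrightarrow> t' \<le> T \<Longrightarrow> t' - t < \<delta> \<Longrightarrow> \<bar>val (x,t) - val (x,t')\<bar> < e"
proof -
  have e4: "0 < e / 4" using e by simp
  obtain ds where ds: "ds > 0" "\<And>x x' t. t \<in> {0..T} \<Longrightarrow> norm (x - x') < ds \<Longrightarrow> \<bar>val (x,t) - val (x',t)\<bar> < e / 4"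
    using val_space_modulus[OF e4] by blast
  obtain dp where dp: "dp > 0" "\<And>x x' t t'. t \<in> {0..T} \<Longrightarrow> t' \<in> {0..T} \<Longrightarrow> norm (x - x') < dp \<Longrightarrow> \<bar>t - t'\<bar> < dp \<Longrightarrow> \<bar>\<psi> (x,t) - \<psi> (x',t')\<bar> < e / 4"
    using \<psi>_uc e4 unfolding uniformly_continuous_on_spacetime_iff by meson
  \<comment> \<open>A trajectory moves by at most \<open>K (t' - t)\<close>; the other entries bound the running cost and the loss from discounting.\<close>
  define \<delta> where "\<delta> = Min {ds / (K + 1), dp / (K + 1), dp, e / (4 * (M + 1)), e / (4 * (lam * P + 1))}"
  have pos: "0 < K + 1" "0 < M + 1" "0 < lam * P + 1"
    using K_nonneg M_nonneg P_nonneg lam_nonneg by (auto intro: add_nonneg_pos)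
  have \<delta>: "\<delta> > 0" using ds dp e pos by (simp add: \<delta>_def)
  show thesis
  proof (rule that[OF \<delta>])
    fix x :: "real^'d" and t t' assume t: "0 \<le> t" "t \<le> t'" "t' \<le> T" and near: "t' - t < \<delta>"
    have tT: "t \<in> {0..T}" "t' \<in> {0..T}" "t \<le> T" using t by auto
    have "t' - t < ds / (K + 1)" "t' - t < dp / (K + 1)" "t' - t < dp"
        "t' - t < e / (4 * (M + 1))" "t' - t < e / (4 * (lam * P + 1))" using near by (auto simp: \<delta>_def)
    then have n: "(K + 1) * (t' - t) < ds" "(K + 1) * (t' - t) < dp" "t' - t < dp"
        "(M + 1) * (t' - t) < e / 4" "(lam * P + 1) * (t' - t) < e / 4"
      using pos by (simp_all add: field_simps)
    have M4: "M * (t' - t) \<le> e / 4" and P4: "lam * (t' - t) * P \<le> e / 4" and Kt: "K * (t' - t) \<le> (K + 1) * (t' - t)"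
      using n t by (simp_all add: algebra_simps)
    have move: "norm (y s - x) < ds" "norm (y s - x) < dp"
      if "\<alpha> \<in> controls A" "trajectory f T p x t \<alpha> y" "s \<in> {t..t'}" for \<alpha> y s
    proof -
      have "norm (y s - y t) \<le> K * (s - t)"
        by (rule trajectory_speed(2)[OF that(2,1) t(1)]) (use that(3) t in auto)
      also have "K * (s - t) \<le> K * (t' - t)" using K_nonneg that(3) by (intro mult_left_mono) auto
      finally have "norm (y s - x) \<le> K * (t' - t)" using that(2) by (simp add: trajectory_def)
      then show "norm (y s - x) < ds" "norm (y s - x) < dp" using n Kt by linarith+
    qed
    obtain a where a: "a \<in> A" using A_nonempty by blast
    note ca = const_control[OF a]
    obtain y where y: "trajectory f T p x t (\<lambda>_. a) y"
      using trajectory_exists[OF ca t(1) tT(3)] by blast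
    have "val (x,t) \<le> running_cost t (\<lambda>_. a) y t' + exp (- lam * (t' - t)) * val (y t', t')"
      by (rule dynamic_programming_upper[OF ca y t(1)]) (use t in auto)
    also have "running_cost t (\<lambda>_. a) y t' \<le> M * (t' - t)"
      by (rule running_cost_bounds(2)[OF ca _ t])
         (use trajectoryD(1)[OF y ca t(1) tT(3)] t in \<open>auto intro: continuous_on_subset\<close>)
    also have "exp (- lam * (t' - t)) * val (y t', t') \<le> val (y t', t')"
      by (rule discount_bounds(2)[where B = P]) (use t val_bounds[OF tT(2)] in auto)
    also have "val (y t', t') \<le> val (x, t') + e / 4"
    proof -
      have "\<bar>val (y t', t') - val (x, t')\<bar> < e / 4"
        by (rule ds(2)[OF tT(2) move(1)[OF ca y]]) (use t in auto)
      then show ?thesis by linarith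
    qed
    finally have upper: "val (x,t) \<le> val (x,t') + e / 2" using M4 by simp
    obtain \<alpha> y \<tau> where opt: "\<alpha> \<in> controls A" "trajectory f T p x t \<alpha> y" "\<tau> \<in> {t..T}" "cost t \<alpha> y \<tau> < val (x,t) + e / 4"
      using near_optimal[OF tT(1) e4] by blast
    have "val (x,t') - e / 2 \<le> cost t \<alpha> y \<tau>"
    proof (cases "t' \<le> \<tau>")
      case True
      have cont: "continuous_on {t..t'} y"
        using trajectoryD(1)[OF opt(2,1) t(1) tT(3)] t by (auto intro: continuous_on_subset)
      have "val (x,t') - e / 4 \<le> val (y t', t')"
      proof -
        have "\<bar>val (y t', t') - val (x, t')\<bar> < e / 4"
          by (rule ds(2)[OF tT(2) move(1)[OF opt(1,2)]]) (use t in auto)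
        then show ?thesis by linarith
      qed
      also have "\<dots> - lam * (t' - t) * P \<le> exp (- lam * (t' - t)) * val (y t', t')"
        by (rule discount_bounds(1)) (use t val_bounds[OF tT(2)] in auto)
      also have "\<dots> \<le> running_cost t \<alpha> y t' + exp (- lam * (t' - t)) * val (y t', t')"
        using running_cost_bounds(1)[OF opt(1) cont t] by simp
      also have "\<dots> \<le> cost t \<alpha> y \<tau>"
        by (rule dynamic_programming_lower[OF opt(1,2) t(1,2) True]) (use opt(3) in auto)
      finally show ?thesis using P4 by simp
    next
      case False
      then have \<tau>: "0 \<le> \<tau>" "t \<le> \<tau>" "\<tau> \<le> t'" "\<tau> \<le> T" using opt(3) t by auto
      have cont: "continuous_on {t..\<tau>} y"
        using trajectoryD(1)[OF opt(2,1) t(1) tT(3)] \<tau> by (auto intro: continuous_on_subset)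
      have "val (x,t') \<le> \<psi> (x,t')" by (rule val_le_obstacle[OF tT(2)])
      also have "\<psi> (x,t') \<le> \<psi> (y \<tau>, \<tau>) + e / 4"
      proof -
        have "\<bar>\<psi> (y \<tau>, \<tau>) - \<psi> (x, t')\<bar> < e / 4"
          by (rule dp(2)[OF _ tT(2) move(2)[OF opt(1,2)]]) (use \<tau> n(3) t in auto)
        then show ?thesis by linarith
      qed
      also have "\<psi> (y \<tau>, \<tau>) \<le> exp (- lam * (\<tau> - t)) * \<psi> (y \<tau>, \<tau>) + lam * (\<tau> - t) * P"
        using discount_bounds(1)[of "\<tau> - t" "\<psi> (y \<tau>, \<tau>)" P] \<psi>_bounds[of \<tau> "y \<tau>"] \<tau> by simp
      also have "lam * (\<tau> - t) * P \<le> lam * (t' - t) * P"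
        using lam_nonneg P_nonneg \<tau> by (intro mult_right_mono mult_left_mono) auto
      also have "exp (- lam * (\<tau> - t)) * \<psi> (y \<tau>, \<tau>) \<le> cost t \<alpha> y \<tau>"
        using running_cost_bounds(1)[OF opt(1) cont t(1) \<tau>(2,4)] by (simp add: cost_def)
      finally show ?thesis using P4 by simp
    qed
    then have "val (x,t') < val (x,t) + e" using opt(4) e by linarith
    then show "\<bar>val (x,t) - val (x,t')\<bar> < e" using upper e by (simp add: abs_if)
  qed
qed

lemma val_BUC: "BUC T val"
  unfolding BUC_def
proof
  show "bounded (val ` spacetime T)"
    unfolding bounded_iff using val_bounds by (intro exI[of _ P]) (auto simp: spacetime_def)
  show "uniformly_continuous_on (spacetime T) val"
    unfolding uniformly_continuous_on_spacetime_iff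
  proof (intro allI impI)
    fix e :: real assume "0 < e"
    then have e2: "0 < e / 2" by simp
    obtain d1 where d1: "d1 > 0" "\<And>x x' t. t \<in> {0..T} \<Longrightarrow> norm (x - x') < d1 \<Longrightarrow> \<bar>val (x,t) - val (x',t)\<bar> < e / 2"
      using val_space_modulus[OF e2] by blast
    obtain d2 where d2: "d2 > 0" "\<And>x t t'. 0 \<le> t \<Longrightarrow> t \<le> t' \<Longrightarrow> t' \<le> T \<Longrightarrow> t' - t < d2 \<Longrightarrow> \<bar>val (x,t) - val (x,t')\<bar> < e / 2"
      using val_time_modulus[OF e2] by blast
    show "\<exists>\<delta>>0. \<forall>x x' t t'. t \<in> {0..T} \<and> t' \<in> {0..T} \<and> norm (x - x') < \<delta> \<and> \<bar>t - t'\<bar> < \<delta> \<longrightarrow> \<bar>val (x,t) - val (x',t')\<bar> < e"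
    proof (intro exI[of _ "min d1 d2"] conjI allI impI)
      fix x x' :: "real^'d" and t t' assume *: "t \<in> {0..T} \<and> t' \<in> {0..T} \<and> norm (x - x') < min d1 d2 \<and> \<bar>t - t'\<bar> < min d1 d2"
      have "\<bar>val (x,t) - val (x',t)\<bar> < e / 2" using * by (intro d1) auto
      moreover have "\<bar>val (x',t) - val (x',t')\<bar> < e / 2"
        using * d2(2)[of t t' x'] d2(2)[of t' t x'] by (cases "t \<le> t'") (auto simp: abs_minus_commute)
      ultimately show "\<bar>val (x,t) - val (x',t')\<bar> < e" by linarith
    qed (use d1 d2 in simp)
  qed
qed

end

section \<open>The value is a viscosity solution\<close>

context switching_mode
begin

lemma abs_inner_drift_le:
  assumes "a \<in> A"
  shows "\<bar>f x a p \<bullet> g\<bar> \<le> K * norm g"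
  using Cauchy_Schwarz_ineq2[of "f x a p" g] mult_right_mono[OF f_bound[OF assms] norm_ge_zero[of g]]
  by (rule order_trans)

lemma hamiltonian_upper:
  assumes "a \<in> A" "t \<in> {0..T}"
  shows "- (f x a p \<bullet> \<xi>) - l x a p t \<le> hamiltonian f l A p x t \<xi>"
  unfolding hamiltonian_def
proof (rule cSUP_upper[OF assms(1)])
  show "bdd_above ((\<lambda>a. - (f x a p \<bullet> \<xi>) - l x a p t) ` A)"
  proof (rule bdd_aboveI2)
    fix a assume a: "a \<in> A"
    have "\<bar>f x a p \<bullet> \<xi>\<bar> \<le> K * norm \<xi>"
      by (rule abs_inner_drift_le[OF a])
    then show "- (f x a p \<bullet> \<xi>) - l x a p t \<le> K * norm \<xi>" using l_nonneg[OF a assms(2), of x] by linarith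
  qed
qed

lemma hamiltonian_least:
  assumes "\<And>a. a \<in> A \<Longrightarrow> - (f x a p \<bullet> \<xi>) - l x a p t \<le> c"
  shows "hamiltonian f l A p x t \<xi> \<le> c"
  unfolding hamiltonian_def by (rule cSUP_least[OF A_nonempty assms])

text \<open>
  The structure condition behind the comparison principle: moving the state costs a multiple of
  \<open>norm (x - y) * norm \<xi>\<close>, moving the momentum costs at most its displacement times \<open>K\<close>, and \<open>\<omega>\<close> accounts for the running cost.
\<close>

lemma hamiltonian_perturb:
  assumes t: "t \<in> {0..T}" and l: "\<And>a. a \<in> A \<Longrightarrow> \<bar>l x a p t - l y a p s\<bar> \<le> \<omega>"
  shows "hamiltonian f l A p y s \<xi> \<le> hamiltonian f l A p x t (\<xi> + \<zeta>) + L * norm (x - y) * norm \<xi> + K * norm \<zeta> + \<omega>"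
proof (rule hamiltonian_least)
  fix a assume a: "a \<in> A"
  have "f x a p \<bullet> (\<xi> + \<zeta>) - f y a p \<bullet> \<xi> = (f x a p - f y a p) \<bullet> \<xi> + f x a p \<bullet> \<zeta>"
    by (simp add: inner_simps)
  moreover have "\<bar>(f x a p - f y a p) \<bullet> \<xi>\<bar> \<le> L * norm (x - y) * norm \<xi>"
    using Cauchy_Schwarz_ineq2[of "f x a p - f y a p" \<xi>] mult_right_mono[OF f_lip[OF a, of x y] norm_ge_zero[of \<xi>]]
    by (rule order_trans)
  moreover note abs_inner_drift_le[OF a, of x \<zeta>] hamiltonian_upper[OF a t, of x "\<xi> + \<zeta>"] l[OF a]
  ultimately show "- (f y a p \<bullet> \<xi>) - l y a p s \<le> hamiltonian f l A p x t (\<xi> + \<zeta>) + L * norm (x - y) * norm \<xi> + K * norm \<zeta> + \<omega>"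
    by linarith
qed

end

context optimal_stopping
begin

lemma trajectory_near:
  assumes "trajectory f T p x t \<alpha> y" "\<alpha> \<in> controls A" "0 \<le> t" "0 \<le> h" "t + h \<le> T"
  shows "dist (y (t + h), t + h) (x, t) \<le> (K + 1) * h"
proof -
  have "norm (y (t + h) - x) \<le> K * h"
    using trajectory_speed(2)[OF assms(1-3), of t "t + h"] assms by (simp add: trajectory_def)
  then show ?thesis
    using norm_Pair_diff_le[of "y (t + h)" "t + h" x t] assms(4) by (simp add: dist_norm algebra_simps)
qed

lemma frozen_integrable:
  assumes \<alpha>: "\<alpha> \<in> controls A" and t: "0 \<le> t" "u \<le> T" "t0 \<in> {0..T}"
  shows "(\<lambda>s. l x (\<alpha> s) p t0 + f x (\<alpha> s) p \<bullet> g) integrable_on {t..u}"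
proof -
  have "continuous_on (UNIV \<times> A \<times> {0..T}) (\<lambda>z. case (x, fst (snd z), t0) of (x, a, t) \<Rightarrow> l x a p t)"
    by (rule continuous_on_compose2[OF l_cont]) (use t in \<open>auto intro!: continuous_intros\<close>)
  then have c: "continuous_on (UNIV \<times> A \<times> {0..T}) (\<lambda>z. l x (fst (snd z)) p t0 + f (fst z) (fst (snd z)) p \<bullet> g)"
    by (intro continuous_intros f_cont_spacetime) simp
  have b: "norm (l x a p t0 + f x a p \<bullet> g) \<le> M + K * norm g" if "a \<in> A" for a
    using l_nonneg[OF that t(3), of x] l_bound[OF that t(3), of x] abs_inner_drift_le[OF that, of x g] by simp
  have "(\<lambda>s. l x (fst (snd (x, \<alpha> s, s))) p t0 + f (fst (x, \<alpha> s, s)) (fst (snd (x, \<alpha> s, s))) p \<bullet> g) absolutely_integrable_on {t..u}"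
    by (rule integrable_along_curve[OF c \<alpha> continuous_on_const t(1,2), where B = "M + K * norm g"])
       (use b controls_in[OF \<alpha>] t in auto)
  then show ?thesis using set_lebesgue_integral_eq_integral(1) by fastforce
qed

text \<open>
  Dynamic programming compares \<open>\<phi>\<close> at \<open>(x,t)\<close> with the running cost plus the discounted \<open>\<phi>\<close> a short time
  \<open>h\<close> later. Differentiability of \<open>\<phi>\<close> at the single point \<open>(x,t)\<close> suffices for this: the increment of \<open>y\<close> is
  the integral of the drift, and since \<open>y\<close> moves with speed at most \<open>K\<close>, the state and the time
  can be frozen in the drift and in the running cost with an error \<open>o(h)\<close> that does not depend on the control.
\<close>

lemma first_order_expansion:
  assumes t: "0 \<le> t" "t < T"
    and \<phi>: "(\<phi> has_derivative (\<lambda>(h,k). g \<bullet> h + q * k)) (at (x,t) within spacetime T)" and e: "0 < e"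
  obtains h0 where "h0 > 0" "t + h0 \<le> T"
    "\<And>h \<alpha> y. 0 < h \<Longrightarrow> h < h0 \<Longrightarrow> \<alpha> \<in> controls A \<Longrightarrow> trajectory f T p x t \<alpha> y \<Longrightarrow>
      \<bar>running_cost t \<alpha> y (t + h) + exp (- lam * h) * \<phi> (y (t + h), t + h) - \<phi> (x,t)
        - (integral {t..t+h} (\<lambda>s. l x (\<alpha> s) p t + f x (\<alpha> s) p \<bullet> g) + h * (q - lam * \<phi> (x,t)))\<bar> \<le> e * h"
proof -
  define G where "G = (\<lambda>(z, a, s). exp (- lam * (s - t)) * l z a p s + f z a p \<bullet> g)"
  have G: "continuous_on (UNIV \<times> A \<times> {0..T}) G"
    using l_cont f_cont_spacetime unfolding G_def split_def by (intro continuous_intros)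
  have Gb: "norm (G (z, a, s)) \<le> M + K * norm g" if "a \<in> A" "s \<in> {t..T}" for z a s
  proof -
    have "0 \<le> exp (- lam * (s - t)) * l z a p s" "exp (- lam * (s - t)) * l z a p s \<le> M"
      using rate_bounds[OF const_control[OF that(1)], of s t "\<lambda>_. z"] that t by auto
    moreover have "\<bar>f z a p \<bullet> g\<bar> \<le> K * norm g"
      by (rule abs_inner_drift_le[OF that(1)])
    ultimately show ?thesis by (simp add: G_def)
  qed
  have e2: "0 < e / 2" using e by simp
  obtain \<delta> where \<delta>: "\<delta> > 0" "\<And>z z' a s s'. z \<in> cball x 1 \<Longrightarrow> z' \<in> cball x 1 \<Longrightarrow> a \<in> A \<Longrightarrow> s \<in> {0..T} \<Longrightarrow> s' \<in> {0..T} \<Longrightarrow>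
      norm (z - z') < \<delta> \<Longrightarrow> \<bar>s - s'\<bar> < \<delta> \<Longrightarrow> \<bar>G (z, a, s) - G (z', a, s')\<bar> < e / 2"
    using equicontinuous_in_control[OF G A_compact compact_cball e2] by blast
  \<comment> \<open>Including the discount in the test function yields the term \<open>- lam * \<phi> (x,t)\<close> in the time derivative.\<close>
  define \<Theta> where "\<Theta> = (\<lambda>z. exp (- lam * (snd z - t)) * \<phi> z)"
  have "(\<Theta> has_derivative (\<lambda>w. exp (- lam * (snd (x,t) - t)) * (case w of (h,k) \<Rightarrow> g \<bullet> h + q * k)
           + exp (- lam * (snd (x,t) - t)) * (- lam * snd w) * \<phi> (x,t))) (at (x,t) within spacetime T)"
    unfolding \<Theta>_def by (rule has_derivative_mult[OF _ \<phi>]) (auto intro!: derivative_eq_intros)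
  then have "(\<Theta> has_derivative (\<lambda>(h,k). g \<bullet> h + (q - lam * \<phi> (x,t)) * k)) (at (x,t) within spacetime T)"
    by (rule has_derivative_eq_rhs) (auto simp: fun_eq_iff algebra_simps)
  moreover have e1: "0 < e / (2 * (K + 1))" using e K_nonneg by simp
  ultimately obtain d where d: "d > 0" "\<And>z. z \<in> spacetime T \<Longrightarrow> norm (z - (x,t)) < d \<Longrightarrow>
      norm (\<Theta> z - \<Theta> (x,t) - (case z - (x,t) of (h,k) \<Rightarrow> g \<bullet> h + (q - lam * \<phi> (x,t)) * k)) \<le> e / (2 * (K + 1)) * norm (z - (x,t))"
    unfolding has_derivative_within_alt by meson
  define h0 where "h0 = Min {T - t, d / (K + 1), \<delta> / (K + 1), 1 / (K + 1)}"
  have K1: "0 < K + 1" using K_nonneg by simp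
  have h0: "h0 > 0" "t + h0 \<le> T" using t d \<delta> K1 by (auto simp: h0_def)
  show thesis
  proof (rule that[OF h0])
    fix h \<alpha> y assume h: "0 < h" "h < h0" and \<alpha>: "\<alpha> \<in> controls A" and y: "trajectory f T p x t \<alpha> y"
    have "h < T - t" "h < d / (K + 1)" "h < \<delta> / (K + 1)" "h < 1 / (K + 1)" using h by (auto simp: h0_def)
    then have h': "t + h \<le> T" "(K + 1) * h < d" "(K + 1) * h < \<delta>" "(K + 1) * h < 1"
      using K1 by (simp_all add: field_simps)
    have "h \<le> (K + 1) * h" using K_nonneg h(1) by (simp add: algebra_simps)
    then have h'': "h < \<delta>" using h'(3) by linarith
    have tT: "t \<le> T" using t by simp
    have yt: "y t = x" using y by (simp add: trajectory_def)
    have cont: "continuous_on {t..t+h} y"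
      using trajectoryD(1)[OF y \<alpha> t(1) tT] by (rule continuous_on_subset) (use h' in auto)
    have near: "norm (y s - x) < \<delta>" "norm (y s - x) \<le> 1" if "s \<in> {t..t+h}" for s
    proof -
      have "norm (y s - x) \<le> K * (s - t)"
        using trajectory_speed(2)[OF y \<alpha> t(1), of t s] that h' yt by simp
      also have "\<dots> \<le> (K + 1) * h" using that K_nonneg h by (intro mult_mono) auto
      finally show "norm (y s - x) < \<delta>" "norm (y s - x) \<le> 1" using h' by linarith+
    qed
    have inA: "\<alpha> s \<in> A" if "s \<in> {t..t+h}" for s using that t controls_in[OF \<alpha>] by auto
    have intG: "(\<lambda>s. G (y s, \<alpha> s, s)) integrable_on {t..t+h}"
      by (rule set_lebesgue_integral_eq_integral(1), rule integrable_along_curve[OF G \<alpha> cont t(1) h'(1), where B = "M + K * norm g"])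
         (use Gb inA h' in auto)
    have intG0: "(\<lambda>s. G (x, \<alpha> s, t)) integrable_on {t..t+h}"
      using frozen_integrable[OF \<alpha> t(1) h'(1), of t x g] t by (simp add: G_def)
    have intr: "rate t \<alpha> y integrable_on {t..t+h}" and intd: "drift \<alpha> y integrable_on {t..t+h}"
      by (rule rate_integrable[OF \<alpha> cont t(1) h'(1) order_refl], rule drift_integrable[OF \<alpha> cont t(1) h'(1)])
    have lin: "bounded_linear (\<lambda>v. v \<bullet> g)" by (rule bounded_linear_inner_left)
    have "integral {t..t+h} (\<lambda>s. G (y s, \<alpha> s, s)) = integral {t..t+h} (\<lambda>s. rate t \<alpha> y s + drift \<alpha> y s \<bullet> g)"
      by (simp add: G_def)
    also have "\<dots> = running_cost t \<alpha> y (t + h) + integral {t..t+h} (\<lambda>s. drift \<alpha> y s \<bullet> g)"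
      unfolding running_cost_def by (rule integral_add[OF intr]) (rule integrable_linear[OF intd lin, unfolded o_def])
    also have "integral {t..t+h} (\<lambda>s. drift \<alpha> y s \<bullet> g) = integral {t..t+h} (drift \<alpha> y) \<bullet> g"
      using integral_linear[OF intd lin] by (simp add: o_def)
    also have "integral {t..t+h} (drift \<alpha> y) = y (t + h) - x"
      using trajectory_speed(1)[OF y \<alpha> t(1), of t "t + h"] h h' yt by simp
    finally have G_eq: "integral {t..t+h} (\<lambda>s. G (y s, \<alpha> s, s)) = running_cost t \<alpha> y (t + h) + g \<bullet> (y (t + h) - x)"
      by (simp add: inner_commute)
    have "norm (integral {t..t+h} (\<lambda>s. G (y s, \<alpha> s, s) - G (x, \<alpha> s, t))) \<le> e / 2 * (t + h - t)"
    proof (rule norm_integral_le_const[OF integrable_diff[OF intG intG0]])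
      fix s assume s: "s \<in> {t..t+h}"
      have "\<bar>G (y s, \<alpha> s, s) - G (x, \<alpha> s, t)\<bar> < e / 2"
        by (rule \<delta>(2)[OF _ _ inA[OF s] _ _ near(1)[OF s]])
           (use s t near(2)[OF s] h' h'' in \<open>auto simp: dist_norm norm_minus_commute\<close>)
      then show "norm (G (y s, \<alpha> s, s) - G (x, \<alpha> s, t)) \<le> e / 2" by simp
    qed (use h in simp)
    then have close1: "\<bar>running_cost t \<alpha> y (t + h) + g \<bullet> (y (t + h) - x) - integral {t..t+h} (\<lambda>s. G (x, \<alpha> s, t))\<bar> \<le> e / 2 * h"
      by (simp add: integral_diff[OF intG intG0] G_eq)
    have dist: "norm ((y (t + h), t + h) - (x,t)) \<le> (K + 1) * h"
      using trajectory_near[OF y \<alpha> t(1), of h] h h' by (simp add: dist_norm)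
    have "norm (\<Theta> (y (t + h), t + h) - \<Theta> (x,t) - (case (y (t + h), t + h) - (x,t) of (h,k) \<Rightarrow> g \<bullet> h + (q - lam * \<phi> (x,t)) * k))
        \<le> e / (2 * (K + 1)) * norm ((y (t + h), t + h) - (x,t))"
      by (rule d(2)) (use dist h' h t in \<open>auto simp: spacetime_def\<close>)
    also have "\<dots> \<le> e / (2 * (K + 1)) * ((K + 1) * h)"
      using e1 dist by (intro mult_left_mono) auto
    also have "\<dots> = e / 2 * h" using K1 by (simp add: field_simps)
    finally have close2: "\<bar>exp (- lam * h) * \<phi> (y (t + h), t + h) - \<phi> (x,t) - (g \<bullet> (y (t + h) - x) + (q - lam * \<phi> (x,t)) * h)\<bar> \<le> e / 2 * h"
      by (simp add: \<Theta>_def)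
    have "integral {t..t+h} (\<lambda>s. G (x, \<alpha> s, t)) = integral {t..t+h} (\<lambda>s. l x (\<alpha> s) p t + f x (\<alpha> s) p \<bullet> g)"
      by (simp add: G_def)
    moreover have "(q - lam * \<phi> (x,t)) * h = h * (q - lam * \<phi> (x,t))" by (rule mult.commute)
    moreover have "e * h = e / 2 * h + e / 2 * h" by simp
    ultimately show "\<bar>running_cost t \<alpha> y (t + h) + exp (- lam * h) * \<phi> (y (t + h), t + h) - \<phi> (x,t)
        - (integral {t..t+h} (\<lambda>s. l x (\<alpha> s) p t + f x (\<alpha> s) p \<bullet> g) + h * (q - lam * \<phi> (x,t)))\<bar> \<le> e * h"
      using close1 close2 by linarith
  qed
qed

lemma val_terminal: "val (x,T) = \<psi> (x,T)"
proof (rule antisym)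
  show "val (x,T) \<le> \<psi> (x,T)" using T_pos by (intro val_le_obstacle) auto
  show "\<psi> (x,T) \<le> val (x,T)"
  proof (rule le_valI)
    fix \<alpha> y \<tau> assume "trajectory f T p x T \<alpha> y" "\<tau> \<in> {T..T}"
    then show "\<psi> (x,T) \<le> cost T \<alpha> y \<tau>" by (simp add: cost_def running_cost_def trajectory_def)
  qed (use T_pos in auto)
qed

lemma local_max_onD:
  assumes "local_max_on S w z"
  obtains \<rho> where "\<rho> > 0" "\<And>z'. z' \<in> S \<Longrightarrow> dist z' z < \<rho> \<Longrightarrow> w z' \<le> w z"
  using assms unfolding local_max_on_def eventually_at by (metis order_refl)

text \<open>
  If the inequality failed, some constant control \<open>a\<close> would violate it strictly; following \<open>a\<close> for a short
  time would then cost less than the value, by the expansion of the test function.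
\<close>

lemma val_subsolution:
  assumes \<phi>: "C1_with T \<phi> g q" and max: "local_max_on (UNIV \<times> {0..<T}) (\<lambda>z. val z - \<phi> z) (x,t)"
  shows "max (val (x,t) - \<psi> (x,t)) (- q (x,t) + lam * val (x,t) + hamiltonian f l A p x t (g (x,t))) \<le> 0"
proof -
  have t: "0 \<le> t" "t < T" "t \<in> {0..T}" using max by (auto simp: local_max_on_def)
  let ?v = "val (x,t)"
  \<comment> \<open>The test function is shifted so as to touch the value at \<open>(x,t)\<close>.\<close>
  define \<phi>' where "\<phi>' = (\<lambda>z. \<phi> z + (?v - \<phi> (x,t)))"
  have \<phi>'0: "\<phi>' (x,t) = ?v" by (simp add: \<phi>'_def)
  have "(\<phi> has_derivative (\<lambda>(h,k). g (x,t) \<bullet> h + q (x,t) * k)) (at (x,t) within spacetime T)"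
    using \<phi> t by (auto simp: C1_with_def spacetime_def)
  then have der: "(\<phi>' has_derivative (\<lambda>(h,k). g (x,t) \<bullet> h + q (x,t) * k)) (at (x,t) within spacetime T)"
    unfolding \<phi>'_def by (rule has_derivative_add_const)
  obtain \<rho> where \<rho>: "\<rho> > 0" "\<And>z'. z' \<in> UNIV \<times> {0..<T} \<Longrightarrow> dist z' (x,t) < \<rho> \<Longrightarrow> val z' - \<phi> z' \<le> ?v - \<phi> (x,t)"
    using local_max_onD[OF max] by blast
  have "hamiltonian f l A p x t (g (x,t)) \<le> q (x,t) - lam * ?v"
  proof (rule hamiltonian_least, rule ccontr)
    fix a assume a: "a \<in> A" and "\<not> - (f x a p \<bullet> g (x,t)) - l x a p t \<le> q (x,t) - lam * ?v"
    define \<kappa> where "\<kappa> = - (l x a p t + f x a p \<bullet> g (x,t) + (q (x,t) - lam * ?v))"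
    have \<kappa>: "\<kappa> > 0" using \<open>\<not> _\<close> by (simp add: \<kappa>_def)
    then have "0 < \<kappa> / 2" by simp
    from first_order_expansion[OF t(1,2) der this]
    obtain h0 where h0: "h0 > 0" "t + h0 \<le> T" and ex: "\<And>h \<alpha> y. 0 < h \<Longrightarrow> h < h0 \<Longrightarrow> \<alpha> \<in> controls A \<Longrightarrow> trajectory f T p x t \<alpha> y \<Longrightarrow>
      \<bar>running_cost t \<alpha> y (t + h) + exp (- lam * h) * \<phi>' (y (t + h), t + h) - \<phi>' (x,t)
        - (integral {t..t+h} (\<lambda>s. l x (\<alpha> s) p t + f x (\<alpha> s) p \<bullet> g (x,t)) + h * (q (x,t) - lam * \<phi>' (x,t)))\<bar> \<le> \<kappa> / 2 * h"
      by blast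
    define h where "h = min (h0 / 2) (\<rho> / (2 * (K + 1)))"
    have K1: "0 < K + 1" using K_nonneg by simp
    have h: "0 < h" "h < h0" using h0 \<rho>(1) K1 by (auto simp: h_def)
    have "h \<le> \<rho> / (2 * (K + 1))" by (simp add: h_def)
    then have "(K + 1) * h \<le> \<rho> / 2" using K1 by (simp add: field_simps)
    then have hr: "(K + 1) * h < \<rho>" using \<rho>(1) by linarith
    note ca = const_control[OF a]
    have tT: "t \<le> T" using t by simp
    obtain y where y: "trajectory f T p x t (\<lambda>_. a) y" using trajectory_exists[OF ca t(1) tT] by blast
    have "val (y (t + h), t + h) \<le> \<phi>' (y (t + h), t + h)"
      using \<rho>(2)[of "(y (t + h), t + h)"] trajectory_near[OF y ca t(1), of h] h h0 hr t by (auto simp: \<phi>'_def)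
    then have "exp (- lam * h) * val (y (t + h), t + h) \<le> exp (- lam * h) * \<phi>' (y (t + h), t + h)"
      by (intro mult_left_mono) auto
    moreover have "?v \<le> running_cost t (\<lambda>_. a) y (t + h) + exp (- lam * h) * val (y (t + h), t + h)"
      using dynamic_programming_upper[OF ca y t(1), of "t + h"] h h0 by auto
    moreover have eq: "integral {t..t+h} (\<lambda>s. l x a p t + f x a p \<bullet> g (x,t)) + h * (q (x,t) - lam * \<phi>' (x,t)) = - \<kappa> * h"
      using h by (simp add: \<kappa>_def \<phi>'0 algebra_simps)
    moreover have "\<kappa> * h > 0" using \<kappa> h by simp
    ultimately show False using ex[OF h ca y] unfolding eq \<phi>'0 by linarith
  qed
  then show ?thesis using val_le_obstacle[OF t(3), of x] by simp
qed

lemma local_min_onD: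
  assumes "local_min_on S w z"
  obtains \<rho> where "\<rho> > 0" "\<And>z'. z' \<in> S \<Longrightarrow> dist z' z < \<rho> \<Longrightarrow> w z \<le> w z'"
  using assms unfolding local_min_on_def eventually_at by (metis order_refl)

text \<open>
  Suppose that the value lies below the obstacle by \<open>\<zeta>\<close> and that the differential inequality fails by \<open>\<theta>\<close>.
  By the expansion, following any control for a short time \<open>h\<close> and continuing optimally then costs at least
  \<open>\<theta> h / 2\<close> more than the value, which contradicts near-optimality up to \<open>\<theta> h / 4\<close> if the near-optimal stopping time is at least
  \<open>t + h\<close>. Stopping before \<open>t + h\<close> costs nearly \<open>\<psi> (x,t)\<close>, which is too much.
\<close>

lemma val_supersolution:
  assumes \<phi>: "C1_with T \<phi> g q" and min: "local_min_on (UNIV \<times> {0..<T}) (\<lambda>z. val z - \<phi> z) (x,t)"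
  shows "max (val (x,t) - \<psi> (x,t)) (- q (x,t) + lam * val (x,t) + hamiltonian f l A p x t (g (x,t))) \<ge> 0"
proof (rule ccontr)
  let ?v = "val (x,t)" and ?H = "hamiltonian f l A p x t (g (x,t))"
  assume "\<not> ?thesis"
  then have neg: "?v < \<psi> (x,t)" "- q (x,t) + lam * ?v + ?H < 0" by auto
  have t: "0 \<le> t" "t < T" "t \<in> {0..T}" using min by (auto simp: local_min_on_def)
  define \<theta> where "\<theta> = q (x,t) - lam * ?v - ?H"
  have \<theta>: "\<theta> > 0" "\<theta> / 2 > 0" using neg by (auto simp: \<theta>_def)
  define \<zeta> where "\<zeta> = \<psi> (x,t) - ?v"
  have \<zeta>: "\<zeta> > 0" "\<zeta> / 4 > 0" using neg by (auto simp: \<zeta>_def)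
  define \<phi>' where "\<phi>' = (\<lambda>z. \<phi> z + (?v - \<phi> (x,t)))"
  have \<phi>'0: "\<phi>' (x,t) = ?v" by (simp add: \<phi>'_def)
  have "(\<phi> has_derivative (\<lambda>(h,k). g (x,t) \<bullet> h + q (x,t) * k)) (at (x,t) within spacetime T)"
    using \<phi> t by (auto simp: C1_with_def spacetime_def)
  then have der: "(\<phi>' has_derivative (\<lambda>(h,k). g (x,t) \<bullet> h + q (x,t) * k)) (at (x,t) within spacetime T)"
    unfolding \<phi>'_def by (rule has_derivative_add_const)
  obtain \<rho> where \<rho>: "\<rho> > 0" "\<And>z'. z' \<in> UNIV \<times> {0..<T} \<Longrightarrow> dist z' (x,t) < \<rho> \<Longrightarrow> ?v - \<phi> (x,t) \<le> val z' - \<phi> z'"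
    using local_min_onD[OF min] by blast
  obtain h0 where h0: "h0 > 0" "t + h0 \<le> T" and ex: "\<And>h \<alpha> y. 0 < h \<Longrightarrow> h < h0 \<Longrightarrow> \<alpha> \<in> controls A \<Longrightarrow> trajectory f T p x t \<alpha> y \<Longrightarrow>
      \<bar>running_cost t \<alpha> y (t + h) + exp (- lam * h) * \<phi>' (y (t + h), t + h) - \<phi>' (x,t)
        - (integral {t..t+h} (\<lambda>s. l x (\<alpha> s) p t + f x (\<alpha> s) p \<bullet> g (x,t)) + h * (q (x,t) - lam * \<phi>' (x,t)))\<bar> \<le> \<theta> / 2 * h"
    using first_order_expansion[OF t(1,2) der \<theta>(2)] by blast
  obtain dp where dp: "dp > 0" "\<And>x x' t t'. t \<in> {0..T} \<Longrightarrow> t' \<in> {0..T} \<Longrightarrow> norm (x - x') < dp \<Longrightarrow> \<bar>t - t'\<bar> < dp \<Longrightarrow> \<bar>\<psi> (x,t) - \<psi> (x',t')\<bar> < \<zeta> / 4"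
    using \<psi>_uc \<zeta>(2) unfolding uniformly_continuous_on_spacetime_iff by meson
  define h where "h = Min {h0 / 2, \<rho> / (2 * (K + 1)), dp / (2 * (K + 1)), \<zeta> / (4 * (lam * P + 1)), \<zeta> / \<theta>}"
  have K1: "0 < K + 1" using K_nonneg by simp
  have LP: "0 < lam * P + 1" using lam_nonneg P_nonneg by (auto intro: add_nonneg_pos)
  have h: "0 < h" "h < h0" using h0 \<rho>(1) dp(1) \<zeta> \<theta> K1 LP by (auto simp: h_def)
  have "h \<le> \<rho> / (2 * (K + 1))" "h \<le> dp / (2 * (K + 1))" "h \<le> \<zeta> / (4 * (lam * P + 1))" "h \<le> \<zeta> / \<theta>" by (simp_all add: h_def)
  then have hs: "(K + 1) * h \<le> \<rho> / 2" "(K + 1) * h \<le> dp / 2" "(lam * P + 1) * h \<le> \<zeta> / 4" "\<theta> * h \<le> \<zeta>"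
    using K1 LP \<theta> by (simp_all add: field_simps)
  have hr: "(K + 1) * h < \<rho>" "(K + 1) * h < dp" using hs \<rho>(1) dp(1) by linarith+
  have "h \<le> (K + 1) * h" using K_nonneg h(1) by (simp add: algebra_simps)
  then have hd: "h < dp" using hr(2) by linarith
  have lamhP: "lam * h * P \<le> \<zeta> / 4" using hs(3) h(1) by (simp add: algebra_simps)
  have "0 < \<theta> * h / 4" using \<theta> h by simp
  then obtain \<alpha> y \<tau> where opt: "\<alpha> \<in> controls A" "trajectory f T p x t \<alpha> y" "\<tau> \<in> {t..T}" "cost t \<alpha> y \<tau> < ?v + \<theta> * h / 4"
    using near_optimal[OF t(3)] by blast
  have tT: "t \<le> T" using t by simp
  note cont = trajectoryD(1)[OF opt(2,1) t(1) tT]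
  show False
  proof (cases "t + h \<le> \<tau>")
    case True
    have "\<phi>' (y (t + h), t + h) \<le> val (y (t + h), t + h)"
      using \<rho>(2)[of "(y (t + h), t + h)"] trajectory_near[OF opt(2,1) t(1), of h] h h0 hr t by (auto simp: \<phi>'_def)
    then have "exp (- lam * h) * \<phi>' (y (t + h), t + h) \<le> exp (- lam * h) * val (y (t + h), t + h)"
      by (intro mult_left_mono) auto
    moreover have "running_cost t \<alpha> y (t + h) + exp (- lam * h) * val (y (t + h), t + h) \<le> cost t \<alpha> y \<tau>"
      using dynamic_programming_lower[OF opt(1,2) t(1) _ True] opt(3) h by simp
    moreover have "(\<theta> - (q (x,t) - lam * ?v)) * h \<le> integral {t..t+h} (\<lambda>s. l x (\<alpha> s) p t + f x (\<alpha> s) p \<bullet> g (x,t))"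
    proof -
      have inA: "\<alpha> s \<in> A" if "s \<in> {t..t+h}" for s using that t controls_in[OF opt(1)] by auto
      have "(\<lambda>s. l x (\<alpha> s) p t + f x (\<alpha> s) p \<bullet> g (x,t)) integrable_on {t..t+h}"
        using h h0 t by (intro frozen_integrable[OF opt(1)]) auto
      moreover have "\<theta> - (q (x,t) - lam * ?v) \<le> l x (\<alpha> s) p t + f x (\<alpha> s) p \<bullet> g (x,t)" if "s \<in> {t..t+h}" for s
        using hamiltonian_upper[OF inA[OF that] t(3), of x "g (x,t)"] by (simp add: \<theta>_def)
      ultimately have "integral {t..t+h} (\<lambda>_. \<theta> - (q (x,t) - lam * ?v)) \<le> integral {t..t+h} (\<lambda>s. l x (\<alpha> s) p t + f x (\<alpha> s) p \<bullet> g (x,t))"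
        by (intro integral_le integrable_const_ivl) auto
      then show ?thesis using h by (simp add: mult.commute)
    qed
    moreover have "(\<theta> - (q (x,t) - lam * ?v)) * h = \<theta> * h - h * (q (x,t) - lam * ?v)" by (simp add: algebra_simps)
    moreover have "\<theta> * h > 0" using \<theta> h by simp
    ultimately show False using ex[OF h opt(1,2)] opt(4) unfolding \<phi>'0 by linarith
  next
    case False
    then have \<tau>: "t \<le> \<tau>" "\<tau> \<le> T" "\<tau> \<le> t + h" "0 \<le> \<tau>" using opt(3) t by auto
    have "norm (y \<tau> - y t) \<le> K * (\<tau> - t)"
      by (rule trajectory_speed(2)[OF opt(2,1) t(1)]) (use \<tau> in auto)
    also have "\<dots> \<le> (K + 1) * h" using \<tau> K_nonneg h by (intro mult_mono) auto
    finally have "norm (y \<tau> - x) < dp" using hr(2) opt(2) by (simp add: trajectory_def)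
    then have "\<bar>\<psi> (y \<tau>, \<tau>) - \<psi> (x,t)\<bar> < \<zeta> / 4"
      by (intro dp(2)) (use \<tau> t hd in auto)
    moreover have "\<psi> (y \<tau>, \<tau>) - lam * (\<tau> - t) * P \<le> exp (- lam * (\<tau> - t)) * \<psi> (y \<tau>, \<tau>)"
      by (rule discount_bounds(1)) (use \<tau> \<psi>_bounds in auto)
    moreover have "lam * (\<tau> - t) * P \<le> lam * h * P"
      using lam_nonneg P_nonneg \<tau> by (intro mult_right_mono mult_left_mono) auto
    moreover have "exp (- lam * (\<tau> - t)) * \<psi> (y \<tau>, \<tau>) \<le> cost t \<alpha> y \<tau>"
      using running_cost_bounds(1)[OF opt(1) continuous_on_subset[OF cont] t(1) \<tau>(1,2)] \<tau> by (simp add: cost_def)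
    moreover have "\<theta> * h / 4 \<le> \<zeta> / 4" using hs(4) by simp
    moreover have "\<psi> (x,t) = ?v + \<zeta>" by (simp add: \<zeta>_def)
    ultimately show False using opt(4) lamhP \<zeta>(1) by linarith
  qed
qed

lemma val_viscosity_solution: "viscosity_solution T lam \<psi> (hamiltonian f l A p) val"
  unfolding viscosity_solution_def
  using val_subsolution val_supersolution val_terminal val_BUC
  by (auto simp: BUC_def uniformly_continuous_imp_continuous)

end

section \<open>Comparison by doubling the variables\<close>

text \<open>
  Covers both test functions of the doubling argument: for the subsolution \<open>c > 0\<close>, with the penalty at
  infinity \<open>\<beta>\<close> and the strictness term \<open>\<eta>\<close>; for the supersolution \<open>c < 0\<close> and \<open>\<beta> = \<eta> = 0\<close>.
\<close>

lemma C1_with_penalty: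
  fixes y :: "real^'d"
  shows "C1_with T (\<lambda>z. c * ((fst z - y) \<bullet> (fst z - y) + (snd z - s)\<^sup>2) + \<beta> * sqrt (1 + fst z \<bullet> fst z) + \<eta> * (T - snd z))
     (\<lambda>z. (2 * c) *\<^sub>R (fst z - y) + (\<beta> / sqrt (1 + fst z \<bullet> fst z)) *\<^sub>R fst z)
     (\<lambda>z. 2 * c * (snd z - s) - \<eta>)"
proof -
  have pos: "0 < 1 + x \<bullet> x" for x :: "real^'d" using inner_ge_zero[of x] by linarith
  have ne: "1 + x \<bullet> x \<noteq> 0" for x :: "real^'d" using pos[of x] by simp
  show ?thesis
    unfolding C1_with_def
  proof (intro conjI ballI)
    fix z :: "(real^'d) \<times> real"
    have s: "((\<lambda>z. sqrt (1 + fst z \<bullet> fst z)) has_derivative (\<lambda>w. (fst z \<bullet> fst w) / sqrt (1 + fst z \<bullet> fst z))) (at z within spacetime T)"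
      using pos[of "fst z"] by (auto intro!: derivative_eq_intros simp: inner_commute field_simps)
    show "((\<lambda>z. c * ((fst z - y) \<bullet> (fst z - y) + (snd z - s)\<^sup>2) + \<beta> * sqrt (1 + fst z \<bullet> fst z) + \<eta> * (T - snd z))
       has_derivative (\<lambda>(h, k). ((2 * c) *\<^sub>R (fst z - y) + (\<beta> / sqrt (1 + fst z \<bullet> fst z)) *\<^sub>R fst z) \<bullet> h + (2 * c * (snd z - s) - \<eta>) * k))
       (at z within spacetime T)"
      by (rule derivative_eq_intros s refl)+ (auto simp: fun_eq_iff inner_simps inner_commute algebra_simps)
  qed (auto intro!: continuous_intros simp: ne)
qed

context switching_mode
begin

text \<open>
  Maximise \<open>u (x,t) - v (y,s) - (norm (x - y)^2 + (t - s)^2) / (2 \<epsilon>) - \<beta> sqrt (1 + norm x^2) - \<eta> (T - t)\<close>. The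
  \<open>\<beta>\<close>-term confines the maximum to a compact set, and the \<open>\<eta>\<close>-term makes \<open>u\<close> a strict subsolution, which is
  what produces the contradiction even if \<open>lam = 0\<close>. The order of choices is essential: \<open>\<eta>\<close> and \<open>\<beta>\<close>, and
  with them the compact set, come first; only then is \<open>\<epsilon>\<close> chosen, small with respect to the
  modulus of continuity of the running cost on that compact set.
\<close>

lemma comparison:
  fixes \<psi> :: "(real^'d) \<times> real \<Rightarrow> real"
  assumes \<psi>_uc: "uniformly_continuous_on (spacetime T) \<psi>"
    and u: "BUC T u" "viscosity_solution T lam \<psi> (hamiltonian f l A p) u"
    and v: "BUC T v" "viscosity_solution T lam \<psi> (hamiltonian f l A p) v"
    and t0: "t0 \<in> {0..T}"
  shows "u (x0,t0) \<le> v (x0,t0)"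
proof (rule ccontr)
  define \<sigma> where "\<sigma> = u (x0,t0) - v (x0,t0)"
  assume "\<not> u (x0,t0) \<le> v (x0,t0)"
  then have \<sigma>: "\<sigma> > 0" by (simp add: \<sigma>_def)
  obtain Bu Bv where B0: "\<And>z. z \<in> spacetime T \<Longrightarrow> \<bar>u z\<bar> \<le> Bu" "\<And>z. z \<in> spacetime T \<Longrightarrow> \<bar>v z\<bar> \<le> Bv"
    using u(1) v(1) unfolding BUC_def bounded_iff by auto
  define B where "B = max Bu Bv"
  have B: "\<bar>u (x,t)\<bar> \<le> B" "\<bar>v (x,t)\<bar> \<le> B" if "t \<in> {0..T}" for x t
    using B0[of "(x,t)"] that by (auto simp: B_def spacetime_def max_def)
  have B_nonneg: "0 \<le> B" using B(1)[OF t0, of x0] by simp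
  define sq where "sq = (\<lambda>x::real^'d. sqrt (1 + x \<bullet> x))"
  have sq: "0 < sq x" "norm x \<le> sq x" for x
    by (auto simp: sq_def norm_eq_sqrt_inner add_pos_nonneg)
  \<comment> \<open>The \<open>\<eta>\<close>-term and the \<open>\<beta>\<close>-term each cost at most \<open>\<sigma> / 4\<close> at \<open>(x0,t0)\<close>.\<close>
  define \<eta> where "\<eta> = \<sigma> / (4 * T)"
  have \<eta>: "\<eta> > 0" using \<sigma> T_pos by (simp add: \<eta>_def)
  define \<beta> where "\<beta> = min (\<sigma> / (4 * sq x0)) (\<eta> / (4 * (K + 1)))"
  have K1: "0 < K + 1" using K_nonneg by simp
  have \<beta>: "\<beta> > 0" using \<sigma> \<eta> sq[of x0] K1 by (simp add: \<beta>_def)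
  have "\<beta> \<le> \<sigma> / (4 * sq x0)" "\<beta> \<le> \<eta> / (4 * (K + 1))" by (simp_all add: \<beta>_def)
  then have \<beta>x0: "\<beta> * sq x0 \<le> \<sigma> / 4" and "(K + 1) * \<beta> \<le> \<eta> / 4"
    using sq[of x0] K1 by (simp_all add: field_simps)
  then have \<beta>K: "K * \<beta> \<le> \<eta> / 4" using \<beta> by (simp add: algebra_simps)
  \<comment> \<open>Maximum points lie strictly inside this radius, so they are interior in space.\<close>
  define R where "R = 2 * B / \<beta> + (4 * B + 1) + norm x0"
  \<comment> \<open>Bound for \<open>norm (x - y)^2 / (2 \<epsilon>)\<close> at the maximum point.\<close>
  define \<omega> where "\<omega> = min (\<sigma> / 4) (\<eta> / (8 * L))"
  have \<omega>: "\<omega> > 0" "\<omega> \<le> \<sigma> / 4" "8 * L * \<omega> \<le> \<eta>"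
    using \<sigma> \<eta> L_pos by (auto simp: \<omega>_def min_def field_simps)
  obtain d1 where d1: "d1 > 0" "\<And>x x' t t'. t \<in> {0..T} \<Longrightarrow> t' \<in> {0..T} \<Longrightarrow> norm (x - x') < d1 \<Longrightarrow> \<bar>t - t'\<bar> < d1 \<Longrightarrow> \<bar>v (x,t) - v (x',t')\<bar> < \<omega>"
    using v(1) \<omega>(1) unfolding BUC_def uniformly_continuous_on_spacetime_iff by meson
  have "0 < \<sigma> / 4" using \<sigma> by simp
  then obtain d2 where d2: "d2 > 0" "\<And>x x' t t'. t \<in> {0..T} \<Longrightarrow> t' \<in> {0..T} \<Longrightarrow> norm (x - x') < d2 \<Longrightarrow> \<bar>t - t'\<bar> < d2 \<Longrightarrow> \<bar>\<psi> (x,t) - \<psi> (x',t')\<bar> < \<sigma> / 4"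
    using \<psi>_uc unfolding uniformly_continuous_on_spacetime_iff by meson
  have "0 < \<eta> / 4" using \<eta> by simp
  from equicontinuous_in_control[OF l_cont A_compact compact_cball[of 0 R] this]
  obtain d3 where d3: "d3 > 0" "\<And>z z' a s s'. z \<in> cball 0 R \<Longrightarrow> z' \<in> cball 0 R \<Longrightarrow> a \<in> A \<Longrightarrow> s \<in> {0..T} \<Longrightarrow> s' \<in> {0..T} \<Longrightarrow>
      norm (z - z') < d3 \<Longrightarrow> \<bar>s - s'\<bar> < d3 \<Longrightarrow> \<bar>l z a p s - l z' a p s'\<bar> < \<eta> / 4"
    by auto
  define \<delta> where "\<delta> = Min {d1, d2, d3}"
  have \<delta>: "\<delta> > 0" "\<delta> \<le> d1" "\<delta> \<le> d2" "\<delta> \<le> d3" using d1(1) d2(1) d3(1) by (auto simp: \<delta>_def)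
  \<comment> \<open>The maximum satisfies \<open>norm (x - y)^2 + (t - s)^2 \<le> 4 B \<epsilon>\<close>, so this forces the two points to be \<open>\<delta>\<close>-close.\<close>
  define \<epsilon> where "\<epsilon> = min 1 (\<delta>\<^sup>2 / (4 * B + 1))"
  have \<epsilon>: "\<epsilon> > 0" "\<epsilon> \<le> 1" using \<delta> B_nonneg by (auto simp: \<epsilon>_def)
  have "\<epsilon> \<le> \<delta>\<^sup>2 / (4 * B + 1)" by (simp add: \<epsilon>_def)
  then have "(4 * B + 1) * \<epsilon> \<le> \<delta>\<^sup>2" using B_nonneg by (simp add: field_simps)
  then have \<epsilon>\<delta>: "4 * B * \<epsilon> < \<delta>\<^sup>2" using \<epsilon> by (simp add: algebra_simps)
  define c where "c = 1 / (2 * \<epsilon>)"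
  have c: "c > 0" "2 * \<epsilon> * c = 1" using \<epsilon> by (auto simp: c_def)
  define \<Phi> where "\<Phi> = (\<lambda>(x::real^'d, t::real, y::real^'d, s::real).
      u (x,t) - v (y,s) - (c * ((x - y) \<bullet> (x - y) + (t - s)\<^sup>2) + \<beta> * sq x + \<eta> * (T - t)))"
  define D where "D = cball (0::real^'d) R \<times> {0..T} \<times> cball (0::real^'d) R \<times> {0..T}"
  have Dc: "compact D" unfolding D_def by (intro compact_Times compact_cball) auto
  have x0D: "(x0, t0, x0, t0) \<in> D"
    using t0 B_nonneg \<beta> by (auto simp: D_def R_def intro!: add_nonneg_nonneg divide_nonneg_pos)
  have \<Phi>_cont: "continuous_on D \<Phi>"
  proof -
    have uc: "continuous_on (spacetime T) u" "continuous_on (spacetime T) v"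
      using u(1) v(1) by (auto simp: BUC_def uniformly_continuous_imp_continuous)
    have "continuous_on D (\<lambda>z. u (fst z, fst (snd z)))"
      by (rule continuous_on_compose2[OF uc(1)]) (auto intro!: continuous_intros simp: D_def spacetime_def)
    moreover have "continuous_on D (\<lambda>z. v (fst (snd (snd z)), snd (snd (snd z))))"
      by (rule continuous_on_compose2[OF uc(2)]) (auto intro!: continuous_intros simp: D_def spacetime_def)
    ultimately show ?thesis
      unfolding \<Phi>_def split_def sq_def by (intro continuous_intros)
  qed
  have "D \<noteq> {}" using x0D by blast
  from continuous_attains_sup[OF Dc this \<Phi>_cont]
  obtain m where m: "m \<in> D" "\<And>w. w \<in> D \<Longrightarrow> \<Phi> w \<le> \<Phi> m" by blast
  obtain x t y s where m_eq: "m = (x,t,y,s)" using prod_cases4 by blast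
  have ts: "t \<in> {0..T}" "s \<in> {0..T}" and xyR: "x \<in> cball 0 R" "y \<in> cball 0 R" using m(1) by (auto simp: m_eq D_def)
  define Q where "Q = (x - y) \<bullet> (x - y) + (t - s)\<^sup>2"
  have Qn: "0 \<le> Q" "(norm (x - y))\<^sup>2 \<le> Q" "(t - s)\<^sup>2 \<le> Q" by (simp_all add: Q_def power2_norm_eq_inner)
  have \<Phi>m: "\<Phi> m = u (x,t) - v (y,s) - (c * Q + \<beta> * sq x + \<eta> * (T - t))" by (simp add: \<Phi>_def m_eq Q_def)
  have "\<sigma> / 2 \<le> \<Phi> (x0, t0, x0, t0)"
  proof -
    have "\<eta> * (T - t0) \<le> \<eta> * T" using \<eta> t0 by (intro mult_left_mono) auto
    also have "\<eta> * T = \<sigma> / 4" using T_pos by (simp add: \<eta>_def)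
    finally show ?thesis using \<beta>x0 by (simp add: \<Phi>_def \<sigma>_def)
  qed
  then have \<Phi>_ge: "\<sigma> / 2 \<le> \<Phi> m" using m(2)[OF x0D] by linarith
  have terms: "0 \<le> c * Q" "0 \<le> \<beta> * sq x" "0 \<le> \<eta> * (T - t)"
    using c Qn \<beta> sq(1)[of x] \<eta> ts by (auto simp: less_imp_le)
  have gap: "\<sigma> / 2 \<le> u (x,t) - v (y,s)" using \<Phi>_ge \<Phi>m terms by linarith
  \<comment> \<open>Comparison with the diagonal point \<open>(x,t,x,t)\<close>: the penalisation is controlled by the modulus of continuity of \<open>v\<close>.\<close>
  have cQ_le: "c * Q \<le> v (x,t) - v (y,s)"
  proof -
    have "(x,t,x,t) \<in> D" using m(1) by (simp add: m_eq D_def)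
    then have "\<Phi> (x,t,x,t) \<le> \<Phi> m" by (rule m(2))
    then show ?thesis unfolding \<Phi>m by (simp add: \<Phi>_def)
  qed
  also have "\<dots> \<le> 2 * B" using B(2)[OF ts(1), of x] B(2)[OF ts(2), of y] by linarith
  finally have "c * Q \<le> 2 * B" .
  then have "2 * \<epsilon> * (c * Q) \<le> 2 * \<epsilon> * (2 * B)" using \<epsilon> by (intro mult_left_mono) auto
  moreover have "2 * \<epsilon> * (c * Q) = Q" using c(2) by (simp only: mult.assoc[symmetric] mult_1_left)
  moreover have "2 * \<epsilon> * (2 * B) = 4 * B * \<epsilon>" by simp
  ultimately have Q_le: "Q \<le> 4 * B * \<epsilon>" by simp
  have xy: "norm (x - y) < \<delta>" and ts_near: "\<bar>t - s\<bar> < \<delta>"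
  proof -
    have "(norm (x - y))\<^sup>2 < \<delta>\<^sup>2" "\<bar>t - s\<bar>\<^sup>2 < \<delta>\<^sup>2" using Qn Q_le \<epsilon>\<delta> by simp_all
    then show "norm (x - y) < \<delta>" "\<bar>t - s\<bar> < \<delta>" using \<delta>(1) by (auto intro: power2_less_imp_less)
  qed
  have x_lt: "norm x \<le> 2 * B / \<beta>"
  proof -
    have "\<beta> * norm x \<le> \<beta> * sq x" using \<beta> sq by (intro mult_left_mono) auto
    also have "\<dots> \<le> 2 * B" using \<Phi>_ge \<Phi>m terms \<sigma> B(1)[OF ts(1), of x] B(2)[OF ts(2), of y] by linarith
    finally show ?thesis using \<beta> by (simp add: field_simps)
  qed
  have xy_le: "norm (x - y) < 4 * B + 1"
  proof -
    have "(norm (x - y))\<^sup>2 \<le> 4 * B * \<epsilon>" using Qn Q_le by simp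
    also have "\<dots> \<le> 4 * B * 1" using \<epsilon> B_nonneg by (intro mult_left_mono) auto
    also have "\<dots> < (4 * B + 1)\<^sup>2" using B_nonneg by (simp add: power2_eq_square algebra_simps add_pos_nonneg)
    finally show ?thesis using B_nonneg by (auto intro: power2_less_imp_less)
  qed
  have xR: "norm x < R" using x_lt B_nonneg norm_ge_zero[of x0] unfolding R_def by linarith
  have yR: "norm y < R"
    using x_lt xy_le norm_triangle_ineq2[of y x] norm_ge_zero[of x0]
    unfolding R_def norm_minus_commute[of y x] by linarith
  have v_near: "\<bar>v (x,t) - v (y,s)\<bar> < \<omega>" using xy ts_near \<delta> by (intro d1(2) ts) auto
  have \<psi>_near: "\<bar>\<psi> (x,t) - \<psi> (y,s)\<bar> < \<sigma> / 4" using xy ts_near \<delta> by (intro d2(2) ts) auto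
  have t_lt: "t < T"
  proof (rule ccontr)
    assume "\<not> t < T"
    then have "t = T" using ts by simp
    then have "u (x,t) = v (x,t)" using u(2) v(2) by (simp add: viscosity_solution_def)
    then show False using gap v_near \<omega>(2) \<sigma> by linarith
  qed
  define \<phi>u where "\<phi>u = (\<lambda>z. c * ((fst z - y) \<bullet> (fst z - y) + (snd z - s)\<^sup>2) + \<beta> * sqrt (1 + fst z \<bullet> fst z) + \<eta> * (T - snd z))"
  have "local_max_on (UNIV \<times> {0..<T}) (\<lambda>z. u z - \<phi>u z) (x,t)"
    unfolding local_max_on_def eventually_at
  proof (intro conjI exI[of _ "R - norm x"] ballI impI)
    show "(x,t) \<in> UNIV \<times> {0..<T}" using ts t_lt by simp
    show "0 < R - norm x" using xR by simp
    fix z assume z: "z \<in> UNIV \<times> {0..<T}" "z \<noteq> (x,t) \<and> dist z (x,t) < R - norm x"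
    obtain x' t' where z_eq: "z = (x',t')" by fastforce
    have "norm (x' - x) < R - norm x" using z(2) dist_fst_le[of z "(x,t)"] by (simp add: z_eq dist_norm)
    then have "norm x' \<le> R" using norm_triangle_ineq2[of x' x] by linarith
    then have "(x',t',y,s) \<in> D" using z(1) m(1) by (auto simp: D_def m_eq z_eq)
    from m(2)[OF this] show "u z - \<phi>u z \<le> u (x,t) - \<phi>u (x,t)"
      unfolding \<Phi>m by (simp add: \<Phi>_def z_eq \<phi>u_def sq_def Q_def)
  qed
  then have "max (u (x,t) - \<psi> (x,t)) (- (2 * c * (snd (x,t) - s) - \<eta>) + lam * u (x,t)
      + hamiltonian f l A p x t ((2 * c) *\<^sub>R (fst (x,t) - y) + (\<beta> / sqrt (1 + fst (x,t) \<bullet> fst (x,t))) *\<^sub>R fst (x,t))) \<le> 0"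
    using u(2) C1_with_penalty[of T c y s \<beta> \<eta>] unfolding viscosity_solution_def \<phi>u_def by blast
  then have sub: "u (x,t) \<le> \<psi> (x,t)"
      "- (2 * c * (t - s)) + \<eta> + lam * u (x,t) + hamiltonian f l A p x t ((2 * c) *\<^sub>R (x - y) + (\<beta> / sq x) *\<^sub>R x) \<le> 0"
    by (simp_all add: sq_def)
  \<comment> \<open>Otherwise \<open>u (x,t) - v (y,s) \<le> \<psi> (x,t) - \<psi> (y,s)\<close> would be less than \<open>\<sigma> / 4\<close>.\<close>
  have v_lt: "v (y,s) < \<psi> (y,s)" using sub(1) gap \<psi>_near \<sigma> by linarith
  have s_lt: "s < T"
  proof (rule ccontr)
    assume "\<not> s < T"
    then have "s = T" using ts by simp
    then have "v (y,s) = \<psi> (y,s)" using v(2) by (simp add: viscosity_solution_def)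
    then show False using v_lt by simp
  qed
  define \<phi>v where "\<phi>v = (\<lambda>z. (- c) * ((fst z - x) \<bullet> (fst z - x) + (snd z - t)\<^sup>2) + 0 * sqrt (1 + fst z \<bullet> fst z) + 0 * (T - snd z))"
  have "local_min_on (UNIV \<times> {0..<T}) (\<lambda>z. v z - \<phi>v z) (y,s)"
    unfolding local_min_on_def eventually_at
  proof (intro conjI exI[of _ "R - norm y"] ballI impI)
    show "(y,s) \<in> UNIV \<times> {0..<T}" using ts s_lt by simp
    show "0 < R - norm y" using yR by simp
    fix z assume z: "z \<in> UNIV \<times> {0..<T}" "z \<noteq> (y,s) \<and> dist z (y,s) < R - norm y"
    obtain y' s' where z_eq: "z = (y',s')" by fastforce
    have "norm (y' - y) < R - norm y" using z(2) dist_fst_le[of z "(y,s)"] by (simp add: z_eq dist_norm)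
    then have "norm y' \<le> R" using norm_triangle_ineq2[of y' y] by linarith
    then have "(x,t,y',s') \<in> D" using z(1) m(1) by (auto simp: D_def m_eq z_eq)
    from m(2)[OF this] have "c * Q - c * ((x - y') \<bullet> (x - y') + (t - s')\<^sup>2) \<le> v (y',s') - v (y,s)"
      unfolding \<Phi>m by (simp add: \<Phi>_def)
    moreover have "(x - y') \<bullet> (x - y') = (y' - x) \<bullet> (y' - x)" "(x - y) \<bullet> (x - y) = (y - x) \<bullet> (y - x)"
      by (simp_all add: inner_diff_left inner_diff_right inner_commute)
    moreover have "(t - s')\<^sup>2 = (s' - t)\<^sup>2" "(t - s)\<^sup>2 = (s - t)\<^sup>2" by (simp_all add: power2_commute)
    ultimately show "v (y,s) - \<phi>v (y,s) \<le> v z - \<phi>v z"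
      by (simp add: z_eq \<phi>v_def Q_def)
  qed
  then have "max (v (y,s) - \<psi> (y,s)) (- (2 * (- c) * (snd (y,s) - t) - 0) + lam * v (y,s)
      + hamiltonian f l A p y s ((2 * (- c)) *\<^sub>R (fst (y,s) - x) + (0 / sqrt (1 + fst (y,s) \<bullet> fst (y,s))) *\<^sub>R fst (y,s))) \<ge> 0"
    using v(2) C1_with_penalty[of T "- c" x t 0 0] unfolding viscosity_solution_def \<phi>v_def by blast
  moreover have "(2 * (- c)) *\<^sub>R (y - x) = (2 * c) *\<^sub>R (x - y)" by (simp add: algebra_simps)
  ultimately have super: "0 \<le> - (2 * c * (t - s)) + lam * v (y,s) + hamiltonian f l A p y s ((2 * c) *\<^sub>R (x - y))"
    using v_lt by (simp add: le_max_iff_disj algebra_simps)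
  have "hamiltonian f l A p y s ((2 * c) *\<^sub>R (x - y))
      \<le> hamiltonian f l A p x t ((2 * c) *\<^sub>R (x - y) + (\<beta> / sq x) *\<^sub>R x)
        + L * norm (x - y) * norm ((2 * c) *\<^sub>R (x - y)) + K * norm ((\<beta> / sq x) *\<^sub>R x) + \<eta> / 4"
  proof (rule hamiltonian_perturb[OF ts(1)])
    fix a assume "a \<in> A"
    then have "\<bar>l x a p t - l y a p s\<bar> < \<eta> / 4" using xyR xy ts_near \<delta> by (intro d3(2) ts) auto
    then show "\<bar>l x a p t - l y a p s\<bar> \<le> \<eta> / 4" by simp
  qed
  moreover have "L * norm (x - y) * norm ((2 * c) *\<^sub>R (x - y)) \<le> \<eta> / 4"
  proof -
    have "L * norm (x - y) * norm ((2 * c) *\<^sub>R (x - y)) = 2 * L * (c * (norm (x - y))\<^sup>2)"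
      using c by (simp add: power2_eq_square)
    also have "\<dots> \<le> 2 * L * (c * Q)" using L_pos c Qn by (intro mult_left_mono) auto
    also have "\<dots> \<le> 2 * L * \<omega>" using L_pos cQ_le v_near by (intro mult_left_mono) auto
    finally show ?thesis using \<omega>(3) by simp
  qed
  moreover have "K * norm ((\<beta> / sq x) *\<^sub>R x) \<le> \<eta> / 4"
  proof -
    have "norm ((\<beta> / sq x) *\<^sub>R x) = \<beta> * (norm x / sq x)" using \<beta> sq(1)[of x] by simp
    also have "\<dots> \<le> \<beta> * 1" using \<beta> sq[of x] by (intro mult_left_mono) auto
    finally have "K * norm ((\<beta> / sq x) *\<^sub>R x) \<le> K * \<beta>" using K_nonneg by (intro mult_left_mono) auto
    then show ?thesis using \<beta>K by linarith
  qed
  moreover have "lam * v (y,s) \<le> lam * u (x,t)"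
    using gap \<sigma> lam_nonneg by (intro mult_left_mono) auto
  ultimately show False using sub(2) super \<eta> by linarith
qed

end

section \<open>The obstacle and the induction over modes\<close>

lemma succs_nonempty:
  fixes p :: "'n::finite \<Rightarrow> bool"
  assumes "p \<noteq> pbar"
  shows "succs p \<noteq> {}"
proof -
  have "pbar \<in> succs p" using assms by (auto simp: succs_def pbar_def fun_eq_iff)
  then show ?thesis by blast
qed

lemma obstacle_attained:
  fixes p :: "'n::finite \<Rightarrow> bool"
  assumes "p \<noteq> pbar"
  obtains q where "q \<in> succs p" "obstacle C U p (x,t) = C x p q + U q (x,t)"
proof -
  let ?S = "(\<lambda>q. C x p q + U q (x,t)) ` succs p"
  have S: "finite ?S" "?S \<noteq> {}" using succs_nonempty[OF assms] by simp_all
  have "Inf ?S \<in> ?S" unfolding cInf_eq_Min[OF S] by (rule Min_in[OF S])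
  then show thesis using that by (auto simp: obstacle_def)
qed

lemma obstacle_le:
  fixes p :: "'n::finite \<Rightarrow> bool"
  assumes "q \<in> succs p"
  shows "obstacle C U p (x,t) \<le> C x p q + U q (x,t)"
  unfolding obstacle_def prod.case by (intro cINF_lower bdd_below_finite finite_imageI assms) simp

lemma obstacle_uniformly_continuous:
  fixes C :: "real^'d \<Rightarrow> ('n::finite \<Rightarrow> bool) \<Rightarrow> ('n \<Rightarrow> bool) \<Rightarrow> real"
  assumes p: "p \<noteq> pbar"
    and C_uc: "\<And>e. 0 < e \<Longrightarrow> \<exists>\<delta>>0. \<forall>x y. \<forall>q\<in>succs p. norm (x - y) < \<delta> \<longrightarrow> \<bar>C x p q - C y p q\<bar> < e"
    and U: "\<And>q. q \<in> succs p \<Longrightarrow> uniformly_continuous_on (spacetime T) (U q)"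
  shows "uniformly_continuous_on (spacetime T) (obstacle C U p)"
  unfolding uniformly_continuous_on_spacetime_iff
proof (intro allI impI)
  fix e :: real assume e: "0 < e"
  then have e2: "0 < e / 2" by simp
  obtain d where d: "d > 0" "\<And>x y q. q \<in> succs p \<Longrightarrow> norm (x - y) < d \<Longrightarrow> \<bar>C x p q - C y p q\<bar> < e / 2"
    using C_uc[OF e2] by blast
  have "\<forall>q\<in>succs p. \<exists>\<delta>>0. \<forall>x x' t t'. t \<in> {0..T} \<and> t' \<in> {0..T} \<and> norm (x - x') < \<delta> \<and> \<bar>t - t'\<bar> < \<delta> \<longrightarrow> \<bar>U q (x,t) - U q (x',t')\<bar> < e / 2"
    using U e2 unfolding uniformly_continuous_on_spacetime_iff by blast
  from bchoice[OF this] obtain D where D: "\<And>q. q \<in> succs p \<Longrightarrow> D q > 0"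
    "\<And>q x x' t t'. q \<in> succs p \<Longrightarrow> t \<in> {0..T} \<Longrightarrow> t' \<in> {0..T} \<Longrightarrow> norm (x - x') < D q \<Longrightarrow> \<bar>t - t'\<bar> < D q \<Longrightarrow> \<bar>U q (x,t) - U q (x',t')\<bar> < e / 2"
    by blast
  define \<delta> where "\<delta> = Min (insert d (D ` succs p))"
  have \<delta>: "\<delta> > 0" "\<delta> \<le> d" "\<And>q. q \<in> succs p \<Longrightarrow> \<delta> \<le> D q"
    using d(1) D(1) by (auto simp: \<delta>_def)
  have one: "obstacle C U p (x,t) < obstacle C U p (x',t') + e"
    if *: "t \<in> {0..T}" "t' \<in> {0..T}" "norm (x - x') < \<delta>" "\<bar>t - t'\<bar> < \<delta>" for x x' t t'
  proof -
    obtain q where q: "q \<in> succs p" "obstacle C U p (x',t') = C x' p q + U q (x',t')"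
      using obstacle_attained[OF p] by blast
    have "\<bar>U q (x,t) - U q (x',t')\<bar> < e / 2"
      by (rule D(2)[OF q(1) *(1,2)]) (use \<delta>(3)[OF q(1)] *(3,4) in linarith)+
    moreover have "\<bar>C x p q - C x' p q\<bar> < e / 2"
      by (rule d(2)[OF q(1)]) (use \<delta>(2) *(3) in linarith)
    ultimately show ?thesis using obstacle_le[OF q(1), of C U x t] q(2) by linarith
  qed
  show "\<exists>\<delta>>0. \<forall>x x' t t'. t \<in> {0..T} \<and> t' \<in> {0..T} \<and> norm (x - x') < \<delta> \<and> \<bar>t - t'\<bar> < \<delta> \<longrightarrow>
      \<bar>obstacle C U p (x,t) - obstacle C U p (x',t')\<bar> < e"
  proof (intro exI[of _ \<delta>] conjI allI impI)
    fix x x' :: "real^'d" and t t' assume *: "t \<in> {0..T} \<and> t' \<in> {0..T} \<and> norm (x - x') < \<delta> \<and> \<bar>t - t'\<bar> < \<delta>"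
    have "obstacle C U p (x,t) < obstacle C U p (x',t') + e" using * by (intro one) auto
    moreover have "obstacle C U p (x',t') < obstacle C U p (x,t) + e"
      using * by (intro one) (auto simp: norm_minus_commute abs_minus_commute)
    ultimately show "\<bar>obstacle C U p (x,t) - obstacle C U p (x',t')\<bar> < e" by (simp add: abs_less_iff)
  qed (rule \<delta>(1))
qed

lemma BUC_cong:
  assumes "\<And>z. z \<in> spacetime T \<Longrightarrow> u z = u' z" "BUC T u"
  shows "BUC T u'"
proof -
  have "u ` spacetime T = u' ` spacetime T" using assms(1) by (auto simp: image_iff)
  moreover have "uniformly_continuous_on (spacetime T) u'"
    using assms by (auto simp: BUC_def uniformly_continuous_on_def)
  ultimately show ?thesis using assms(2) by (simp add: BUC_def)
qed

lemma local_max_on_cong: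
  assumes "\<And>z. z \<in> S \<Longrightarrow> w z = w' z" "local_max_on S w' z"
  shows "local_max_on S w z"
proof -
  have z: "z \<in> S" "\<forall>\<^sub>F z' in at z within S. w' z' \<le> w' z" using assms(2) by (auto simp: local_max_on_def)
  from z(2) have "\<forall>\<^sub>F z' in at z within S. w z' \<le> w z"
    unfolding eventually_at_filter by (rule eventually_mono) (use assms(1) z(1) in auto)
  with z(1) show ?thesis by (simp add: local_max_on_def)
qed

lemma local_min_on_cong:
  assumes "\<And>z. z \<in> S \<Longrightarrow> w z = w' z" "local_min_on S w' z"
  shows "local_min_on S w z"
proof -
  have z: "z \<in> S" "\<forall>\<^sub>F z' in at z within S. w' z \<le> w' z'" using assms(2) by (auto simp: local_min_on_def)
  from z(2) have "\<forall>\<^sub>F z' in at z within S. w z \<le> w z'"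
    unfolding eventually_at_filter by (rule eventually_mono) (use assms(1) z(1) in auto)
  with z(1) show ?thesis by (simp add: local_min_on_def)
qed

text \<open>
  Solutions depend only on the values on \<open>spacetime T\<close>. The induction needs this because two solutions of
  the system, and their obstacles, agree only there.
\<close>

lemma viscosity_solution_cong:
  fixes u u' :: "(real^'d) \<times> real \<Rightarrow> real"
  assumes T: "0 < T" and u: "\<And>z. z \<in> spacetime T \<Longrightarrow> u z = u' z" and \<psi>: "\<And>z. z \<in> spacetime T \<Longrightarrow> \<psi> z = \<psi>' z"
    and sol: "viscosity_solution T lam \<psi> H u"
  shows "viscosity_solution T lam \<psi>' H u'"
  unfolding viscosity_solution_def
proof (intro conjI allI impI)
  have sub: "UNIV \<times> {0..<T} \<subseteq> spacetime T" by (auto simp: spacetime_def)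
  show "continuous_on (spacetime T) u'"
    using sol u by (auto simp: viscosity_solution_def cong: continuous_on_cong_simp)
  show "u' (x,T) = \<psi>' (x,T)" for x
    using sol T u[of "(x,T)"] \<psi>[of "(x,T)"] by (simp add: viscosity_solution_def spacetime_def)
  fix \<phi> q :: "(real^'d) \<times> real \<Rightarrow> real" and g :: "(real^'d) \<times> real \<Rightarrow> real^'d" and x t
  assume \<phi>: "C1_with T \<phi> g q"
  show "max (u' (x,t) - \<psi>' (x,t)) (- q (x,t) + lam * u' (x,t) + H x t (g (x,t))) \<le> 0"
    if "local_max_on (UNIV \<times> {0..<T}) (\<lambda>z. u' z - \<phi> z) (x,t)"
  proof -
    have xt: "(x,t) \<in> spacetime T" using that by (auto simp: local_max_on_def spacetime_def)
    have "local_max_on (UNIV \<times> {0..<T}) (\<lambda>z. u z - \<phi> z) (x,t)"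
      by (rule local_max_on_cong[OF _ that]) (use u sub in auto)
    then have "max (u (x,t) - \<psi> (x,t)) (- q (x,t) + lam * u (x,t) + H x t (g (x,t))) \<le> 0"
      using sol \<phi> unfolding viscosity_solution_def by blast
    then show ?thesis using u[OF xt] \<psi>[OF xt] by simp
  qed
  show "max (u' (x,t) - \<psi>' (x,t)) (- q (x,t) + lam * u' (x,t) + H x t (g (x,t))) \<ge> 0"
    if "local_min_on (UNIV \<times> {0..<T}) (\<lambda>z. u' z - \<phi> z) (x,t)"
  proof -
    have xt: "(x,t) \<in> spacetime T" using that by (auto simp: local_min_on_def spacetime_def)
    have "local_min_on (UNIV \<times> {0..<T}) (\<lambda>z. u z - \<phi> z) (x,t)"
      by (rule local_min_on_cong[OF _ that]) (use u sub in auto)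
    then have "max (u (x,t) - \<psi> (x,t)) (- q (x,t) + lam * u (x,t) + H x t (g (x,t))) \<ge> 0"
      using sol \<phi> unfolding viscosity_solution_def by blast
    then show ?thesis using u[OF xt] \<psi>[OF xt] by simp
  qed
qed

lemma (in switching_mode) unique_BUC_viscosity_solutionI:
  assumes "uniformly_continuous_on (spacetime T) \<psi>" "BUC T u" "viscosity_solution T lam \<psi> (hamiltonian f l A p) u"
  shows "unique_BUC_viscosity_solution T lam \<psi> (hamiltonian f l A p) u"
  unfolding unique_BUC_viscosity_solution_def
proof (intro conjI allI impI ballI assms)
  fix v :: "(real^'d) \<times> real \<Rightarrow> real" and z :: "(real^'d) \<times> real"
  assume v: "BUC T v \<and> viscosity_solution T lam \<psi> (hamiltonian f l A p) v" and z: "z \<in> spacetime T"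
  obtain x t where xt: "z = (x,t)" "t \<in> {0..T}" using z by (auto simp: spacetime_def)
  show "v z = u z"
    unfolding xt(1) using comparison[OF assms(1) _ _ assms(2,3) xt(2)] comparison[OF assms(1,2,3) _ _ xt(2)] v
    by (simp add: order_antisym)
qed

text \<open>
  Minimising first over the successor mode at the stopping point gives the obstacle; the minimum is
  attained because there are finitely many modes.
\<close>

lemma value_fun_eq_val:
  fixes p :: "'n::finite \<Rightarrow> bool"
  assumes os: "optimal_stopping f l A T lam p K L M (obstacle C (value_fun f l C A lam T) p) P" and p: "p \<noteq> pbar" and t: "t \<in> {0..T}"
  shows "value_fun f l C A lam T p (x,t) = optimal_stopping.val f l A T lam p (obstacle C (value_fun f l C A lam T) p) (x,t)"
proof -
  interpret optimal_stopping f l A T lam p K L M "obstacle C (value_fun f l C A lam T) p" P by (rule os)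
  let ?V = "value_fun f l C A lam T"
  define J where "J = (\<lambda>(\<alpha>,y,\<tau>,p').
                   (LINT s:{t..\<tau>}|lebesgue. exp (- lam * (s - t)) * l (y s) (\<alpha> s) p s)
                   + exp (- lam * (\<tau> - t)) * (C (y \<tau>) p p' + ?V p' (y \<tau>, \<tau>)))"
  define S where "S = {(\<alpha>,y,\<tau>,p'). \<alpha> \<in> controls A \<and> trajectory f T p x t \<alpha> y \<and> \<tau> \<in> {t..T} \<and> p' \<in> succs p}"
  have V: "?V p (x,t) = Inf (J ` S)"
    by (subst value_fun.simps) (simp add: p J_def S_def)
  have t': "0 \<le> t" "t \<le> T" using t by auto
  have run: "(LINT s:{t..\<tau>}|lebesgue. exp (- lam * (s - t)) * l (y s) (\<alpha> s) p s) = running_cost t \<alpha> y \<tau>"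
    if "\<alpha> \<in> controls A" "trajectory f T p x t \<alpha> y" "\<tau> \<in> {t..T}" for \<alpha> y \<tau>
  proof -
    have "continuous_on {t..\<tau>} y"
      using trajectoryD(1)[OF that(2,1) t'] by (rule continuous_on_subset) (use that(3) in auto)
    then have "rate t \<alpha> y absolutely_integrable_on {t..\<tau>}"
      by (intro rate_absolutely_integrable[OF that(1)]) (use that(3) t' in auto)
    then show ?thesis unfolding running_cost_def by (rule set_lebesgue_integral_eq_integral(2))
  qed
  have J_ge: "cost t \<alpha> y \<tau> \<le> J (\<alpha>,y,\<tau>,p')" if "(\<alpha>,y,\<tau>,p') \<in> S" for \<alpha> y \<tau> p'
    using that run[of \<alpha> y \<tau>] obstacle_le[of p' p C ?V "y \<tau>" \<tau>] by (simp add: S_def J_def cost_def)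
  show ?thesis
  proof (rule antisym)
    show "?V p (x,t) \<le> val (x,t)"
    proof (rule le_valI[OF t])
      fix \<alpha> y \<tau> assume *: "\<alpha> \<in> controls A" "trajectory f T p x t \<alpha> y" "\<tau> \<in> {t..T}"
      obtain q where q: "q \<in> succs p" "obstacle C ?V p (y \<tau>,\<tau>) = C (y \<tau>) p q + ?V q (y \<tau>,\<tau>)"
        using obstacle_attained[OF p] by blast
      have "J (\<alpha>,y,\<tau>,q) = cost t \<alpha> y \<tau>" using run[OF *] q(2) by (simp add: J_def cost_def)
      moreover have "(\<alpha>,y,\<tau>,q) \<in> S" using * q(1) by (simp add: S_def)
      moreover have "bdd_below (J ` S)"
      proof (rule bdd_belowI2)
        fix i assume i: "i \<in> S"
        obtain \<alpha> y \<tau> p' where i_eq: "i = (\<alpha>,y,\<tau>,p')" using prod_cases4 by blast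
        have "0 \<le> cost t \<alpha> y \<tau>" using i t' by (intro cost_nonneg) (auto simp: S_def i_eq)
        then show "0 \<le> J i" using J_ge[of \<alpha> y \<tau> p'] i by (simp add: i_eq)
      qed
      ultimately show "?V p (x,t) \<le> cost t \<alpha> y \<tau>" unfolding V using cINF_lower by metis
    qed
    show "val (x,t) \<le> ?V p (x,t)"
      unfolding V
    proof (rule cINF_greatest)
      obtain q where "q \<in> succs p" using succs_nonempty[OF p] by blast
      then show "S \<noteq> {}" using competitors_nonempty[OF t, of x] by (fastforce simp: S_def)
      fix i assume i: "i \<in> S"
      obtain \<alpha> y \<tau> p' where i_eq: "i = (\<alpha>,y,\<tau>,p')" using prod_cases4 by blast
      have "val (x,t) \<le> cost t \<alpha> y \<tau>" using i t' by (intro val_le_cost) (auto simp: S_def i_eq)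
      also have "\<dots> \<le> J i" using J_ge[of \<alpha> y \<tau> p'] i by (simp add: i_eq)
      finally show "val (x,t) \<le> J i" .
    qed
  qed
qed

lemma value_fun_pbar: "value_fun f l C A lam T pbar z = 0"
  by (cases z) (simp add: value_fun.simps)

text \<open>
  The induction step. Nonnegativity is carried along since the stopping problem is set up for
  nonnegative obstacles.
\<close>

lemma value_fun_step:
  fixes f :: "real^'d \<Rightarrow> real^'m \<Rightarrow> ('n::finite \<Rightarrow> bool) \<Rightarrow> real^'d" and p :: "'n \<Rightarrow> bool"
  assumes sm: "switching_mode f l A T lam p K L M" and p: "p \<noteq> pbar"
    and C_nonneg: "\<And>x q. 0 \<le> C x p q" and C_bound: "\<And>x q. q \<in> succs p \<Longrightarrow> C x p q \<le> B"
    and C_uc: "\<And>e. 0 < e \<Longrightarrow> \<exists>\<delta>>0. \<forall>x y. \<forall>q\<in>succs p. norm (x - y) < \<delta> \<longrightarrow> \<bar>C x p q - C y p q\<bar> < e"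
    and IH: "\<And>q. q \<in> succs p \<Longrightarrow> BUC T (value_fun f l C A lam T q)"
      "\<And>q z. q \<in> succs p \<Longrightarrow> z \<in> spacetime T \<Longrightarrow> 0 \<le> value_fun f l C A lam T q z"
  shows "BUC T (value_fun f l C A lam T p)"
    and "\<And>z. z \<in> spacetime T \<Longrightarrow> 0 \<le> value_fun f l C A lam T p z"
    and "unique_BUC_viscosity_solution T lam (obstacle C (value_fun f l C A lam T) p) (hamiltonian f l A p) (value_fun f l C A lam T p)"
proof -
  interpret switching_mode f l A T lam p K L M by (rule sm)
  let ?V = "value_fun f l C A lam T" and ?\<psi> = "obstacle C (value_fun f l C A lam T) p"
  have \<psi>_uc: "uniformly_continuous_on (spacetime T) ?\<psi>"
    using IH(1) by (intro obstacle_uniformly_continuous[where C = C, OF p C_uc]) (auto simp: BUC_def)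
  obtain q0 where q0: "q0 \<in> succs p" using succs_nonempty[OF p] by blast
  obtain B0 where B0: "\<And>z. z \<in> spacetime T \<Longrightarrow> \<bar>?V q0 z\<bar> \<le> B0"
    using IH(1)[OF q0] unfolding BUC_def bounded_iff by auto
  have bounds: "0 \<le> ?\<psi> (x,t) \<and> ?\<psi> (x,t) \<le> B + B0" if "t \<in> {0..T}" for x t
  proof
    have xt: "(x,t) \<in> spacetime T" using that by (simp add: spacetime_def)
    obtain q where q: "q \<in> succs p" "?\<psi> (x,t) = C x p q + ?V q (x,t)"
      using obstacle_attained[OF p] by blast
    then show "0 \<le> ?\<psi> (x,t)" using C_nonneg[of x q] IH(2)[OF q(1) xt] by simp
    show "?\<psi> (x,t) \<le> B + B0"
      using obstacle_le[OF q0, of C ?V x t] C_bound[OF q0, of x] B0[OF xt] by linarith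
  qed
  interpret os: optimal_stopping f l A T lam p K L M ?\<psi> "B + B0"
    by unfold_locales (use \<psi>_uc bounds in auto)
  have eq: "os.val z = ?V p z" if zT: "z \<in> spacetime T" for z :: "(real^'d) \<times> real"
  proof -
    obtain x t where z: "z = (x,t)" "t \<in> {0..T}" using zT by (auto simp: spacetime_def)
    show ?thesis unfolding z(1)
      by (rule value_fun_eq_val[OF os.optimal_stopping_axioms p z(2), symmetric])
  qed
  show BUC: "BUC T (?V p)" by (rule BUC_cong[OF eq os.val_BUC])
  show "0 \<le> ?V p z" if "z \<in> spacetime T" for z :: "(real^'d) \<times> real"
    using that eq[OF that] os.val_bounds(1)[of "snd z" "fst z"] by (simp add: spacetime_def mem_Times_iff)
  show "unique_BUC_viscosity_solution T lam ?\<psi> (hamiltonian f l A p) (?V p)"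
    by (rule unique_BUC_viscosity_solutionI[OF \<psi>_uc BUC viscosity_solution_cong[OF T_pos eq refl os.val_viscosity_solution]])
qed

theorem theorem2p5:
  fixes f :: "real^'d \<Rightarrow> real^'m \<Rightarrow> ('n::finite \<Rightarrow> bool) \<Rightarrow> real^'d"
    and l :: "real^'d \<Rightarrow> real^'m \<Rightarrow> ('n \<Rightarrow> bool) \<Rightarrow> real \<Rightarrow> real"
    and C :: "real^'d \<Rightarrow> ('n \<Rightarrow> bool) \<Rightarrow> ('n \<Rightarrow> bool) \<Rightarrow> real"
    and A :: "(real^'m) set"
    and lam T :: real
  assumes T_pos: "0 < T"
    and lam_nonneg: "0 \<le> lam"
    and A_compact: "compact A"
    and A_nonempty: "A \<noteq> {}"
    and f_continuous: "continuous_on (UNIV \<times> A \<times> UNIV) (\<lambda>(x,a,p). f x a p)"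
    and f_bounded: "\<exists>K. \<forall>x p. \<forall>a\<in>A. norm (f x a p) \<le> K"
    and f_lipschitz: "\<exists>L>0. \<forall>x y p. \<forall>a\<in>A. norm (f x a p - f y a p) \<le> L * norm (x - y)"
    and l_nonneg: "\<forall>x p. \<forall>a\<in>A. \<forall>t\<in>{0..T}. 0 \<le> l x a p t"
    and l_bounded: "\<exists>K. \<forall>x p. \<forall>a\<in>A. \<forall>t\<in>{0..T}. l x a p t \<le> K"
    and l_continuous: "continuous_on (UNIV \<times> A \<times> UNIV \<times> {0..T}) (\<lambda>(x,a,p,t). l x a p t)"
    and l_unif_continuous:
      "\<forall>e>0. \<exists>\<delta>>0. \<forall>x y p. \<forall>a\<in>A. \<forall>t\<in>{0..T}.
         norm (x - y) < \<delta> \<longrightarrow> \<bar>l x a p t - l y a p t\<bar> < e"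
    and C_nonneg: "\<forall>x p p'. 0 \<le> C x p p'"
    and C_unif_continuous:
      "\<forall>e>0. \<exists>\<delta>>0. \<forall>x y p. \<forall>p'\<in>succs p.
         norm (x - y) < \<delta> \<longrightarrow> \<bar>C x p p' - C y p p'\<bar> < e"
    and C_bounded: "\<exists>K. \<forall>x p. \<forall>p'\<in>succs p. C x p p' \<le> K"
  shows "solves_system f l C A lam T (value_fun f l C A lam T) \<and>
    (\<forall>U. solves_system f l C A lam T U \<longrightarrow>
         (\<forall>p. \<forall>z\<in>spacetime T. U p z = value_fun f l C A lam T p z))"
proof -
  obtain K where K: "\<And>x p a. a \<in> A \<Longrightarrow> norm (f x a p) \<le> K" using f_bounded by blast
  obtain L where L: "L > 0" "\<And>x y p a. a \<in> A \<Longrightarrow> norm (f x a p - f y a p) \<le> L * norm (x - y)"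
    using f_lipschitz by blast
  obtain M where M: "\<And>x p a t. a \<in> A \<Longrightarrow> t \<in> {0..T} \<Longrightarrow> l x a p t \<le> M" using l_bounded by blast
  obtain B where B: "\<And>x p p'. p' \<in> succs p \<Longrightarrow> C x p p' \<le> B" using C_bounded by blast
  let ?V = "value_fun f l C A lam T"
  have mode: "switching_mode f l A T lam p K L M" for p
  proof
    have "continuous_on (UNIV \<times> A) (\<lambda>z. case (fst z, snd z, p) of (x,a,p) \<Rightarrow> f x a p)"
      by (rule continuous_on_compose2[OF f_continuous]) (auto intro!: continuous_intros)
    then show "continuous_on (UNIV \<times> A) (\<lambda>(x,a). f x a p)" by (simp add: split_def)
    have "continuous_on (UNIV \<times> A \<times> {0..T}) (\<lambda>z. case (fst z, fst (snd z), p, snd (snd z)) of (x,a,p,t) \<Rightarrow> l x a p t)"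
      by (rule continuous_on_compose2[OF l_continuous]) (auto intro!: continuous_intros)
    then show "continuous_on (UNIV \<times> A \<times> {0..T}) (\<lambda>(x,a,t). l x a p t)" by (simp add: split_def)
    show "\<forall>e>0. \<exists>\<delta>>0. \<forall>x y. \<forall>a\<in>A. \<forall>t\<in>{0..T}. norm (x - y) < \<delta> \<longrightarrow> \<bar>l x a p t - l y a p t\<bar> < e"
      using l_unif_continuous by meson
  qed (use T_pos lam_nonneg A_compact A_nonempty K L M l_nonneg in auto)
  have C_uc: "\<exists>\<delta>>0. \<forall>x y. \<forall>q\<in>succs p. norm (x - y) < \<delta> \<longrightarrow> \<bar>C x p q - C y p q\<bar> < e" if "0 < e" for e p
    using C_unif_continuous that by meson
  have V: "BUC T (?V p) \<and> (\<forall>z\<in>spacetime T. 0 \<le> ?V p z)" for p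
  proof (induction "card {i. \<not> p i}" arbitrary: p rule: less_induct)
    case less
    have IH: "BUC T (?V q)" "z \<in> spacetime T \<Longrightarrow> 0 \<le> ?V q z" if "q \<in> succs p" for q and z :: "(real^'d) \<times> real"
      using less card_zeros_succs[OF that] by auto
    show ?case
    proof (cases "p = pbar")
      case True
      have "BUC T (\<lambda>z. 0)" unfolding BUC_def by (auto intro: uniformly_continuous_on_const bounded_subset[of "{0}"])
      then have "BUC T (?V p)" by (rule BUC_cong[rotated]) (simp add: True value_fun_pbar)
      then show ?thesis by (simp add: True value_fun_pbar)
    next
      case False
      show ?thesis
        using value_fun_step(1,2)[where C = C and B = B, OF mode False _ B C_uc IH] C_nonneg by blast
    qed
  qed
  have V_solves: "solves_system f l C A lam T ?V"
    unfolding solves_system_def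
  proof (intro conjI allI impI ballI)
    show "BUC T (?V p)" for p using V by blast
    show "?V pbar z = 0" for z by (rule value_fun_pbar)
    show "unique_BUC_viscosity_solution T lam (obstacle C ?V p) (hamiltonian f l A p) (?V p)" if "p \<noteq> pbar" for p
      using value_fun_step(3)[where C = C and B = B, OF mode that _ B C_uc] C_nonneg V by blast
  qed
  moreover have "U p z = ?V p z" if U: "solves_system f l C A lam T U" and z: "z \<in> spacetime T" for U p and z :: "(real^'d) \<times> real"
    using z
  proof (induction "card {i. \<not> p i}" arbitrary: p z rule: less_induct)
    case less
    have IH: "U q z = ?V q z" if "q \<in> succs p" "z \<in> spacetime T" for q and z :: "(real^'d) \<times> real"
      using less(1) card_zeros_succs[OF that(1)] that(2) by blast
    show ?case
    proof (cases "p = pbar")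
      case True
      then show ?thesis using U less(2) by (simp add: solves_system_def value_fun_pbar)
    next
      case False
      have eq: "obstacle C U p z = obstacle C ?V p z" if "z \<in> spacetime T" for z :: "(real^'d) \<times> real"
      proof -
        obtain x t where z: "z = (x,t)" by fastforce
        show ?thesis unfolding obstacle_def z prod.case
          by (rule INF_cong[OF refl]) (use IH that z in auto)
      qed
      have "BUC T (U p)" "viscosity_solution T lam (obstacle C U p) (hamiltonian f l A p) (U p)"
        using U False by (auto simp: solves_system_def unique_BUC_viscosity_solution_def)
      moreover from viscosity_solution_cong[OF T_pos refl eq this(2)]
      have "viscosity_solution T lam (obstacle C ?V p) (hamiltonian f l A p) (U p)" .
      ultimately show ?thesis
        using V_solves False less(2) unfolding solves_system_def unique_BUC_viscosity_solution_def by blast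
    qed
  qed
  ultimately show ?thesis by blast
qed

end
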